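(* Let $\Lambda$ be an Artin algebra and let $(P\xrightarrow{f}Q)$ be an indecomposable non-projective object of the morphism category $\mathcal H$ of $\Lambda$ with $P$ and $Q$ projective $\Lambda$-modules. Set $M=\mathrm{Coker}(P\xrightarrow{f}Q)$. Then $\tau_{\mathcal H}(P\xrightarrow{f}Q)=(0\to\tau M)$ (up to isomorphism).
   Context: $\mathrm{mod}\,\Lambda$ is the category of finitely generated left $\Lambda$-modules and $\tau$ its Auslander-Reiten translation. The morphism category $\mathcal H=H(\Lambda)$ has as objects the maps $(A\xrightarrow{f}B)$ in $\mathrm{mod}\,\Lambda$; a morphism from $(A\xrightarrow{f}B)$ to $(C\xrightarrow{g}D)$ is a pair $(h_1,h_2)$ with $h_1:A\to C$, $h_2:B\to D$, $gh_1=h_2f$. It is equivalent to the category of finitely generated modules over $T_2(\Lambda)=\begin{pmatrix}\Lambda&\Lambda\\0&\Lambda\end{pmatrix}$; its indecomposable projective objects are $(0\to P)$ and $(P\xrightarrow{1}P)$ with $P$ an indecomposable projective $\Lambda$-module, and $\tau_{\mathcal H}$ denotes the Auslander-Reiten translation ($D\,\mathrm{Tr}$) of $\mathcal H$.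
   Formalization: The formal statement additionally assumes Q ≠ 0: for an indecomposable projective P, the object (P → 0) meets all hypotheses with M = 0, but its translate is (0 → νP) ≠ 0 (ν the Nakayama functor), so the claim fails exactly there. *)

theory Defs
  imports "HOL-Algebra.RingHom" "HOL-Algebra.Module"
begin

section \<open>Left modules over a noncommutative ring\<close>

text \<open>
  The library locale \<open>module\<close> requires a commutative ring of scalars; this is the same list of
  axioms over an arbitrary ring. As in the library, the fields \<open>mult\<close> and \<open>one\<close> of a module
  record carry no meaning. The library's \<open>submodule\<close> does not mention commutativity and is used
  unchanged. Right modules over \<open>R\<close> are treated as left modules over the opposite ring, that is,
  \<open>a \<odot> x\<close> stands for \<open>x a\<close>.
\<close>

locale left_module = R?: ring R + M?: abelian_group M
  for R (structure) and M :: "('a, 'm, 's) module_scheme" (structure) +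
  assumes smult_closed:
      "\<lbrakk>a \<in> carrier R; x \<in> carrier M\<rbrakk> \<Longrightarrow> a \<odot>\<^bsub>M\<^esub> x \<in> carrier M"
    and smult_l_distr:
      "\<lbrakk>a \<in> carrier R; b \<in> carrier R; x \<in> carrier M\<rbrakk> \<Longrightarrow>
       (a \<oplus> b) \<odot>\<^bsub>M\<^esub> x = a \<odot>\<^bsub>M\<^esub> x \<oplus>\<^bsub>M\<^esub> b \<odot>\<^bsub>M\<^esub> x"
    and smult_r_distr:
      "\<lbrakk>a \<in> carrier R; x \<in> carrier M; y \<in> carrier M\<rbrakk> \<Longrightarrow>
       a \<odot>\<^bsub>M\<^esub> (x \<oplus>\<^bsub>M\<^esub> y) = a \<odot>\<^bsub>M\<^esub> x \<oplus>\<^bsub>M\<^esub> a \<odot>\<^bsub>M\<^esub> y"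
    and smult_assoc1:
      "\<lbrakk>a \<in> carrier R; b \<in> carrier R; x \<in> carrier M\<rbrakk> \<Longrightarrow>
       (a \<otimes> b) \<odot>\<^bsub>M\<^esub> x = a \<odot>\<^bsub>M\<^esub> (b \<odot>\<^bsub>M\<^esub> x)"
    and smult_one:
      "x \<in> carrier M \<Longrightarrow> \<one> \<odot>\<^bsub>M\<^esub> x = x"

definition regular_module :: "('a, 'r) ring_scheme \<Rightarrow> ('a, 'a) module" where
  "regular_module R =
     \<lparr>carrier = carrier R, mult = mult R, one = one R, zero = zero R, add = add R, smult = mult R\<rparr>"

definition lin_hom ::
    "('a, 'r) ring_scheme \<Rightarrow> ('a, 'm) module \<Rightarrow> ('a, 'n) module \<Rightarrow> ('m \<Rightarrow> 'n) set" where
  "lin_hom R M N =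
     {f \<in> carrier M \<rightarrow> carrier N.
        (\<forall>x\<in>carrier M. \<forall>y\<in>carrier M. f (x \<oplus>\<^bsub>M\<^esub> y) = f x \<oplus>\<^bsub>N\<^esub> f y) \<and>
        (\<forall>a\<in>carrier R. \<forall>x\<in>carrier M. f (a \<odot>\<^bsub>M\<^esub> x) = a \<odot>\<^bsub>N\<^esub> f x)}"

definition zero_module :: "('a, unit) module" where
  "zero_module =
     \<lparr>carrier = {()}, mult = (\<lambda>_ _. ()), one = (), zero = (), add = (\<lambda>_ _. ()), smult = (\<lambda>_ _. ())\<rparr>"

definition direct_sum :: "('a, 'm) module \<Rightarrow> ('a, 'n) module \<Rightarrow> ('a, 'm \<times> 'n) module" where
  "direct_sum M N =
     \<lparr>carrier = carrier M \<times> carrier N, mult = undefined, one = undefined,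
      zero = (\<zero>\<^bsub>M\<^esub>, \<zero>\<^bsub>N\<^esub>),
      add = (\<lambda>(x, y) (x', y'). (x \<oplus>\<^bsub>M\<^esub> x', y \<oplus>\<^bsub>N\<^esub> y')),
      smult = (\<lambda>a (x, y). (a \<odot>\<^bsub>M\<^esub> x, a \<odot>\<^bsub>N\<^esub> y))\<rparr>"

definition quotient_module :: "('a, 'm) module \<Rightarrow> 'm set \<Rightarrow> ('a, 'm set) module" where
  "quotient_module M N =
     \<lparr>carrier = a_rcosets\<^bsub>M\<^esub> N, mult = undefined, one = undefined,
      zero = N, add = set_add M,
      smult = (\<lambda>a C. \<Union>x\<in>C. N +>\<^bsub>M\<^esub> (a \<odot>\<^bsub>M\<^esub> x))\<rparr>"

definition cokernel ::
    "('a, 'm) module \<Rightarrow> ('a, 'n) module \<Rightarrow> ('m \<Rightarrow> 'n) \<Rightarrow> ('a, 'n set) module" where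
  "cokernel M N f = quotient_module N (f ` carrier M)"

definition restrict_scalars :: "('c \<Rightarrow> 'a) \<Rightarrow> ('a, 'm) module \<Rightarrow> ('c, 'm) module" where
  "restrict_scalars \<phi> M =
     \<lparr>carrier = carrier M, mult = mult M, one = one M, zero = zero M, add = add M,
      smult = (\<lambda>c x. \<phi> c \<odot>\<^bsub>M\<^esub> x)\<rparr>"

definition finitely_generated :: "('a, 'r) ring_scheme \<Rightarrow> ('a, 'm) module \<Rightarrow> bool" where
  "finitely_generated R M \<longleftrightarrow>
     (\<exists>S. finite S \<and> S \<subseteq> carrier M \<and> (\<forall>N. submodule N R M \<and> S \<subseteq> N \<longrightarrow> N = carrier M))"

definition fg_module :: "('a, 'r) ring_scheme \<Rightarrow> ('a, 'm) module \<Rightarrow> bool" where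
  "fg_module R M \<longleftrightarrow> left_module R M \<and> finitely_generated R M"

section \<open>Projective and injective modules\<close>

text \<open>
  Lifting properties quantify over all finitely generated modules. Such a module is isomorphic to
  a quotient of some \<open>R\<^sup>n\<close>, whose elements are cosets of \<open>n\<close>-tuples; hence modules whose elements
  have type \<open>(nat \<Rightarrow> 'a) set\<close> represent all isomorphism classes, and it suffices to quantify
  over this type.
\<close>

type_synonym 'a univ = "(nat \<Rightarrow> 'a) set"

definition projective_module :: "('a, 'r) ring_scheme \<Rightarrow> ('a, 'm) module \<Rightarrow> bool" where
  "projective_module R P \<longleftrightarrow>
     fg_module R P \<and>
     (\<forall>(Y :: ('a, 'a univ) module) (Z :: ('a, 'a univ) module) g h.
        fg_module R Y \<and> fg_module R Z \<and>
        g \<in> lin_hom R Y Z \<and> g ` carrier Y = carrier Z \<and> h \<in> lin_hom R P Z \<longrightarrow>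
        (\<exists>l \<in> lin_hom R P Y. \<forall>x\<in>carrier P. g (l x) = h x))"

text \<open>
  Over a Noetherian ring, testing injectivity on finitely generated modules is enough, by Baer's
  criterion. Below this is only used over the commutative Artinian base ring.
\<close>

definition injective_module :: "('a, 'r) ring_scheme \<Rightarrow> ('a, 'm) module \<Rightarrow> bool" where
  "injective_module R J \<longleftrightarrow>
     left_module R J \<and>
     (\<forall>(Y :: ('a, 'a univ) module) (Z :: ('a, 'a univ) module) i h.
        fg_module R Y \<and> fg_module R Z \<and>
        i \<in> lin_hom R Y Z \<and> inj_on i (carrier Y) \<and> h \<in> lin_hom R Y J \<longrightarrow>
        (\<exists>l \<in> lin_hom R Z J. \<forall>y\<in>carrier Y. l (i y) = h y))"

definition injective_envelope ::
    "('a, 'r) ring_scheme \<Rightarrow> ('a, 'm) module \<Rightarrow> ('a, 'n) module \<Rightarrow> bool" where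
  "injective_envelope R S J \<longleftrightarrow>
     injective_module R J \<and>
     (\<exists>\<iota> \<in> lin_hom R S J. inj_on \<iota> (carrier S) \<and>
        (\<forall>N. submodule N R J \<and> N \<inter> \<iota> ` carrier S = {\<zero>\<^bsub>J\<^esub>} \<longrightarrow> N = {\<zero>\<^bsub>J\<^esub>}))"

definition projective_cover ::
    "('a, 'r) ring_scheme \<Rightarrow> ('a, 'm) module \<Rightarrow> ('m \<Rightarrow> 'n) \<Rightarrow> ('a, 'n) module \<Rightarrow> bool" where
  "projective_cover R P p M \<longleftrightarrow>
     projective_module R P \<and> p \<in> lin_hom R P M \<and> p ` carrier P = carrier M \<and>
     (\<forall>N. submodule N R P \<and> N <+>\<^bsub>P\<^esub> a_kernel P M p = carrier P \<longrightarrow> N = carrier P)"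

definition minimal_presentation ::
    "('a, 'r) ring_scheme \<Rightarrow> ('a, 'm) module \<Rightarrow> ('m \<Rightarrow> 'n) \<Rightarrow> ('a, 'n) module \<Rightarrow> ('n \<Rightarrow> 'l) \<Rightarrow>
     ('a, 'l) module \<Rightarrow> bool" where
  "minimal_presentation R P1 d P0 p M \<longleftrightarrow>
     projective_cover R P0 p M \<and>
     projective_cover R P1 d (P0\<lparr>carrier := a_kernel P0 M p\<rparr>)"

section \<open>Artin algebras and the Auslander-Reiten translation\<close>

definition artinian_ring :: "('c, 'k) ring_scheme \<Rightarrow> bool" where
  "artinian_ring k \<longleftrightarrow>
     ring k \<and>
     (\<forall>I :: nat \<Rightarrow> 'c set. (\<forall>n. ideal (I n) k) \<and> (\<forall>n. I (Suc n) \<subseteq> I n) \<longrightarrow>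
        (\<exists>n. \<forall>m\<ge>n. I m = I n))"

text \<open>
  \<open>R\<close> is an algebra over the commutative Artinian ring \<open>k\<close> by way of \<open>\<phi> : k \<rightarrow> Z(R)\<close>, and it is
  finitely generated as a \<open>k\<close>-module.
\<close>

definition artin_algebra ::
    "('c, 'k) ring_scheme \<Rightarrow> ('c \<Rightarrow> 'a) \<Rightarrow> ('a, 'r) ring_scheme \<Rightarrow> bool" where
  "artin_algebra k \<phi> R \<longleftrightarrow>
     cring k \<and> artinian_ring k \<and> ring R \<and> \<phi> \<in> ring_hom k R \<and>
     (\<forall>c\<in>carrier k. \<forall>a\<in>carrier R. \<phi> c \<otimes>\<^bsub>R\<^esub> a = a \<otimes>\<^bsub>R\<^esub> \<phi> c) \<and>
     finitely_generated k (restrict_scalars \<phi> (regular_module R))"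

definition jacobson_radical :: "('c, 'k) ring_scheme \<Rightarrow> 'c set" where
  "jacobson_radical k = carrier k \<inter> \<Inter>{I. maximalideal I k}"

text \<open>
  \<open>J\<close> is an injective envelope of \<open>k/rad k\<close>, so that \<open>Hom\<^sub>k(-, J)\<close> is the standard duality of an
  Artin \<open>k\<close>-algebra.
\<close>

definition dualizing_module :: "('c, 'k) ring_scheme \<Rightarrow> ('c, 'e) module \<Rightarrow> bool" where
  "dualizing_module k J \<longleftrightarrow>
     injective_envelope k (quotient_module (regular_module k) (jacobson_radical k)) J"

text \<open>
  The right module \<open>Hom\<^sub>R(M, R)\<close>, with \<open>(f a) x = f x a\<close>. Functions are
  \<^const>\<open>extensional\<close> so that equality of maps is equality on the carrier.
\<close>

definition ring_dual :: "('a, 'r) ring_scheme \<Rightarrow> ('a, 'm) module \<Rightarrow> ('a, 'm \<Rightarrow> 'a) module" where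
  "ring_dual R M =
     \<lparr>carrier = lin_hom R M (regular_module R) \<inter> extensional (carrier M),
      mult = undefined, one = undefined,
      zero = (\<lambda>x\<in>carrier M. \<zero>\<^bsub>R\<^esub>),
      add = (\<lambda>f g. \<lambda>x\<in>carrier M. f x \<oplus>\<^bsub>R\<^esub> g x),
      smult = (\<lambda>a f. \<lambda>x\<in>carrier M. f x \<otimes>\<^bsub>R\<^esub> a)\<rparr>"

text \<open>
  \<open>Tr M\<close> is the cokernel of \<open>Hom\<^sub>R(P\<^sub>0, R) \<rightarrow> Hom\<^sub>R(P\<^sub>1, R)\<close> for a minimal projective
  presentation \<open>P\<^sub>1 \<rightarrow> P\<^sub>0 \<rightarrow> M \<rightarrow> 0\<close>; it is a right \<open>R\<close>-module. Minimal presentations of a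
  finitely generated module over an Artin algebra exist and are unique up to isomorphism, so
  choosing one fixes \<open>Tr M\<close> up to isomorphism.
\<close>

definition transpose ::
    "('a, 'r) ring_scheme \<Rightarrow> ('a, 'm) module \<Rightarrow> ('a, ('a univ \<Rightarrow> 'a) set) module" where
  "transpose R M =
     (let (P1, d, P0) = SOME (P1 :: ('a, 'a univ) module, d, P0 :: ('a, 'a univ) module).
            \<exists>p. minimal_presentation R P1 d P0 p M
      in cokernel (ring_dual R P0) (ring_dual R P1) (\<lambda>g. \<lambda>x\<in>carrier P1. g (d x)))"

text \<open>
  The dual \<open>Hom\<^sub>k(N, J)\<close> of a right module \<open>N\<close>, a left module by \<open>(a g) x = g (x a)\<close>; recall that
  \<open>x a\<close> is written \<open>a \<odot> x\<close>.
\<close>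

definition duality ::
    "('c, 'k) ring_scheme \<Rightarrow> ('c \<Rightarrow> 'a) \<Rightarrow> ('c, 'e) module \<Rightarrow> ('a, 'm) module \<Rightarrow>
     ('a, 'm \<Rightarrow> 'e) module" where
  "duality k \<phi> J N =
     \<lparr>carrier = lin_hom k (restrict_scalars \<phi> N) J \<inter> extensional (carrier N),
      mult = undefined, one = undefined,
      zero = (\<lambda>x\<in>carrier N. \<zero>\<^bsub>J\<^esub>),
      add = (\<lambda>f g. \<lambda>x\<in>carrier N. f x \<oplus>\<^bsub>J\<^esub> g x),
      smult = (\<lambda>a g. \<lambda>x\<in>carrier N. g (a \<odot>\<^bsub>N\<^esub> x))\<rparr>"

definition AR_translation ::
    "('c, 'k) ring_scheme \<Rightarrow> ('c \<Rightarrow> 'a) \<Rightarrow> ('c, 'e) module \<Rightarrow> ('a, 'r) ring_scheme \<Rightarrow>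
     ('a, 'm) module \<Rightarrow> ('a, ('a univ \<Rightarrow> 'a) set \<Rightarrow> 'e) module" where
  "AR_translation k \<phi> J R M = duality k \<phi> J (transpose R M)"

section \<open>The morphism category\<close>

record ('a, 'm, 'n) mor =
  src :: "('a, 'm) module"
  tgt :: "('a, 'n) module"
  arr :: "'m \<Rightarrow> 'n"

definition mor_obj :: "('a, 'r) ring_scheme \<Rightarrow> ('a, 'm, 'n) mor \<Rightarrow> bool" where
  "mor_obj R X \<longleftrightarrow>
     fg_module R (src X) \<and> fg_module R (tgt X) \<and> arr X \<in> lin_hom R (src X) (tgt X)"

definition mor_hom ::
    "('a, 'r) ring_scheme \<Rightarrow> ('a, 'm, 'n) mor \<Rightarrow> ('a, 'p, 'q) mor \<Rightarrow>
     (('m \<Rightarrow> 'p) \<times> ('n \<Rightarrow> 'q)) set" where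
  "mor_hom R X Y =
     {(h1, h2). h1 \<in> lin_hom R (src X) (src Y) \<and> h2 \<in> lin_hom R (tgt X) (tgt Y) \<and>
        (\<forall>x\<in>carrier (src X). arr Y (h1 x) = h2 (arr X x))}"

definition mor_iso ::
    "('a, 'r) ring_scheme \<Rightarrow> ('a, 'm, 'n) mor \<Rightarrow> ('a, 'p, 'q) mor \<Rightarrow> bool" where
  "mor_iso R X Y \<longleftrightarrow>
     (\<exists>(h1, h2) \<in> mor_hom R X Y.
        bij_betw h1 (carrier (src X)) (carrier (src Y)) \<and>
        bij_betw h2 (carrier (tgt X)) (carrier (tgt Y)))"

definition mor_zero :: "('a, 'm, 'n) mor \<Rightarrow> bool" where
  "mor_zero X \<longleftrightarrow> carrier (src X) = {\<zero>\<^bsub>src X\<^esub>} \<and> carrier (tgt X) = {\<zero>\<^bsub>tgt X\<^esub>}"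

definition mor_sum ::
    "('a, 'm, 'n) mor \<Rightarrow> ('a, 'p, 'q) mor \<Rightarrow> ('a, 'm \<times> 'p, 'n \<times> 'q) mor" where
  "mor_sum X Y =
     \<lparr>src = direct_sum (src X) (src Y), tgt = direct_sum (tgt X) (tgt Y),
      arr = map_prod (arr X) (arr Y)\<rparr>"

text \<open>
  A direct summand of \<open>X\<close> is isomorphic to a subobject of \<open>X\<close>, so it is enough to let the
  summands range over objects with the element types of \<open>X\<close>.
\<close>

definition mor_indecomposable ::
    "('a, 'r) ring_scheme \<Rightarrow> ('a, 'm, 'n) mor \<Rightarrow> bool" where
  "mor_indecomposable R X \<longleftrightarrow>
     mor_obj R X \<and> \<not> mor_zero X \<and>
     (\<forall>(Y :: ('a, 'm, 'n) mor) (Z :: ('a, 'm, 'n) mor).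
        mor_obj R Y \<and> mor_obj R Z \<and> mor_iso R X (mor_sum Y Z) \<longrightarrow> mor_zero Y \<or> mor_zero Z)"

text \<open>
  The epimorphisms of the morphism category are the pairs of surjective maps.
\<close>

definition mor_projective :: "('a, 'r) ring_scheme \<Rightarrow> ('a, 'm, 'n) mor \<Rightarrow> bool" where
  "mor_projective R X \<longleftrightarrow>
     mor_obj R X \<and>
     (\<forall>(Y :: ('a, 'a univ, 'a univ) mor) (Z :: ('a, 'a univ, 'a univ) mor) g1 g2 h1 h2.
        mor_obj R Y \<and> mor_obj R Z \<and>
        (g1, g2) \<in> mor_hom R Y Z \<and>
        g1 ` carrier (src Y) = carrier (src Z) \<and> g2 ` carrier (tgt Y) = carrier (tgt Z) \<and>
        (h1, h2) \<in> mor_hom R X Z \<longrightarrow>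
        (\<exists>(l1, l2) \<in> mor_hom R X Y.
           (\<forall>x\<in>carrier (src X). g1 (l1 x) = h1 x) \<and> (\<forall>x\<in>carrier (tgt X). g2 (l2 x) = h2 x)))"

text \<open>
  \<open>T2 R\<close> is the ring of upper triangular \<open>2 \<times> 2\<close> matrices over \<open>R\<close>; the triple \<open>(a, b, c)\<close>
  stands for the matrix with first row \<open>a, b\<close> and second row \<open>0, c\<close>.
\<close>

definition T2 :: "('a, 'r) ring_scheme \<Rightarrow> ('a \<times> 'a \<times> 'a) ring" where
  "T2 R =
     \<lparr>carrier = carrier R \<times> carrier R \<times> carrier R,
      mult = (\<lambda>(a, b, c) (a', b', c').
                (a \<otimes>\<^bsub>R\<^esub> a', a \<otimes>\<^bsub>R\<^esub> b' \<oplus>\<^bsub>R\<^esub> b \<otimes>\<^bsub>R\<^esub> c', c \<otimes>\<^bsub>R\<^esub> c')),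
      one = (\<one>\<^bsub>R\<^esub>, \<zero>\<^bsub>R\<^esub>, \<one>\<^bsub>R\<^esub>),
      zero = (\<zero>\<^bsub>R\<^esub>, \<zero>\<^bsub>R\<^esub>, \<zero>\<^bsub>R\<^esub>),
      add = (\<lambda>(a, b, c) (a', b', c'). (a \<oplus>\<^bsub>R\<^esub> a', b \<oplus>\<^bsub>R\<^esub> b', c \<oplus>\<^bsub>R\<^esub> c'))\<rparr>"

definition T2_scalar :: "('a, 'r) ring_scheme \<Rightarrow> ('c \<Rightarrow> 'a) \<Rightarrow> 'c \<Rightarrow> 'a \<times> 'a \<times> 'a" where
  "T2_scalar R \<phi> c = (\<phi> c, \<zero>\<^bsub>R\<^esub>, \<phi> c)"

text \<open>
  The equivalence between the morphism category and the finitely generated left \<open>T2 R\<close>-modules.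
  An object \<open>f : A \<rightarrow> B\<close> goes to the module of column vectors with upper entry in \<open>B\<close> and lower
  entry in \<open>A\<close>, on which \<open>(a, b, c)\<close> acts by \<open>(y, x) \<mapsto> (a y + b f(x), c x)\<close>. In the other
  direction, \<open>N\<close> goes to \<open>e\<^sub>1\<^sub>2 : e\<^sub>2\<^sub>2 N \<rightarrow> e\<^sub>1\<^sub>1 N\<close>.
\<close>

definition mor_to_T2 :: "('a, 'm, 'n) mor \<Rightarrow> ('a \<times> 'a \<times> 'a, 'n \<times> 'm) module" where
  "mor_to_T2 X =
     \<lparr>carrier = carrier (tgt X) \<times> carrier (src X), mult = undefined, one = undefined,
      zero = (\<zero>\<^bsub>tgt X\<^esub>, \<zero>\<^bsub>src X\<^esub>),
      add = (\<lambda>(y, x) (y', x'). (y \<oplus>\<^bsub>tgt X\<^esub> y', x \<oplus>\<^bsub>src X\<^esub> x')),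
      smult = (\<lambda>(a, b, c) (y, x).
                 ((a \<odot>\<^bsub>tgt X\<^esub> y) \<oplus>\<^bsub>tgt X\<^esub> (b \<odot>\<^bsub>tgt X\<^esub> arr X x), c \<odot>\<^bsub>src X\<^esub> x))\<rparr>"

definition T2_to_mor ::
    "('a, 'r) ring_scheme \<Rightarrow> ('a \<times> 'a \<times> 'a, 'n) module \<Rightarrow> ('a, 'n, 'n) mor" where
  "T2_to_mor R N =
     (let e11 = (\<one>\<^bsub>R\<^esub>, \<zero>\<^bsub>R\<^esub>, \<zero>\<^bsub>R\<^esub>);
          e12 = (\<zero>\<^bsub>R\<^esub>, \<one>\<^bsub>R\<^esub>, \<zero>\<^bsub>R\<^esub>);
          e22 = (\<zero>\<^bsub>R\<^esub>, \<zero>\<^bsub>R\<^esub>, \<one>\<^bsub>R\<^esub>);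
          part = (\<lambda>e. \<lparr>carrier = (\<lambda>x. e \<odot>\<^bsub>N\<^esub> x) ` carrier N,
                       mult = undefined, one = undefined, zero = \<zero>\<^bsub>N\<^esub>, add = add N,
                       smult = (\<lambda>a x. (a, \<zero>\<^bsub>R\<^esub>, a) \<odot>\<^bsub>N\<^esub> x)\<rparr>)
      in \<lparr>src = part e22, tgt = part e11, arr = (\<lambda>x. e12 \<odot>\<^bsub>N\<^esub> x)\<rparr>)"

text \<open>
  The translation \<open>D Tr\<close> of the morphism category is that of the Artin \<open>k\<close>-algebra \<open>T2 R\<close>, carried
  over by the equivalence.
\<close>

definition mor_AR_translation ::
    "('c, 'k) ring_scheme \<Rightarrow> ('c \<Rightarrow> 'a) \<Rightarrow> ('c, 'e) module \<Rightarrow> ('a, 'r) ring_scheme \<Rightarrow>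
     ('a, 'm, 'n) mor \<Rightarrow>
     ('a, (('a \<times> 'a \<times> 'a) univ \<Rightarrow> 'a \<times> 'a \<times> 'a) set \<Rightarrow> 'e,
          (('a \<times> 'a \<times> 'a) univ \<Rightarrow> 'a \<times> 'a \<times> 'a) set \<Rightarrow> 'e) mor" where
  "mor_AR_translation k \<phi> J R X =
     T2_to_mor R (AR_translation k (T2_scalar R \<phi>) J (T2 R) (mor_to_T2 X))"

end

theory Submission
  imports Defs
begin

text \<open>
  Since \<open>(P \<rightarrow> Q)\<close> is indecomposable and neither projective nor of the form \<open>P \<rightarrow> 0\<close>, the image of \<open>f\<close>
  is superfluous in \<open>Q\<close> and the kernel of \<open>f\<close> is superfluous in \<open>P\<close>: otherwise an idempotent
  endomorphism would split off a summand \<open>P' = P'\<close> or \<open>P' \<rightarrow> 0\<close>. Hence \<open>P \<rightarrow> Q \<rightarrow> M \<rightarrow> 0\<close> is a minimal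
  projective presentation of \<open>M\<close>, and \<open>(0 \<rightarrow> P) \<rightarrow> (P \<rightarrow> P \<oplus> Q) \<rightarrow> (P \<rightarrow> Q) \<rightarrow> 0\<close> is one in the morphism
  category. Applying \<open>Hom(-, T2 \<Lambda>)\<close> to the latter and cancelling the part that factors through the
  identity of \<open>P\<close> leaves \<open>Hom(Q, \<Lambda>) \<rightarrow> Hom(P, \<Lambda>)\<close> concentrated in the first column, so the two
  transposes agree and the dual has zero source.
\<close>

text \<open>The case \<open>Q = 0\<close> has to be excluded: an indecomposable projective
  \<open>P\<close> gives a non-projective object \<open>P -> 0\<close> whose cokernel is zero, while
  its translate has the non-zero target \<open>D Hom(P, \<Lambda>)\<close>.

  Two things shape the rest. \<open>transpose\<close> chooses its presentation, and only among
  modules with elements in \<open>'a univ\<close>, so neither translate can be computed directly.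
  Both are compared through \<open>nakayama_kernel\<close>, the kernel of
  \<open>D Hom(P1, R) -> D Hom(P0, R)\<close>, which every minimal presentation of any element type
  yields up to isomorphism. Likewise the lifting property of a projective module is postulated only
  against modules over \<open>'a univ\<close>; a finite dual basis is extracted from it once, and
  lifts to modules of every element type are then given by a formula.\<close>

declare (in left_module) smult_closed [simp, intro]

section \<open>Submodules, linear maps and finite generation over a ring that need not be
  commutative\<close>

context left_module
begin

lemma smult_l_null: "x \<in> carrier M \<Longrightarrow> \<zero> \<odot>\<^bsub>M\<^esub> x = \<zero>\<^bsub>M\<^esub>"
  by (metis M.add.r_cancel_one' R.l_zero R.zero_closed smult_closed smult_l_distr)

lemma smult_r_null: "a \<in> carrier R \<Longrightarrow> a \<odot>\<^bsub>M\<^esub> \<zero>\<^bsub>M\<^esub> = \<zero>\<^bsub>M\<^esub>"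
  by (metis M.add.r_cancel_one' M.l_zero M.zero_closed smult_closed smult_r_distr)

lemma smult_r_minus:
  "\<lbrakk>a \<in> carrier R; x \<in> carrier M\<rbrakk> \<Longrightarrow> a \<odot>\<^bsub>M\<^esub> (\<ominus>\<^bsub>M\<^esub> x) = \<ominus>\<^bsub>M\<^esub> (a \<odot>\<^bsub>M\<^esub> x)"
  by (metis M.add.inv_closed M.l_neg M.minus_equality smult_closed smult_r_distr smult_r_null)

lemma smult_minus_one: "x \<in> carrier M \<Longrightarrow> (\<ominus> \<one>) \<odot>\<^bsub>M\<^esub> x = \<ominus>\<^bsub>M\<^esub> x"
  by (metis M.minus_equality R.add.inv_closed R.l_neg R.one_closed smult_closed smult_l_distr
      smult_l_null smult_one)

text \<open>Negatives come for free from closure under the scalar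
  \<open>\<ominus> \<one>\<close>.\<close>

lemma submoduleI':
  assumes "N \<subseteq> carrier M" "\<zero>\<^bsub>M\<^esub> \<in> N"
    and "\<And>x y. \<lbrakk>x \<in> N; y \<in> N\<rbrakk> \<Longrightarrow> x \<oplus>\<^bsub>M\<^esub> y \<in> N"
    and "\<And>a x. \<lbrakk>a \<in> carrier R; x \<in> N\<rbrakk> \<Longrightarrow> a \<odot>\<^bsub>M\<^esub> x \<in> N"
  shows "submodule N R M"
proof (intro submodule.intro subgroup.intro submodule_axioms.intro)
  show "inv\<^bsub>add_monoid M\<^esub> x \<in> N" if "x \<in> N" for x
    using assms(4)[of "\<ominus> \<one>" x] that assms(1) smult_minus_one[of x]
    by (auto simp: a_inv_def)
qed (use assms in auto)

lemma carrier_is_submodule: "submodule (carrier M) R M"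
  by (rule submoduleI') (auto simp: smult_closed)

end

lemma submoduleD:
  assumes "submodule N R M"
  shows "N \<subseteq> carrier M" "\<zero>\<^bsub>M\<^esub> \<in> N"
    and "\<lbrakk>x \<in> N; y \<in> N\<rbrakk> \<Longrightarrow> x \<oplus>\<^bsub>M\<^esub> y \<in> N"
    and "\<lbrakk>a \<in> carrier R; x \<in> N\<rbrakk> \<Longrightarrow> a \<odot>\<^bsub>M\<^esub> x \<in> N"
    and "x \<in> N \<Longrightarrow> \<ominus>\<^bsub>M\<^esub> x \<in> N"
  using submodule.axioms[OF assms]
  by (auto simp: subgroup_def submodule_axioms_def a_inv_def)

lemma left_module_of_submodule:
  assumes "left_module R M" "submodule N R M"
  shows "left_module R (M\<lparr>carrier := N\<rparr>)"
proof -
  interpret M: left_module R M by fact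
  note N = submoduleD[OF assms(2)]
  have c: "x \<in> carrier M" if "x \<in> N" for x using N(1) that by auto
  show ?thesis
  proof (intro left_module.intro left_module_axioms.intro abelian_groupI M.R.ring_axioms)
    show "\<exists>y\<in>carrier (M\<lparr>carrier := N\<rparr>). y \<oplus>\<^bsub>M\<lparr>carrier := N\<rparr>\<^esub> x = \<zero>\<^bsub>M\<lparr>carrier := N\<rparr>\<^esub>"
      if "x \<in> carrier (M\<lparr>carrier := N\<rparr>)" for x
      using that N(5) c by (auto intro!: bexI[of _ "\<ominus>\<^bsub>M\<^esub> x"] simp: M.M.l_neg)
  qed (auto simp: N c M.smult_l_distr M.smult_r_distr M.smult_assoc1 M.smult_one M.M.a_ac)
qed

lemma lin_homI:
  assumes "\<And>x. x \<in> carrier M \<Longrightarrow> f x \<in> carrier N"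
    and "\<And>x y. \<lbrakk>x \<in> carrier M; y \<in> carrier M\<rbrakk> \<Longrightarrow> f (x \<oplus>\<^bsub>M\<^esub> y) = f x \<oplus>\<^bsub>N\<^esub> f y"
    and "\<And>a x. \<lbrakk>a \<in> carrier R; x \<in> carrier M\<rbrakk> \<Longrightarrow> f (a \<odot>\<^bsub>M\<^esub> x) = a \<odot>\<^bsub>N\<^esub> f x"
  shows "f \<in> lin_hom R M N"
  using assms by (auto simp: lin_hom_def)

lemma lin_homD:
  assumes "f \<in> lin_hom R M N"
  shows lin_hom_closed: "x \<in> carrier M \<Longrightarrow> f x \<in> carrier N"
    and lin_hom_add: "\<lbrakk>x \<in> carrier M; y \<in> carrier M\<rbrakk> \<Longrightarrow> f (x \<oplus>\<^bsub>M\<^esub> y) = f x \<oplus>\<^bsub>N\<^esub> f y"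
    and lin_hom_smult: "\<lbrakk>a \<in> carrier R; x \<in> carrier M\<rbrakk> \<Longrightarrow> f (a \<odot>\<^bsub>M\<^esub> x) = a \<odot>\<^bsub>N\<^esub> f x"
  using assms by (auto simp: lin_hom_def)

lemma lin_hom_zero:
  assumes "left_module R M" "left_module R N" "f \<in> lin_hom R M N"
  shows "f \<zero>\<^bsub>M\<^esub> = \<zero>\<^bsub>N\<^esub>"
proof -
  interpret M: left_module R M by fact
  interpret N: left_module R N by fact
  show ?thesis
    by (metis M.M.l_zero M.M.zero_closed N.M.add.r_cancel_one' assms(3) lin_hom_add lin_hom_closed)
qed

lemma lin_hom_minus:
  assumes "left_module R M" "left_module R N" "f \<in> lin_hom R M N" "x \<in> carrier M"
  shows "f (\<ominus>\<^bsub>M\<^esub> x) = \<ominus>\<^bsub>N\<^esub> f x"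
proof -
  interpret M: left_module R M by fact
  interpret N: left_module R N by fact
  show ?thesis
    using M.smult_minus_one[of x] N.smult_minus_one[of "f x"] lin_homD[OF assms(3)] assms(4)
    by (metis M.R.add.inv_closed M.R.one_closed)
qed

lemma lin_hom_diff:
  assumes "left_module R M" "left_module R N" "f \<in> lin_hom R M N" "x \<in> carrier M" "y \<in> carrier M"
  shows "f (x \<ominus>\<^bsub>M\<^esub> y) = f x \<ominus>\<^bsub>N\<^esub> f y"
proof -
  interpret M: left_module R M by fact
  show ?thesis
    using lin_hom_minus[OF assms(1-3)] lin_hom_add[OF assms(3)] assms(4,5)
    by (simp add: a_minus_def)
qed

lemma lin_hom_comp:
  assumes "f \<in> lin_hom R L M" "g \<in> lin_hom R M N"
  shows "(\<lambda>x. g (f x)) \<in> lin_hom R L N"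
  using assms by (auto intro!: lin_homI simp: lin_homD[OF assms(1)] lin_homD[OF assms(2)])

lemma lin_hom_id: "(\<lambda>x. x) \<in> lin_hom R M M"
  by (auto intro: lin_homI)

lemma lin_hom_image_submodule:
  assumes "left_module R M" "left_module R N" "f \<in> lin_hom R M N" "submodule A R M"
  shows "submodule (f ` A) R N"
proof -
  interpret M: left_module R M by fact
  interpret N: left_module R N by fact
  note A = submoduleD[OF assms(4)] and f = lin_homD[OF assms(3)]
  have c: "x \<in> carrier M" if "x \<in> A" for x using A(1) that by auto
  show ?thesis
  proof (rule N.submoduleI')
    show "\<zero>\<^bsub>N\<^esub> \<in> f ` A" using lin_hom_zero[OF assms(1-3)] A(2) by force
    show "x \<oplus>\<^bsub>N\<^esub> y \<in> f ` A" if "x \<in> f ` A" "y \<in> f ` A" for x y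
      using that A(3) by (auto simp: f c simp flip: f(2))
    show "a \<odot>\<^bsub>N\<^esub> x \<in> f ` A" if "a \<in> carrier R" "x \<in> f ` A" for a x
      using that A(4) by (auto simp: f c simp flip: f(3))
  qed (use c f in auto)
qed

lemma lin_hom_vimage_submodule:
  assumes "left_module R M" "left_module R N" "f \<in> lin_hom R M N" "submodule B R N"
  shows "submodule {x \<in> carrier M. f x \<in> B} R M"
proof -
  interpret M: left_module R M by fact
  show ?thesis
    using submoduleD[OF assms(4)] lin_homD[OF assms(3)] lin_hom_zero[OF assms(1-3)]
    by (intro M.submoduleI') auto
qed

lemma lin_hom_kernel_submodule:
  assumes "left_module R M" "left_module R N" "f \<in> lin_hom R M N"
  shows "submodule {x \<in> carrier M. f x = \<zero>\<^bsub>N\<^esub>} R M"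
proof -
  interpret M: left_module R M by fact
  interpret N: left_module R N by fact
  show ?thesis
    using lin_homD[OF assms(3)] lin_hom_zero[OF assms(1-3)]
    by (intro M.submoduleI') (auto simp: N.smult_r_null)
qed

text \<open>Equational axioms pass along a surjection that respects the operations, and a negative
  of \<open>f x\<close> is the image of a negative of \<open>x\<close>. \<open>N\<close> is not
  assumed to be a group, which is why preservation of zero is a separate hypothesis. Quotients,
  transported modules and \<open>mor_to_T2\<close> obtain their module axioms this way.\<close>

lemma left_module_surj_image:
  assumes "left_module R M" "f \<in> lin_hom R M N" "f ` carrier M = carrier N" "f \<zero>\<^bsub>M\<^esub> = \<zero>\<^bsub>N\<^esub>"
  shows "left_module R N"
proof -
  interpret M: left_module R M by fact
  note f = lin_homD[OF assms(2)]
  have ex: "\<exists>x. x \<in> carrier M \<and> y = f x" if "y \<in> carrier N" for y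
    using that assms(3) by auto
  show ?thesis
  proof (intro left_module.intro left_module_axioms.intro abelian_groupI M.R.ring_axioms)
    fix x assume x: "x \<in> carrier N"
    then obtain x' where x': "x' \<in> carrier M" "x = f x'" using ex by blast
    then have "f (\<ominus>\<^bsub>M\<^esub> x') \<oplus>\<^bsub>N\<^esub> f x' = \<zero>\<^bsub>N\<^esub>"
      by (simp flip: f(2) add: M.M.l_neg assms(4))
    then show "\<exists>y\<in>carrier N. y \<oplus>\<^bsub>N\<^esub> x = \<zero>\<^bsub>N\<^esub>" using x' f(1) by blast
    show "\<zero>\<^bsub>N\<^esub> \<oplus>\<^bsub>N\<^esub> x = x"
      by (metis M.M.l_zero M.M.zero_closed assms(4) f(2) x')
    show "\<one>\<^bsub>R\<^esub> \<odot>\<^bsub>N\<^esub> x = x"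
      by (metis M.R.one_closed M.smult_one f(3) x')
    fix a assume a: "a \<in> carrier R"
    show "a \<odot>\<^bsub>N\<^esub> x \<in> carrier N"
      by (metis M.smult_closed a f(1) f(3) x')
    fix b assume b: "b \<in> carrier R"
    show "(a \<oplus>\<^bsub>R\<^esub> b) \<odot>\<^bsub>N\<^esub> x = a \<odot>\<^bsub>N\<^esub> x \<oplus>\<^bsub>N\<^esub> b \<odot>\<^bsub>N\<^esub> x"
      using a b x' by (simp flip: f(2,3) add: M.smult_l_distr)
    show "(a \<otimes>\<^bsub>R\<^esub> b) \<odot>\<^bsub>N\<^esub> x = a \<odot>\<^bsub>N\<^esub> (b \<odot>\<^bsub>N\<^esub> x)"
      using a b x' by (simp flip: f(2,3) add: M.smult_assoc1)
  next
    fix x y assume "x \<in> carrier N" "y \<in> carrier N"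
    then obtain x' y' where x': "x' \<in> carrier M" "x = f x'" "y' \<in> carrier M" "y = f y'"
      using ex by metis
    show "x \<oplus>\<^bsub>N\<^esub> y \<in> carrier N" using x' f(1,2) M.M.a_closed by metis
    show "x \<oplus>\<^bsub>N\<^esub> y = y \<oplus>\<^bsub>N\<^esub> x" using x' by (simp flip: f(2) add: M.M.a_comm)
    show "a \<odot>\<^bsub>N\<^esub> (x \<oplus>\<^bsub>N\<^esub> y) = a \<odot>\<^bsub>N\<^esub> x \<oplus>\<^bsub>N\<^esub> a \<odot>\<^bsub>N\<^esub> y" if "a \<in> carrier R" for a
      using x' that by (simp flip: f(2,3) add: M.smult_r_distr)
    fix z assume "z \<in> carrier N"
    then obtain z' where z': "z' \<in> carrier M" "z = f z'" using ex by metis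
    show "x \<oplus>\<^bsub>N\<^esub> y \<oplus>\<^bsub>N\<^esub> z = x \<oplus>\<^bsub>N\<^esub> (y \<oplus>\<^bsub>N\<^esub> z)"
      using x' z' by (simp flip: f(2) add: M.M.a_assoc)
  next
    show "\<zero>\<^bsub>N\<^esub> \<in> carrier N" using assms(4) f(1)[of "\<zero>\<^bsub>M\<^esub>"] by simp
  qed
qed

lemma finitely_generatedE:
  assumes "finitely_generated R M"
  obtains S where "finite S" "S \<subseteq> carrier M"
    "\<And>A. \<lbrakk>submodule A R M; S \<subseteq> A\<rbrakk> \<Longrightarrow> A = carrier M"
  using assms unfolding finitely_generated_def by metis

text \<open>A submodule containing the images of the generators pulls back to a submodule containing
  the generators, hence to everything.\<close>

lemma fg_module_surj_image:
  assumes "fg_module R M" "left_module R N" "f \<in> lin_hom R M N" "f ` carrier M = carrier N"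
  shows "fg_module R N"
proof -
  have M: "left_module R M" using assms(1) by (simp add: fg_module_def)
  obtain S where S: "finite S" "S \<subseteq> carrier M" "\<And>A. submodule A R M \<Longrightarrow> S \<subseteq> A \<Longrightarrow> A = carrier M"
    using finitely_generatedE[of R M] assms(1) unfolding fg_module_def by metis
  have "A = carrier N" if A: "submodule A R N" "f ` S \<subseteq> A" for A
  proof -
    have "{x \<in> carrier M. f x \<in> A} = carrier M"
      using A S(2) by (intro S(3) lin_hom_vimage_submodule[OF M assms(2,3)]) auto
    then have "f x \<in> A" if "x \<in> carrier M" for x using that by blast
    then have "f ` carrier M \<subseteq> A" by blast
    then show ?thesis using assms(4) submoduleD(1)[OF A(1)] by simp
  qed
  then show ?thesis
    unfolding fg_module_def finitely_generated_def using assms(2) S(1,2) lin_homD(1)[OF assms(3)]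
    by (intro conjI exI[of _ "f ` S"]) auto
qed

section \<open>Isomorphisms\<close>

definition lin_iso ::
    "('a, 'r) ring_scheme \<Rightarrow> ('a, 'm) module \<Rightarrow> ('a, 'n) module \<Rightarrow> ('m \<Rightarrow> 'n) set" where
  "lin_iso R M N = {e \<in> lin_hom R M N. bij_betw e (carrier M) (carrier N)}"

text \<open>Only closure of the operations is asked of \<open>M\<close>, so that this applies to
  \<open>AR_translation\<close>, for which closure is established but the module axioms are
  not.\<close>

lemma lin_iso_inv_into':
  assumes e: "e \<in> lin_iso R M N"
    and "\<And>x y. \<lbrakk>x \<in> carrier M; y \<in> carrier M\<rbrakk> \<Longrightarrow> x \<oplus>\<^bsub>M\<^esub> y \<in> carrier M"
    and "\<And>a x. \<lbrakk>a \<in> carrier R; x \<in> carrier M\<rbrakk> \<Longrightarrow> a \<odot>\<^bsub>M\<^esub> x \<in> carrier M"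
  shows "inv_into (carrier M) e \<in> lin_iso R N M"
proof -
  have b: "bij_betw e (carrier M) (carrier N)" and l: "e \<in> lin_hom R M N"
    using e by (auto simp: lin_iso_def)
  note l = lin_homD[OF l]
  have ex: "\<exists>x. x \<in> carrier M \<and> y = e x" if "y \<in> carrier N" for y
    using that b by (auto simp: bij_betw_def)
  have i: "inv_into (carrier M) e (e x) = x" if "x \<in> carrier M" for x
    using that b by (simp add: bij_betw_def)
  have "inv_into (carrier M) e \<in> lin_hom R N M"
  proof (rule lin_homI)
    fix x y assume "x \<in> carrier N" "y \<in> carrier N"
    then obtain x' y' where x': "x' \<in> carrier M" "x = e x'" "y' \<in> carrier M" "y = e y'"
      using ex by metis
    show "inv_into (carrier M) e (x \<oplus>\<^bsub>N\<^esub> y) = inv_into (carrier M) e x \<oplus>\<^bsub>M\<^esub> inv_into (carrier M) e y"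
      using x' assms(2) by (simp add: i flip: l(2))
  next
    fix a x assume "a \<in> carrier R" "x \<in> carrier N"
    moreover then obtain x' where x': "x' \<in> carrier M" "x = e x'"
      using ex by metis
    ultimately show "inv_into (carrier M) e (a \<odot>\<^bsub>N\<^esub> x) = a \<odot>\<^bsub>M\<^esub> inv_into (carrier M) e x"
      using assms(3) by (simp add: i flip: l(3))
  next
    show "inv_into (carrier M) e x \<in> carrier M" if "x \<in> carrier N" for x
      using ex[OF that] i by auto
  qed
  then show ?thesis using b by (simp add: lin_iso_def bij_betw_inv_into)
qed

lemma lin_iso_inv_into:
  assumes "left_module R M" "e \<in> lin_iso R M N"
  shows "inv_into (carrier M) e \<in> lin_iso R N M"
proof -
  interpret M: left_module R M by fact
  show ?thesis by (rule lin_iso_inv_into'[OF assms(2)]) auto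
qed

lemma lin_isoD:
  assumes "e \<in> lin_iso R M N"
  shows "e \<in> lin_hom R M N" "bij_betw e (carrier M) (carrier N)"
    "inj_on e (carrier M)" "e ` carrier M = carrier N"
    "x \<in> carrier M \<Longrightarrow> inv_into (carrier M) e (e x) = x"
    "y \<in> carrier N \<Longrightarrow> e (inv_into (carrier M) e y) = y"
    "y \<in> carrier N \<Longrightarrow> inv_into (carrier M) e y \<in> carrier M"
  using assms by (auto simp: lin_iso_def bij_betw_def f_inv_into_f inv_into_into)

lemma lin_iso_comp:
  assumes "f \<in> lin_iso R L M" "g \<in> lin_iso R M N"
  shows "(\<lambda>x. g (f x)) \<in> lin_iso R L N"
  using assms lin_hom_comp[of f R L M g N] bij_betw_trans[of f "carrier L" "carrier M" g "carrier N"]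
  by (auto simp: lin_iso_def comp_def)

text \<open>Carries a module to another element type. Its purpose is to reach
  \<open>'a univ\<close>, the type over which the lifting properties and \<open>transpose\<close>
  quantify.\<close>

definition transport :: "('m \<Rightarrow> 'n) \<Rightarrow> ('a, 'm) module \<Rightarrow> ('a, 'n) module" where
  "transport e M =
     \<lparr>carrier = e ` carrier M, mult = undefined, one = undefined, zero = e \<zero>\<^bsub>M\<^esub>,
      add = (\<lambda>x y. e (inv_into (carrier M) e x \<oplus>\<^bsub>M\<^esub> inv_into (carrier M) e y)),
      smult = (\<lambda>a x. e (a \<odot>\<^bsub>M\<^esub> inv_into (carrier M) e x))\<rparr>"

lemma transport:
  assumes "left_module R M" "inj_on e (carrier M)"
  shows "e \<in> lin_iso R M (transport e M)" "left_module R (transport e M)"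
proof -
  have l: "e \<in> lin_hom R M (transport e M)"
    using assms(2) by (auto simp: lin_hom_def transport_def)
  then show "e \<in> lin_iso R M (transport e M)"
    using assms(2) by (simp add: lin_iso_def bij_betw_def transport_def)
  show "left_module R (transport e M)"
    by (rule left_module_surj_image[OF assms(1) l]) (simp_all add: transport_def)
qed

section \<open>Linear combinations\<close>

fun lin_comb :: "('a, 'm) module \<Rightarrow> (nat \<Rightarrow> 'a) \<Rightarrow> (nat \<Rightarrow> 'm) \<Rightarrow> nat \<Rightarrow> 'm" where
  "lin_comb M c x 0 = \<zero>\<^bsub>M\<^esub>"
| "lin_comb M c x (Suc n) = lin_comb M c x n \<oplus>\<^bsub>M\<^esub> c n \<odot>\<^bsub>M\<^esub> x n"

lemma lin_comb_submodule:
  assumes "submodule N R M" "\<And>i. c i \<in> carrier R" "\<And>i. x i \<in> N"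
  shows "lin_comb M c x n \<in> N"
  using submoduleD[OF assms(1)] assms(2,3) by (induction n) auto

lemma lin_comb_hom:
  assumes "left_module R M" "left_module R N" "f \<in> lin_hom R M N"
    and "\<And>i. c i \<in> carrier R" "\<And>i. x i \<in> carrier M"
  shows "f (lin_comb M c x n) = lin_comb N c (\<lambda>i. f (x i)) n"
proof (induction n)
  case (Suc n)
  interpret M: left_module R M by fact
  have "lin_comb M c x n \<in> carrier M"
    by (intro lin_comb_submodule[OF M.carrier_is_submodule] assms)
  then show ?case using Suc assms by (simp add: lin_homD[OF assms(3)])
qed (use lin_hom_zero[OF assms(1-3)] in simp)

lemma lin_comb_closed:
  assumes "left_module R M" "\<And>i. c i \<in> carrier R" "\<And>i. x i \<in> carrier M"
  shows "lin_comb M c x n \<in> carrier M"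
  using lin_comb_submodule[OF left_module.carrier_is_submodule] assms by metis

lemma lin_comb_add:
  assumes "left_module R M" "\<And>i. c i \<in> carrier R" "\<And>i. d i \<in> carrier R" "\<And>i. x i \<in> carrier M"
  shows "lin_comb M (\<lambda>i. c i \<oplus>\<^bsub>R\<^esub> d i) x n = lin_comb M c x n \<oplus>\<^bsub>M\<^esub> lin_comb M d x n"
proof -
  interpret M: left_module R M by fact
  note [simp] = lin_comb_closed[OF assms(1,2,4)] lin_comb_closed[OF assms(1,3,4)] assms(2-4)
  show ?thesis by (induction n) (simp_all add: M.smult_l_distr M.M.a_ac)
qed

lemma lin_comb_add_right:
  assumes "left_module R M" "\<And>i. c i \<in> carrier R" "\<And>i. x i \<in> carrier M" "\<And>i. y i \<in> carrier M"
  shows "lin_comb M c (\<lambda>i. x i \<oplus>\<^bsub>M\<^esub> y i) n = lin_comb M c x n \<oplus>\<^bsub>M\<^esub> lin_comb M c y n"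
proof -
  interpret M: left_module R M by fact
  note [simp] = lin_comb_closed[OF assms(1,2,4)] lin_comb_closed[OF assms(1,2,3)] assms(2-4)
  show ?thesis by (induction n) (simp_all add: M.smult_r_distr M.M.a_ac)
qed

lemma lin_comb_smult:
  assumes "left_module R M" "a \<in> carrier R" "\<And>i. c i \<in> carrier R" "\<And>i. x i \<in> carrier M"
  shows "lin_comb M (\<lambda>i. a \<otimes>\<^bsub>R\<^esub> c i) x n = a \<odot>\<^bsub>M\<^esub> lin_comb M c x n"
proof -
  interpret M: left_module R M by fact
  note [simp] = lin_comb_closed[OF assms(1,3,4)] assms(2-4)
  show ?thesis by (induction n) (simp_all add: M.smult_r_distr M.smult_assoc1 M.smult_r_null)
qed

lemma lin_comb_unit:
  assumes "left_module R M" "\<And>i. x i \<in> carrier M"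
  shows "lin_comb M (\<lambda>i. if i = j then \<one>\<^bsub>R\<^esub> else \<zero>\<^bsub>R\<^esub>) x n = (if j < n then x j else \<zero>\<^bsub>M\<^esub>)"
proof -
  interpret M: left_module R M by fact
  show ?thesis
    by (induction n) (auto simp: assms(2) M.smult_one M.smult_l_null less_Suc_eq)
qed

lemma lin_comb_cong:
  "(\<And>i. i < n \<Longrightarrow> c i = d i) \<Longrightarrow> (\<And>i. i < n \<Longrightarrow> x i = y i) \<Longrightarrow> lin_comb M c x n = lin_comb M d y n"
  by (induction n) auto

lemma lin_comb_span_submodule:
  assumes M: "left_module R M" and x: "\<And>i. x i \<in> carrier M"
  shows "submodule {m. \<exists>c. (\<forall>i. c i \<in> carrier R) \<and> lin_comb M c x n = m} R M" (is "submodule ?A R M")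
proof -
  interpret M: left_module R M by fact
  show ?thesis
  proof (rule M.submoduleI')
    show "\<zero>\<^bsub>M\<^esub> \<in> ?A"
      \<comment> \<open>The witness is the unit coefficient vector with index \<open>n\<close>, one
        place beyond the \<open>n\<close> summands, so the combination is zero.\<close>
      using lin_comb_unit[OF M, of x n n] x
      by (auto intro!: exI[of _ "\<lambda>i. if i = n then \<one>\<^bsub>R\<^esub> else \<zero>\<^bsub>R\<^esub>"])
    show "y \<oplus>\<^bsub>M\<^esub> z \<in> ?A" if "y \<in> ?A" "z \<in> ?A" for y z
    proof -
      from that obtain c d where "\<forall>i. c i \<in> carrier R" "lin_comb M c x n = y"
        "\<forall>i. d i \<in> carrier R" "lin_comb M d x n = z" by blast
      then show ?thesis
        using lin_comb_add[OF M, of c d x n] x by (auto intro!: exI[of _ "\<lambda>i. c i \<oplus>\<^bsub>R\<^esub> d i"])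
    qed
    show "a \<odot>\<^bsub>M\<^esub> z \<in> ?A" if "a \<in> carrier R" "z \<in> ?A" for a z
    proof -
      from that obtain c where "\<forall>i. c i \<in> carrier R" "lin_comb M c x n = z" by blast
      then show ?thesis
        using lin_comb_smult[OF M that(1), of c x n] x that(1)
        by (auto intro!: exI[of _ "\<lambda>i. a \<otimes>\<^bsub>R\<^esub> c i"])
    qed
  qed (use lin_comb_closed[OF M] x in auto)
qed

lemma fg_module_lin_comb:
  assumes "fg_module R M"
  obtains n x where "\<And>i. x i \<in> carrier M"
    and "\<And>m. m \<in> carrier M \<Longrightarrow> \<exists>c. (\<forall>i. c i \<in> carrier R) \<and> lin_comb M c x n = m"
proof -
  interpret M: left_module R M using assms by (simp add: fg_module_def)
  note M = M.left_module_axioms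
  obtain S where S: "finite S" "S \<subseteq> carrier M" "\<And>A. submodule A R M \<Longrightarrow> S \<subseteq> A \<Longrightarrow> A = carrier M"
    using finitely_generatedE[of R M] assms unfolding fg_module_def by metis
  obtain n and f :: "nat \<Rightarrow> _" where f: "S = f ` {i. i < n}"
    using finite_imp_nat_seg_image_inj_on[OF S(1)] by blast
  \<comment> \<open>The lemmas on \<open>lin_comb\<close> want a vector of the carrier at every
    index; the zeros from \<open>n\<close> on are never summed.\<close>
  define x where "x i = (if i < n then f i else \<zero>\<^bsub>M\<^esub>)" for i
  have x: "x i \<in> carrier M" for i using S(2) f by (auto simp: x_def)
  let ?A = "{m. \<exists>c. (\<forall>i. c i \<in> carrier R) \<and> lin_comb M c x n = m}"
  have "x j \<in> ?A" if "j < n" for j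
    using lin_comb_unit[OF M, of x j n] x that
    by (auto intro!: exI[of _ "\<lambda>i. if i = j then \<one>\<^bsub>R\<^esub> else \<zero>\<^bsub>R\<^esub>"])
  then have "S \<subseteq> ?A" by (auto simp: f x_def cong: if_cong)
  then have "?A = carrier M"
    using S(3)[OF lin_comb_span_submodule[OF M x]] by simp
  then show ?thesis using that[of x n] x by auto
qed

lemma fg_moduleI:
  assumes "left_module R M" "\<And>i. x i \<in> carrier M"
    and "\<And>m. m \<in> carrier M \<Longrightarrow> \<exists>c. (\<forall>i. c i \<in> carrier R) \<and> lin_comb M c x n = m"
  shows "fg_module R M"
proof -
  have "A = carrier M" if A: "submodule A R M" "x ` {..<n} \<subseteq> A" for A
  proof -
    have "lin_comb M c x m \<in> A" if "m \<le> n" "\<forall>i. c i \<in> carrier R" for c m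
      using that submoduleD[OF A(1)] A(2) by (induction m) (auto simp: image_subset_iff)
    with assms(3) show ?thesis using submoduleD(1)[OF A(1)] by blast
  qed
  then show ?thesis
    unfolding fg_module_def finitely_generated_def using assms(1,2)
    by (intro conjI exI[of _ "x ` {..<n}"]) auto
qed

text \<open>An element is encoded as the set of all coefficient sequences that represent it in terms
  of fixed generators. These sets are nonempty, and each member determines the element, so the
  encoding is injective.\<close>

lemma fg_module_univ_copy:
  fixes R :: "('a, 'r) ring_scheme"
  assumes "fg_module R M"
  obtains M' :: "('a, 'a univ) module" and e
  where "fg_module R M'" "left_module R M'" "e \<in> lin_iso R M M'"
proof -
  have M: "left_module R M" using assms by (simp add: fg_module_def)
  obtain n x where x: "\<And>i. x i \<in> carrier M"
    and c: "\<And>m. m \<in> carrier M \<Longrightarrow> \<exists>c. (\<forall>i. c i \<in> carrier R) \<and> lin_comb M c x n = m"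
    using fg_module_lin_comb[OF assms] by metis
  define e where "e m = {c. (\<forall>i. c i \<in> carrier R) \<and> lin_comb M c x n = m}" for m
  have "inj_on e (carrier M)"
    using c by (fastforce simp: inj_on_def e_def set_eq_iff)
  note t = transport[OF M this]
  from that[OF fg_module_surj_image[OF assms t(2) lin_isoD(1,4)[OF t(1)]] t(2,1)]
  show ?thesis .
qed

section \<open>Projective modules\<close>

lemma left_module_regular:
  assumes "ring R"
  shows "left_module R (regular_module R)"
proof -
  interpret ring R by fact
  show ?thesis
    by (intro left_module.intro left_module_axioms.intro abelian_groupI ring_axioms)
      (auto simp: regular_module_def l_distr r_distr m_assoc a_ac intro!: bexI[of _ "\<ominus>\<^bsub>R\<^esub> x" for x] l_neg)
qed

definition free_module :: "('a, 'r) ring_scheme \<Rightarrow> nat \<Rightarrow> ('a, nat \<Rightarrow> 'a) module" where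
  "free_module R n =
     \<lparr>carrier = {c. (\<forall>i. c i \<in> carrier R) \<and> (\<forall>i\<ge>n. c i = \<zero>\<^bsub>R\<^esub>)}, mult = undefined,
      one = undefined, zero = (\<lambda>_. \<zero>\<^bsub>R\<^esub>), add = (\<lambda>c d i. c i \<oplus>\<^bsub>R\<^esub> d i),
      smult = (\<lambda>a c i. a \<otimes>\<^bsub>R\<^esub> c i)\<rparr>"

lemma fg_module_free:
  assumes "ring R"
  shows "fg_module R (free_module R n)"
proof -
  interpret ring R by fact
  have l: "left_module R (free_module R n)"
  proof (intro left_module.intro left_module_axioms.intro abelian_groupI ring_axioms)
    fix c assume "c \<in> carrier (free_module R n)"
    then show "\<exists>d\<in>carrier (free_module R n). d \<oplus>\<^bsub>free_module R n\<^esub> c = \<zero>\<^bsub>free_module R n\<^esub>"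
      by (intro bexI[of _ "\<lambda>i. \<ominus>\<^bsub>R\<^esub> c i"]) (auto simp: free_module_def l_neg)
  qed (auto simp: free_module_def l_distr r_distr m_assoc a_ac)
  \<comment> \<open>Unit vectors; from index \<open>n\<close> on they are zero, so that every
    \<open>x j\<close> lies in the carrier.\<close>
  define x where "x j i = (if i = j \<and> j < n then \<one>\<^bsub>R\<^esub> else \<zero>\<^bsub>R\<^esub>)" for i j :: nat
  show ?thesis
  proof (rule fg_moduleI[OF l, of x n])
    show "x i \<in> carrier (free_module R n)" for i by (auto simp: free_module_def x_def)
    fix m assume "m \<in> carrier (free_module R n)"
    then have m: "m i \<in> carrier R" "i \<ge> n \<Longrightarrow> m i = \<zero>\<^bsub>R\<^esub>" for i by (auto simp: free_module_def)
    have "lin_comb (free_module R n) m x k i = (if i < k \<and> i < n then m i else \<zero>\<^bsub>R\<^esub>)" for k i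
      by (induction k) (auto simp: free_module_def x_def m less_Suc_eq)
    then have "lin_comb (free_module R n) m x n = m" using m by (auto simp: fun_eq_iff)
    then show "\<exists>c. (\<forall>i. c i \<in> carrier R) \<and> lin_comb (free_module R n) c x n = m"
      using m by blast
  qed
qed

lemma projective_moduleD:
  assumes "projective_module R P"
  shows "fg_module R P" "left_module R P" "ring R"
  using assms by (auto simp: projective_module_def fg_module_def left_module_def)

text \<open>A surjection of \<open>free_module R n\<close> onto \<open>P\<close> splits, and the
  coordinates of the splitting are the functionals \<open>\<xi> i\<close>. The definition of
  projectivity only offers lifts against modules over \<open>'a univ\<close>, so the surjection is
  rewritten between the copies \<open>F'\<close> and \<open>P'\<close>, and the map to be lifted is
  the isomorphism \<open>e\<close> instead of the identity of \<open>P\<close>.\<close>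

lemma projective_dual_basis:
  fixes R :: "('a, 'r) ring_scheme"
  assumes "projective_module R P"
  obtains n x \<xi> where "\<And>i. x i \<in> carrier P" "\<And>i. \<xi> i \<in> lin_hom R P (regular_module R)"
    "\<And>p. p \<in> carrier P \<Longrightarrow> lin_comb P (\<lambda>i. \<xi> i p) x n = p"
proof -
  note P = projective_moduleD[OF assms]
  interpret P: left_module R P by fact
  obtain n x where x: "\<And>i. x i \<in> carrier P"
    and c: "\<And>m. m \<in> carrier P \<Longrightarrow> \<exists>c. (\<forall>i. c i \<in> carrier R) \<and> lin_comb P c x n = m"
    using fg_module_lin_comb[OF P(1)] by metis
  obtain P' :: "('a, 'a univ) module" and e where
    P': "fg_module R P'" "left_module R P'" and e: "e \<in> lin_iso R P P'"
    using fg_module_univ_copy[OF P(1)] by metis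
  let ?F = "free_module R n"
  obtain F' :: "('a, 'a univ) module" and u where
    F': "fg_module R F'" "left_module R F'" and u: "u \<in> lin_iso R ?F F'"
    using fg_module_univ_copy[OF fg_module_free[OF P(3)]] by metis
  have F: "left_module R ?F" using fg_module_free[OF P(3)] by (simp add: fg_module_def)
  note v = lin_iso_inv_into[OF F u]
  let ?v = "inv_into (carrier ?F) u"
  have s: "(\<lambda>c. lin_comb P c x n) \<in> lin_hom R ?F P"
  proof (rule lin_homI)
    fix a c assume "a \<in> carrier R" "c \<in> carrier ?F"
    then show "lin_comb P (a \<odot>\<^bsub>?F\<^esub> c) x n = a \<odot>\<^bsub>P\<^esub> lin_comb P c x n"
      using lin_comb_smult[OF P(2), of a c x n] x by (simp add: free_module_def)
  next
    fix c d assume "c \<in> carrier ?F" "d \<in> carrier ?F"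
    then show "lin_comb P (c \<oplus>\<^bsub>?F\<^esub> d) x n = lin_comb P c x n \<oplus>\<^bsub>P\<^esub> lin_comb P d x n"
      using lin_comb_add[OF P(2), of c d x n] x by (simp add: free_module_def)
  next
    show "lin_comb P c x n \<in> carrier P" if "c \<in> carrier ?F" for c
      using lin_comb_closed[OF P(2), of c x n] x that by (simp add: free_module_def)
  qed
  let ?g = "\<lambda>y. e (lin_comb P (?v y) x n)"
  have g: "?g \<in> lin_hom R F' P'"
    using lin_hom_comp[OF lin_hom_comp[OF lin_isoD(1)[OF v] s] lin_isoD(1)[OF e]] .
  have "?g ` carrier F' = carrier P'"
  proof (intro equalityI subsetI)
    fix y assume "y \<in> carrier P'"
    then obtain m where m: "m \<in> carrier P" "y = e m" using lin_isoD(4)[OF e] by blast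
    then obtain c where c: "\<forall>i. c i \<in> carrier R" "lin_comb P c x n = m" using c by blast
    \<comment> \<open>Coefficients from \<open>n\<close> on are cut off, as membership in
      \<open>free_module R n\<close> requires; the combination does not see them.\<close>
    let ?c = "\<lambda>i. if i < n then c i else \<zero>\<^bsub>R\<^esub>"
    have cF: "?c \<in> carrier ?F" using c P.R.zero_closed by (simp add: free_module_def)
    have "lin_comb P ?c x n = m" using c(2) lin_comb_cong[of n ?c c x x P] by simp
    then have "y = ?g (u ?c)" using m(2) lin_isoD(5)[OF u cF] by simp
    then show "y \<in> ?g ` carrier F'" using lin_homD(1)[OF lin_isoD(1)[OF u] cF] by (rule image_eqI)
  qed (use lin_homD(1)[OF g] in auto)
  then have "\<exists>l\<in>lin_hom R P F'. \<forall>p\<in>carrier P. ?g (l p) = e p"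
    using P'(1) F'(1) g lin_isoD(1)[OF e]
    by (intro assms[unfolded projective_module_def, THEN conjunct2, rule_format, of F' P' ?g e]) auto
  then obtain l where l: "l \<in> lin_hom R P F'" "\<And>p. p \<in> carrier P \<Longrightarrow> ?g (l p) = e p"
    by metis
  define \<xi> where "\<xi> i p = ?v (l p) i" for i p
  note vl = lin_hom_comp[OF l(1) lin_isoD(1)[OF v]]
  have vlc: "?v (l p) \<in> carrier ?F" if "p \<in> carrier P" for p
    using lin_homD(1)[OF vl] that by simp
  show ?thesis
  proof (rule that[OF x])
    show "\<xi> i \<in> lin_hom R P (regular_module R)" for i
      using lin_homD[OF vl] by (auto simp: lin_hom_def \<xi>_def regular_module_def free_module_def)
    fix p assume p: "p \<in> carrier P"
    have "lin_comb P (?v (l p)) x n \<in> carrier P" using lin_homD(1)[OF s] vlc[OF p] .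
    then have "lin_comb P (?v (l p)) x n = p"
      using l(2)[OF p] lin_isoD(5)[OF e] p by metis
    then show "lin_comb P (\<lambda>i. \<xi> i p) x n = p" by (simp add: \<xi>_def)
  qed
qed

text \<open>The values \<open>y i\<close> may be prescribed arbitrarily: no relations between
  generators have to be respected, because the formula takes its coefficients from the functionals
  \<open>\<xi> i\<close>.\<close>

lemma lin_comb_dual_basis_hom:
  assumes "left_module R P" "left_module R Y"
    and "\<And>i. \<xi> i \<in> lin_hom R P (regular_module R)" "\<And>i. y i \<in> carrier Y"
  shows "(\<lambda>p. lin_comb Y (\<lambda>i. \<xi> i p) y n) \<in> lin_hom R P Y"
proof -
  interpret P: left_module R P by fact
  have \<xi>: "\<xi> i p \<in> carrier R" if "p \<in> carrier P" for i p
    using lin_homD(1)[OF assms(3) that] by (simp add: regular_module_def)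
  show ?thesis
  proof (rule lin_homI)
    fix p q assume "p \<in> carrier P" "q \<in> carrier P"
    then show "lin_comb Y (\<lambda>i. \<xi> i (p \<oplus>\<^bsub>P\<^esub> q)) y n =
      lin_comb Y (\<lambda>i. \<xi> i p) y n \<oplus>\<^bsub>Y\<^esub> lin_comb Y (\<lambda>i. \<xi> i q) y n"
      using lin_comb_add[OF assms(2), of "\<lambda>i. \<xi> i p" "\<lambda>i. \<xi> i q" y n] \<xi> assms(4) lin_homD(2)[OF assms(3)]
      by (simp add: regular_module_def)
  next
    fix a p assume "a \<in> carrier R" "p \<in> carrier P"
    then show "lin_comb Y (\<lambda>i. \<xi> i (a \<odot>\<^bsub>P\<^esub> p)) y n = a \<odot>\<^bsub>Y\<^esub> lin_comb Y (\<lambda>i. \<xi> i p) y n"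
      using lin_comb_smult[OF assms(2), of a "\<lambda>i. \<xi> i p" y n] \<xi> assms(4) lin_homD(3)[OF assms(3)]
      by (simp add: regular_module_def)
  qed (rule lin_comb_closed[OF assms(2)], use \<xi> assms(4) in auto)
qed

text \<open>Preimages of the values \<open>h (x i)\<close> are chosen and recombined with the dual
  basis. Compared with the definition of projectivity, \<open>Y\<close> and \<open>Z\<close> may
  have any element types and be infinitely generated, and \<open>g\<close> only has to reach the
  image of \<open>h\<close>.\<close>

lemma projective_lift:
  assumes "projective_module R P" "left_module R Y" "left_module R Z"
    and "g \<in> lin_hom R Y Z" "h \<in> lin_hom R P Z" "h ` carrier P \<subseteq> g ` carrier Y"
  obtains l where "l \<in> lin_hom R P Y" "\<And>p. p \<in> carrier P \<Longrightarrow> g (l p) = h p"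
proof -
  note P = projective_moduleD[OF assms(1)]
  obtain n x \<xi> where x: "\<And>i. x i \<in> carrier P" and \<xi>: "\<And>i. \<xi> i \<in> lin_hom R P (regular_module R)"
    and xx: "\<And>p. p \<in> carrier P \<Longrightarrow> lin_comb P (\<lambda>i. \<xi> i p) x n = p"
    using projective_dual_basis[OF assms(1)] by metis
  have "\<exists>y. y \<in> carrier Y \<and> g y = h (x i)" for i
    using x[of i] assms(6) by (force simp: image_subset_iff)
  then obtain y where y: "\<And>i. y i \<in> carrier Y" "\<And>i. g (y i) = h (x i)" by metis
  have "\<xi> i p \<in> carrier R" if "p \<in> carrier P" for i p
    using lin_homD(1)[OF \<xi> that] by (simp add: regular_module_def)
  then have "g (lin_comb Y (\<lambda>i. \<xi> i p) y n) = h p" if "p \<in> carrier P" for p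
    using lin_comb_hom[OF assms(2,3,4), of "\<lambda>i. \<xi> i p" y n]
      lin_comb_hom[OF P(2) assms(3,5), of "\<lambda>i. \<xi> i p" x n] x y xx that by simp
  then show ?thesis by (rule that[OF lin_comb_dual_basis_hom[OF P(2) assms(2) \<xi> y(1)]])
qed

text \<open>It suffices to split the dual basis elements as \<open>x i = k i + l i\<close>:
  recombining the \<open>k i\<close> gives a linear \<open>\<alpha>\<close>, and recombining the
  \<open>l i\<close> gives its complement. As \<open>K\<close> and \<open>L\<close> may intersect,
  \<open>\<alpha>\<close> need not be idempotent yet.\<close>

lemma projective_split_sum:
  assumes "projective_module R P" "submodule K R P" "submodule L R P"
    and "\<And>p. p \<in> carrier P \<Longrightarrow> \<exists>k\<in>K. \<exists>l\<in>L. p = k \<oplus>\<^bsub>P\<^esub> l"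
  obtains \<alpha> where "\<alpha> \<in> lin_hom R P P" "\<And>p. p \<in> carrier P \<Longrightarrow> \<alpha> p \<in> K"
    "\<And>p. p \<in> carrier P \<Longrightarrow> p \<ominus>\<^bsub>P\<^esub> \<alpha> p \<in> L"
proof -
  note P = projective_moduleD[OF assms(1)]
  interpret P: left_module R P by fact
  obtain n x \<xi> where x: "\<And>i. x i \<in> carrier P" and \<xi>: "\<And>i. \<xi> i \<in> lin_hom R P (regular_module R)"
    and xx: "\<And>p. p \<in> carrier P \<Longrightarrow> lin_comb P (\<lambda>i. \<xi> i p) x n = p"
    using projective_dual_basis[OF assms(1)] by metis
  obtain k l where kl: "\<And>i. k i \<in> K" "\<And>i. l i \<in> L" "\<And>i. x i = k i \<oplus>\<^bsub>P\<^esub> l i"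
    using assms(4)[OF x] by metis
  have c: "k i \<in> carrier P" "l i \<in> carrier P" for i
    using kl submoduleD(1)[OF assms(2)] submoduleD(1)[OF assms(3)] by auto
  have \<xi>c: "\<xi> i p \<in> carrier R" if "p \<in> carrier P" for i p
    using lin_homD(1)[OF \<xi> that] by (simp add: regular_module_def)
  let ?\<alpha> = "\<lambda>p. lin_comb P (\<lambda>i. \<xi> i p) k n" and ?\<beta> = "\<lambda>p. lin_comb P (\<lambda>i. \<xi> i p) l n"
  show ?thesis
  proof (rule that[of ?\<alpha>])
    show "?\<alpha> \<in> lin_hom R P P" by (rule lin_comb_dual_basis_hom[OF P(2) P(2) \<xi> c(1)])
    fix p assume p: "p \<in> carrier P"
    show \<alpha>: "?\<alpha> p \<in> K" using lin_comb_submodule[OF assms(2)] \<xi>c[OF p] kl(1) by metis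
    have \<beta>: "?\<beta> p \<in> L" using lin_comb_submodule[OF assms(3)] \<xi>c[OF p] kl(2) by metis
    have "p = ?\<alpha> p \<oplus>\<^bsub>P\<^esub> ?\<beta> p"
      using xx[OF p] lin_comb_add_right[OF P(2), of "\<lambda>i. \<xi> i p" k l n] c \<xi>c[OF p]
      by (simp flip: kl(3))
    then have "p \<ominus>\<^bsub>P\<^esub> ?\<alpha> p = ?\<beta> p"
      using \<alpha> \<beta> submoduleD(1)[OF assms(2)] submoduleD(1)[OF assms(3)]
      by (smt (verit) P.M.a_comm P.M.add.inv_solve_right a_minus_def p subsetD)
    then show "p \<ominus>\<^bsub>P\<^esub> ?\<alpha> p \<in> L" using \<beta> by simp
  qed
qed

lemma projective_module_lin_iso:
  assumes "projective_module R P" "e \<in> lin_iso R P P'" "left_module R P'"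
  shows "projective_module R P'"
  unfolding projective_module_def
proof (intro conjI allI impI)
  note P = projective_moduleD[OF assms(1)]
  show "fg_module R P'" using fg_module_surj_image[OF P(1) assms(3) lin_isoD(1,4)[OF assms(2)]] .
  fix Y Z :: "('a, 'a univ) module" and g h
  assume a: "fg_module R Y \<and> fg_module R Z \<and>
        g \<in> lin_hom R Y Z \<and> g ` carrier Y = carrier Z \<and> h \<in> lin_hom R P' Z"
  note inv = lin_iso_inv_into[OF P(2) assms(2)]
  have he: "(\<lambda>x. h (e x)) \<in> lin_hom R P Z" using a lin_hom_comp[OF lin_isoD(1)[OF assms(2)]] by blast
  have YZ: "left_module R Y" "left_module R Z" "g \<in> lin_hom R Y Z"
    using a by (auto simp: fg_module_def)
  have "(\<lambda>x. h (e x)) ` carrier P \<subseteq> g ` carrier Y" using a lin_homD(1)[OF he] by auto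
  then obtain l where l: "l \<in> lin_hom R P Y" "\<And>p. p \<in> carrier P \<Longrightarrow> g (l p) = h (e p)"
    using projective_lift[OF assms(1) YZ he] by metis
  show "\<exists>l\<in>lin_hom R P' Y. \<forall>x\<in>carrier P'. g (l x) = h x"
    using lin_hom_comp[OF lin_isoD(1)[OF inv] l(1)] l(2) lin_isoD[OF assms(2)] by (intro bexI) auto
qed

section \<open>Projective covers\<close>

lemma a_kernel_eq: "a_kernel M N f = {x \<in> carrier M. f x = \<zero>\<^bsub>N\<^esub>}"
  by (simp add: a_kernel_def kernel_def)

lemma set_add_kernel_eq_carrier_iff:
  assumes "left_module R P" "left_module R M" "p \<in> lin_hom R P M" "p ` carrier P = carrier M"
    "submodule N R P"
  shows "N <+>\<^bsub>P\<^esub> a_kernel P M p = carrier P \<longleftrightarrow> p ` N = carrier M"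
proof -
  interpret P: left_module R P by fact
  interpret M: left_module R M by fact
  note p = lin_homD[OF assms(3)] and N = submoduleD[OF assms(5)]
  have mem: "x \<in> N <+>\<^bsub>P\<^esub> a_kernel P M p \<longleftrightarrow>
      (\<exists>n\<in>N. \<exists>y\<in>carrier P. p y = \<zero>\<^bsub>M\<^esub> \<and> x = n \<oplus>\<^bsub>P\<^esub> y)" for x
    by (auto simp: set_add_def' a_kernel_eq)
  show ?thesis
  proof
    assume eq: "N <+>\<^bsub>P\<^esub> a_kernel P M p = carrier P"
    have "p x \<in> p ` N" if "x \<in> carrier P" for x
    proof -
      have "x \<in> N <+>\<^bsub>P\<^esub> a_kernel P M p" using that eq by simp
      then obtain n y where ny: "n \<in> N" "y \<in> carrier P" "p y = \<zero>\<^bsub>M\<^esub>" "x = n \<oplus>\<^bsub>P\<^esub> y"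
        unfolding mem by blast
      have n: "n \<in> carrier P" using N(1) ny(1) by blast
      have "p x = p n" using p(2)[OF n ny(2)] p(1)[OF n] ny(3,4) by simp
      then show ?thesis using ny(1) by (rule image_eqI)
    qed
    then have "p ` carrier P \<subseteq> p ` N" by (rule image_subsetI)
    then show "p ` N = carrier M" using image_mono[OF N(1), of p] assms(4) by simp
  next
    assume eq: "p ` N = carrier M"
    have "x \<in> N <+>\<^bsub>P\<^esub> a_kernel P M p" if x: "x \<in> carrier P" for x
    proof -
      obtain n where n: "n \<in> N" "p n = p x" using eq p(1)[OF x] by (metis imageE)
      then have nc: "n \<in> carrier P" using N(1) by auto
      have "p (x \<ominus>\<^bsub>P\<^esub> n) = \<zero>\<^bsub>M\<^esub>"
        using lin_hom_diff[OF assms(1-3) x nc] n p(1)[OF x] M.M.r_neg by (simp add: a_minus_def)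
      moreover have "x = n \<oplus>\<^bsub>P\<^esub> (x \<ominus>\<^bsub>P\<^esub> n)"
        using x nc by (metis P.M.a_assoc P.M.a_comm P.M.a_inv_closed P.M.r_neg1 a_minus_def)
      ultimately show ?thesis unfolding mem using n(1) x nc by blast
    qed
    moreover have "N <+>\<^bsub>P\<^esub> a_kernel P M p \<subseteq> carrier P" unfolding subset_iff mem using N(1) by auto
    ultimately show "N <+>\<^bsub>P\<^esub> a_kernel P M p = carrier P" by blast
  qed
qed

lemma projective_cover_iff:
  assumes "left_module R M"
  shows "projective_cover R P p M \<longleftrightarrow>
    projective_module R P \<and> p \<in> lin_hom R P M \<and> p ` carrier P = carrier M \<and>
    (\<forall>N. submodule N R P \<and> p ` N = carrier M \<longrightarrow> N = carrier P)"
  unfolding projective_cover_def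
  using set_add_kernel_eq_carrier_iff[OF _ assms, of P p] projective_moduleD(2)[of R P] by metis

lemma projective_cover_lin_iso:
  assumes "projective_cover R P p M" "left_module R M" "left_module R M'" "left_module R P'"
    and e: "e \<in> lin_iso R P P'" and u: "u \<in> lin_iso R M M'" and p': "p' \<in> lin_hom R P' M'"
    and comm: "\<And>x. x \<in> carrier P \<Longrightarrow> p' (e x) = u (p x)"
  shows "projective_cover R P' p' M'"
proof -
  have pc: "projective_module R P" "p \<in> lin_hom R P M" "p ` carrier P = carrier M"
    and small: "\<And>N. submodule N R P \<Longrightarrow> p ` N = carrier M \<Longrightarrow> N = carrier P"
    using assms(1) unfolding projective_cover_iff[OF assms(2)] by auto
  note e' = lin_isoD[OF e] and u' = lin_isoD[OF u]
  have im: "p' ` e ` A = u ` p ` A" if "A \<subseteq> carrier P" for A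
    unfolding image_image using that comm by (intro image_cong) auto
  have "N = carrier P'" if N: "submodule N R P'" "p' ` N = carrier M'" for N
  proof -
    let ?N = "{x \<in> carrier P. e x \<in> N}"
    have "N \<subseteq> e ` carrier P" using e'(4) submoduleD(1)[OF N(1)] by simp
    then have eN: "e ` ?N = N" by blast
    have sub: "submodule ?N R P"
      using lin_hom_vimage_submodule[OF projective_moduleD(2)[OF pc(1)] assms(4) e'(1) N(1)] .
    have "u ` p ` ?N = u ` carrier M" using im[of ?N] eN N(2) u'(4) by auto
    then have "p ` ?N = carrier M"
      using inj_on_image_eq_iff[OF u'(3), of "p ` ?N" "carrier M"] lin_homD(1)[OF pc(2)] by auto
    then have "?N = carrier P" using small sub by blast
    then show ?thesis using eN e'(4) by simp
  qed
  moreover have "p' ` carrier P' = carrier M'" using im[of "carrier P"] e'(4) pc(3) u'(4) by simp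
  ultimately show ?thesis
    unfolding projective_cover_iff[OF assms(3)]
    using projective_module_lin_iso[OF pc(1) e assms(4)] p' by blast
qed

lemma projective_cover_unique:
  assumes c: "projective_cover R P p M" and c': "projective_cover R P' p' M'"
    and M: "left_module R M" "left_module R M'" and u: "u \<in> lin_iso R M M'"
  obtains e where "e \<in> lin_iso R P P'" "\<And>x. x \<in> carrier P \<Longrightarrow> p' (e x) = u (p x)"
proof -
  have pc: "projective_module R P" "p \<in> lin_hom R P M" "p ` carrier P = carrier M"
    and small: "\<And>N. submodule N R P \<Longrightarrow> p ` N = carrier M \<Longrightarrow> N = carrier P"
    using c unfolding projective_cover_iff[OF M(1)] by auto
  have pc': "projective_module R P'" "p' \<in> lin_hom R P' M'" "p' ` carrier P' = carrier M'"
    and small': "\<And>N. submodule N R P' \<Longrightarrow> p' ` N = carrier M' \<Longrightarrow> N = carrier P'"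
    using c' unfolding projective_cover_iff[OF M(2)] by auto
  note u' = lin_isoD[OF u] and P = projective_moduleD(2)[OF pc(1)] and P' = projective_moduleD(2)[OF pc'(1)]
  interpret P: left_module R P by fact
  interpret P': left_module R P' by fact
  have up: "(\<lambda>x. u (p x)) \<in> lin_hom R P M'" using lin_hom_comp[OF pc(2) u'(1)] .
  have upim: "(\<lambda>x. u (p x)) ` carrier P = carrier M'" using pc(3) u'(4) by (metis image_image)
  obtain e where e: "e \<in> lin_hom R P P'" and pe: "\<And>x. x \<in> carrier P \<Longrightarrow> p' (e x) = u (p x)"
    using projective_lift[OF pc(1) P' M(2) pc'(2) up] by (metis upim pc'(3) subset_refl)
  have "p' ` e ` carrier P = carrier M'" unfolding upim[symmetric] image_image using pe by auto
  then have esurj: "e ` carrier P = carrier P'"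
    using small' lin_hom_image_submodule[OF P P' e P.carrier_is_submodule] by blast
  obtain s where s: "s \<in> lin_hom R P' P" and es: "\<And>x. x \<in> carrier P' \<Longrightarrow> e (s x) = x"
    using projective_lift[OF pc'(1) P P' e lin_hom_id] by (metis esurj image_ident subset_refl)
  have "p (s (e x)) = p x" if x: "x \<in> carrier P" for x
  proof -
    have "u (p (s (e x))) = u (p x)"
      using pe[of "s (e x)"] pe[OF x] es lin_homD(1)[OF s] lin_homD(1)[OF e] x by simp
    then show ?thesis using u'(3) lin_homD(1)[OF pc(2)] lin_homD(1)[OF s] lin_homD(1)[OF e] x
      by (simp add: inj_on_def)
  qed
  then have "(\<lambda>x. p (s (e x))) ` carrier P = p ` carrier P" by (intro image_cong) auto
  then have "p ` s ` carrier P' = carrier M" unfolding esurj[symmetric] image_image pc(3) .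
  then have ssurj: "s ` carrier P' = carrier P"
    using small lin_hom_image_submodule[OF P' P s P'.carrier_is_submodule] by blast
  have "inj_on e (carrier P)"
  proof (rule inj_onI)
    fix x y assume a: "x \<in> carrier P" "y \<in> carrier P" "e x = e y"
    then obtain x' y' where "x' \<in> carrier P'" "y' \<in> carrier P'" "x = s x'" "y = s y'"
      unfolding ssurj[symmetric] by blast
    then show "x = y" using es a(3) by simp
  qed
  with e esurj have "e \<in> lin_iso R P P'" by (simp add: lin_iso_def bij_betw_def)
  then show ?thesis using pe by (rule that)
qed

lemma kernel_lin_iso:
  assumes "left_module R M" "left_module R M'" "u \<in> lin_iso R M M'" and e: "e \<in> lin_iso R P P'"
    and p: "p \<in> lin_hom R P M" and comm: "\<And>x. x \<in> carrier P \<Longrightarrow> p' (e x) = u (p x)"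
  shows "e \<in> lin_iso R (P\<lparr>carrier := a_kernel P M p\<rparr>) (P'\<lparr>carrier := a_kernel P' M' p'\<rparr>)"
proof -
  note e' = lin_isoD[OF e] and u' = lin_isoD[OF assms(3)]
  interpret M: left_module R M by fact
  have iff: "p' (e x) = \<zero>\<^bsub>M'\<^esub> \<longleftrightarrow> p x = \<zero>\<^bsub>M\<^esub>" if "x \<in> carrier P" for x
    using comm[OF that] lin_hom_zero[OF assms(1,2) u'(1)] u'(3) lin_homD(1)[OF p that]
    by (metis M.M.zero_closed inj_onD)
  then have "e ` a_kernel P M p = a_kernel P' M' p'"
    unfolding a_kernel_eq e'(4)[symmetric] by auto
  moreover have "inj_on e (a_kernel P M p)" using e'(3) by (auto simp: inj_on_def a_kernel_eq)
  ultimately show ?thesis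
    using e'(1) iff by (auto simp: lin_iso_def lin_hom_def bij_betw_def a_kernel_eq)
qed

lemma left_module_kernel:
  assumes "left_module R P" "left_module R M" "p \<in> lin_hom R P M"
  shows "left_module R (P\<lparr>carrier := a_kernel P M p\<rparr>)"
  unfolding a_kernel_eq
  by (intro left_module_of_submodule lin_hom_kernel_submodule assms)

text \<open>Uniqueness of projective covers is applied twice, the second time to the kernels of
  \<open>p\<close> and \<open>p'\<close>, which the isomorphism between the first covers
  identifies.\<close>

lemma minimal_presentation_unique:
  assumes m: "minimal_presentation R P1 d P0 p M" and m': "minimal_presentation R P1' d' P0' p' M"
    and M: "left_module R M"
  obtains e1 e0 where "e1 \<in> lin_iso R P1 P1'" "e0 \<in> lin_iso R P0 P0'"
    "\<And>x. x \<in> carrier P1 \<Longrightarrow> d' (e1 x) = e0 (d x)"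
proof -
  let ?K = "P0\<lparr>carrier := a_kernel P0 M p\<rparr>" and ?K' = "P0'\<lparr>carrier := a_kernel P0' M p'\<rparr>"
  have c: "projective_cover R P0 p M" "projective_cover R P1 d ?K"
    "projective_cover R P0' p' M" "projective_cover R P1' d' ?K'"
    using m m' unfolding minimal_presentation_def by auto
  have id: "(\<lambda>x. x) \<in> lin_iso R M M" using lin_hom_id by (auto simp: lin_iso_def bij_betw_def)
  obtain e0 where e0: "e0 \<in> lin_iso R P0 P0'" "\<And>x. x \<in> carrier P0 \<Longrightarrow> p' (e0 x) = p x"
    using projective_cover_unique[OF c(1,3) M M id] by metis
  have p: "p \<in> lin_hom R P0 M" "p' \<in> lin_hom R P0' M" "left_module R P0" "left_module R P0'"
    using c(1,3) unfolding projective_cover_iff[OF M] by (auto intro: projective_moduleD)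
  note k = kernel_lin_iso[OF M M id e0(1) p(1), of p', OF e0(2)]
  obtain e1 where e1: "e1 \<in> lin_iso R P1 P1'" "\<And>x. x \<in> carrier P1 \<Longrightarrow> d' (e1 x) = e0 (d x)"
    using projective_cover_unique[OF c(2,4) left_module_kernel[OF p(3) M p(1)]
        left_module_kernel[OF p(4) M p(2)] k] by metis
  show ?thesis by (rule that[OF e1(1) e0(1) e1(2)])
qed

lemma minimal_presentation_homs:
  assumes "minimal_presentation R P1 d P0 p M" "left_module R M"
  shows "projective_module R P0" "projective_module R P1" "p \<in> lin_hom R P0 M" "d \<in> lin_hom R P1 P0"
proof -
  show P: "projective_module R P0" "projective_module R P1" "p \<in> lin_hom R P0 M"
    using assms by (auto simp: minimal_presentation_def projective_cover_def)
  then have "left_module R (P0\<lparr>carrier := a_kernel P0 M p\<rparr>)"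
    using left_module_kernel[OF projective_moduleD(2) assms(2)] by blast
  then have "d \<in> lin_hom R P1 (P0\<lparr>carrier := a_kernel P0 M p\<rparr>)"
    using assms(1) by (auto simp: minimal_presentation_def projective_cover_def)
  then show "d \<in> lin_hom R P1 P0" by (auto simp: lin_hom_def a_kernel_eq)
qed

text \<open>The choice in \<open>transpose\<close> ranges over \<open>'a univ\<close>, so a
  presentation built from other element types has to be copied there before it shows that the choice
  succeeds.\<close>

lemma minimal_presentation_univ_copy:
  fixes R :: "('a, 'r) ring_scheme"
  assumes m: "minimal_presentation R P1 d P0 p M" and M: "left_module R M"
  obtains P1' :: "('a, 'a univ) module" and P0' :: "('a, 'a univ) module" and d' p'
  where "minimal_presentation R P1' d' P0' p' M"
proof -
  note h = minimal_presentation_homs[OF m M]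
  note P0 = projective_moduleD[OF h(1)] and P1 = projective_moduleD[OF h(2)]
  let ?K = "P0\<lparr>carrier := a_kernel P0 M p\<rparr>"
  have c: "projective_cover R P0 p M" "projective_cover R P1 d ?K"
    using m unfolding minimal_presentation_def by auto
  have K: "left_module R ?K" using left_module_kernel[OF P0(2) M h(3)] .
  obtain P0' :: "('a, 'a univ) module" and e0 where e0: "left_module R P0'" "e0 \<in> lin_iso R P0 P0'"
    using fg_module_univ_copy[OF P0(1)] by metis
  obtain P1' :: "('a, 'a univ) module" and e1 where e1: "left_module R P1'" "e1 \<in> lin_iso R P1 P1'"
    using fg_module_univ_copy[OF P1(1)] by metis
  let ?p = "\<lambda>x. p (inv_into (carrier P0) e0 x)" and ?d = "\<lambda>x. e0 (d (inv_into (carrier P1) e1 x))"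
  let ?K' = "P0'\<lparr>carrier := a_kernel P0' M ?p\<rparr>"
  have p': "?p \<in> lin_hom R P0' M"
    using lin_hom_comp[OF lin_isoD(1)[OF lin_iso_inv_into[OF P0(2) e0(2)]] h(3)] .
  have id: "(\<lambda>x. x) \<in> lin_iso R M M" using lin_hom_id by (auto simp: lin_iso_def bij_betw_def)
  have c0: "projective_cover R P0' ?p M"
    by (rule projective_cover_lin_iso[OF c(1) M M e0(1) e0(2) id p']) (simp add: lin_isoD[OF e0(2)])
  have k: "e0 \<in> lin_iso R ?K ?K'"
    by (rule kernel_lin_iso[OF M M id e0(2) h(3)]) (simp add: lin_isoD[OF e0(2)])
  have dK: "d \<in> lin_hom R P1 ?K" using c(2) unfolding projective_cover_iff[OF K] by blast
  have d': "?d \<in> lin_hom R P1' ?K'"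
    using lin_hom_comp[OF lin_hom_comp[OF lin_isoD(1)[OF lin_iso_inv_into[OF P1(2) e1(2)]] dK]
        lin_isoD(1)[OF k]] .
  have c1: "projective_cover R P1' ?d ?K'"
    by (rule projective_cover_lin_iso[OF c(2) K left_module_kernel[OF e0(1) M p'] e1 k d'])
      (simp add: lin_isoD[OF e1(2)])
  show ?thesis using that[of P1' ?d P0' ?p] c0 c1 unfolding minimal_presentation_def by blast
qed

section \<open>Descending chains of submodules\<close>

definition artinian_module :: "('a, 'r) ring_scheme \<Rightarrow> ('a, 'm) module \<Rightarrow> bool" where
  "artinian_module R M \<longleftrightarrow>
     (\<forall>N :: nat \<Rightarrow> 'm set. (\<forall>n. submodule (N n) R M) \<and> (\<forall>n. N (Suc n) \<subseteq> N n) \<longrightarrow>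
        (\<exists>n. \<forall>m\<ge>n. N m = N n))"

text \<open>Dependent choice turns the absence of a minimal member into a strictly descending
  chain.\<close>

lemma artinian_module_minimal:
  assumes "artinian_module R M" "N0 \<in> S" "\<And>N. N \<in> S \<Longrightarrow> submodule N R M"
  shows "\<exists>N\<in>S. \<forall>N'\<in>S. N' \<subseteq> N \<longrightarrow> N' = N"
proof (rule ccontr)
  assume "\<not> ?thesis"
  then have step: "\<exists>N'. N' \<in> S \<and> N' \<subset> N" if "N \<in> S" for N
    using that by (metis psubsetI)
  obtain c where c: "\<And>n. c n \<in> S" "\<And>n. c (Suc n) \<subset> c n"
    using dependent_nat_choice[of "\<lambda>_ N. N \<in> S" "\<lambda>_ N N'. N' \<subset> N"] assms(2) step by metis
  have "\<exists>n. \<forall>m\<ge>n. c m = c n"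
    using assms(1,3) c unfolding artinian_module_def by (meson psubset_imp_subset)
  then obtain n where "c (Suc n) = c n" by (meson le_Suc_eq order_refl)
  with c(2)[of n] show False by simp
qed

lemma submodule_Int:
  assumes "left_module R M" "submodule A R M" "submodule B R M"
  shows "submodule (A \<inter> B) R M"
proof -
  interpret M: left_module R M by fact
  show ?thesis
    using submoduleD[OF assms(2)] submoduleD[OF assms(3)] by (intro M.submoduleI') auto
qed

text \<open>Induction on the number of generators: a chain inside the span of \<open>k + 1\<close>
  generators is controlled by its intersections with the span of the first \<open>k\<close> and by
  the left ideals of coefficients that occur at the last generator. Both chains become stationary,
  and then so does the given one.\<close>

lemma artinian_module_fg:
  assumes reg: "artinian_module R (regular_module R)" and fg: "fg_module R M"
  shows "artinian_module R M"
proof -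
  interpret M: left_module R M using fg by (simp add: fg_module_def)
  note M = M.left_module_axioms
  obtain n x where x: "\<And>i. x i \<in> carrier M"
    and span: "\<And>m. m \<in> carrier M \<Longrightarrow> \<exists>c. (\<forall>i. c i \<in> carrier R) \<and> lin_comb M c x n = m"
    using fg_module_lin_comb[OF fg] by metis
  define S where "S k = {m. \<exists>c. (\<forall>i. c i \<in> carrier R) \<and> lin_comb M c x k = m}" for k
  have S: "submodule (S k) R M" for k unfolding S_def by (rule lin_comb_span_submodule[OF M x])
  have "\<exists>m. \<forall>j\<ge>m. N j = N m"
    if "\<And>j. submodule (N j) R M" "\<And>j. N (Suc j) \<subseteq> N j" "\<And>j. N j \<subseteq> S k" for N k
    using that
  proof (induction k arbitrary: N)
    case 0
    have "S 0 \<subseteq> {\<zero>\<^bsub>M\<^esub>}" by (auto simp: S_def)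
    then have "N j = {\<zero>\<^bsub>M\<^esub>}" for j
      using 0(3)[of j] submoduleD(2)[OF 0(1), of j] by blast
    then show ?case by blast
  next
    case (Suc k)
    note N = Suc.prems
    have anti: "N j \<subseteq> N i" if "i \<le> j" for i j
      using that N(2) by (rule lift_Suc_antimono_le[of N, rotated])
    let ?I = "\<lambda>j. {a \<in> carrier R. \<exists>s\<in>S k. s \<oplus>\<^bsub>M\<^esub> a \<odot>\<^bsub>M\<^esub> x k \<in> N j}"
    have sc: "s \<in> carrier M" if "s \<in> S k" for s using that submoduleD(1)[OF S] by blast
    have "submodule (?I j) R (regular_module R)" for j
    proof -
      interpret reg: left_module R "regular_module R" by (rule left_module_regular[OF M.R.ring_axioms])
      show ?thesis
      proof (rule reg.submoduleI')
        show "\<zero>\<^bsub>regular_module R\<^esub> \<in> ?I j"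
          using submoduleD(2)[OF S] submoduleD(2)[OF N(1)] x
          by (auto simp: regular_module_def M.smult_l_null intro!: bexI[of _ "\<zero>\<^bsub>M\<^esub>"])
        fix a assume "a \<in> ?I j"
        then obtain s where a: "a \<in> carrier R" "s \<in> S k" "s \<oplus>\<^bsub>M\<^esub> a \<odot>\<^bsub>M\<^esub> x k \<in> N j" by blast
        show "b \<odot>\<^bsub>regular_module R\<^esub> a \<in> ?I j" if b: "b \<in> carrier R" for b
        proof -
          have "b \<odot>\<^bsub>M\<^esub> (s \<oplus>\<^bsub>M\<^esub> a \<odot>\<^bsub>M\<^esub> x k) \<in> N j" using submoduleD(4)[OF N(1) b a(3)] .
          then have "b \<odot>\<^bsub>M\<^esub> s \<oplus>\<^bsub>M\<^esub> (b \<otimes>\<^bsub>R\<^esub> a) \<odot>\<^bsub>M\<^esub> x k \<in> N j"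
            using a b x sc by (simp add: M.smult_r_distr M.smult_assoc1)
          then show ?thesis using submoduleD(4)[OF S b a(2)] a b by (auto simp: regular_module_def)
        qed
        fix b assume "b \<in> ?I j"
        then obtain t where b: "b \<in> carrier R" "t \<in> S k" "t \<oplus>\<^bsub>M\<^esub> b \<odot>\<^bsub>M\<^esub> x k \<in> N j" by blast
        have "(s \<oplus>\<^bsub>M\<^esub> t) \<oplus>\<^bsub>M\<^esub> (a \<oplus>\<^bsub>R\<^esub> b) \<odot>\<^bsub>M\<^esub> x k
            = (s \<oplus>\<^bsub>M\<^esub> a \<odot>\<^bsub>M\<^esub> x k) \<oplus>\<^bsub>M\<^esub> (t \<oplus>\<^bsub>M\<^esub> b \<odot>\<^bsub>M\<^esub> x k)"
          using a b x sc by (simp add: M.smult_l_distr M.M.a_ac)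
        then have "(s \<oplus>\<^bsub>M\<^esub> t) \<oplus>\<^bsub>M\<^esub> (a \<oplus>\<^bsub>R\<^esub> b) \<odot>\<^bsub>M\<^esub> x k \<in> N j"
          using submoduleD(3)[OF N(1) a(3) b(3)] by simp
        then show "a \<oplus>\<^bsub>regular_module R\<^esub> b \<in> ?I j"
          using submoduleD(3)[OF S a(2) b(2)] a b by (auto simp: regular_module_def)
      qed (auto simp: regular_module_def)
    qed
    moreover have "?I (Suc j) \<subseteq> ?I j" for j using N(2) by blast
    ultimately have "\<exists>m. \<forall>j\<ge>m. ?I j = ?I m"
      using reg[unfolded artinian_module_def, rule_format, of ?I] by blast
    then obtain m1 where m1: "\<And>j. j \<ge> m1 \<Longrightarrow> ?I j = ?I m1" by blast
    have "\<exists>m. \<forall>j\<ge>m. N j \<inter> S k = N m \<inter> S k"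
      by (rule Suc.IH) (use N(2) submodule_Int[OF M N(1) S] in auto)
    then obtain m2 where m2: "\<And>j. j \<ge> m2 \<Longrightarrow> N j \<inter> S k = N m2 \<inter> S k" by blast
    let ?m = "max m1 m2"
    have "N ?m \<subseteq> N j" if j: "j \<ge> ?m" for j
    proof
      fix y assume y: "y \<in> N ?m"
      then obtain c where c: "\<And>i. c i \<in> carrier R" "lin_comb M c x (Suc k) = y"
        using N(3) unfolding S_def by blast
      define s where "s = lin_comb M c x k"
      have s: "s \<in> S k" "y = s \<oplus>\<^bsub>M\<^esub> c k \<odot>\<^bsub>M\<^esub> x k" using c by (auto simp: S_def s_def)
      then have "c k \<in> ?I ?m" using y c(1) by blast
      then have "c k \<in> ?I j" using m1[of j] m1[of ?m] j by simp
      then obtain t where t: "t \<in> S k" "t \<oplus>\<^bsub>M\<^esub> c k \<odot>\<^bsub>M\<^esub> x k \<in> N j" by blast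
      \<comment> \<open>\<open>y\<close> and \<open>?z\<close> have the same last coefficient
        \<open>c k\<close>, so their difference lies in the span \<open>S k\<close>, where the chain
        is already stationary.\<close>
      let ?z = "t \<oplus>\<^bsub>M\<^esub> c k \<odot>\<^bsub>M\<^esub> x k"
      have car: "s \<in> carrier M" "t \<in> carrier M" "c k \<odot>\<^bsub>M\<^esub> x k \<in> carrier M"
        using s(1) t(1) sc c(1) x by auto
      have eq: "y \<oplus>\<^bsub>M\<^esub> \<ominus>\<^bsub>M\<^esub> ?z = s \<oplus>\<^bsub>M\<^esub> \<ominus>\<^bsub>M\<^esub> t"
        unfolding s(2) using car by (simp add: M.M.minus_add M.M.a_ac M.M.r_neg M.M.r_neg2)
      have "?z \<in> N ?m" using t(2) anti[OF j] by blast
      then have "y \<oplus>\<^bsub>M\<^esub> \<ominus>\<^bsub>M\<^esub> ?z \<in> N ?m" using y submoduleD(3,5)[OF N(1)] by blast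
      moreover have "y \<oplus>\<^bsub>M\<^esub> \<ominus>\<^bsub>M\<^esub> ?z \<in> S k"
        unfolding eq using s(1) t(1) submoduleD(3,5)[OF S] by blast
      ultimately have "y \<oplus>\<^bsub>M\<^esub> \<ominus>\<^bsub>M\<^esub> ?z \<in> N j" using m2[of j] m2[of ?m] j by auto
      then have "(y \<oplus>\<^bsub>M\<^esub> \<ominus>\<^bsub>M\<^esub> ?z) \<oplus>\<^bsub>M\<^esub> ?z \<in> N j" using t(2) submoduleD(3)[OF N(1)] by blast
      moreover have "(y \<oplus>\<^bsub>M\<^esub> \<ominus>\<^bsub>M\<^esub> ?z) \<oplus>\<^bsub>M\<^esub> ?z = y"
        using car s(2) by (simp add: M.M.a_assoc M.M.l_neg)
      ultimately show "y \<in> N j" by simp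
    qed
    with anti show ?case by blast
  qed
  moreover have "carrier M \<subseteq> S n" using span by (auto simp: S_def)
  ultimately show ?thesis
    unfolding artinian_module_def using submoduleD(1)[of _ R M]
    by (metis (no_types, lifting) order_trans)
qed

section \<open>Change of scalars and the descending chain condition over an Artin algebra\<close>

lemma left_module_restrict_scalars:
  assumes "ring k" "\<phi> \<in> ring_hom k R" "left_module R M"
  shows "left_module k (restrict_scalars \<phi> M)"
proof -
  interpret M: left_module R M by fact
  have [simp]: "\<phi> a \<in> carrier R" if "a \<in> carrier k" for a
    using assms(2) that by (auto simp: ring_hom_def)
  show ?thesis
  proof (intro left_module.intro left_module_axioms.intro abelian_groupI assms(1))
    fix x assume "x \<in> carrier (restrict_scalars \<phi> M)"
    then show "\<exists>y\<in>carrier (restrict_scalars \<phi> M). y \<oplus>\<^bsub>restrict_scalars \<phi> M\<^esub> x = \<zero>\<^bsub>restrict_scalars \<phi> M\<^esub>"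
      by (intro bexI[of _ "\<ominus>\<^bsub>M\<^esub> x"]) (auto simp: restrict_scalars_def M.M.l_neg)
  qed (use assms(2) in \<open>auto simp: restrict_scalars_def ring_hom_def M.M.a_ac M.smult_one
      M.smult_l_distr M.smult_r_distr M.smult_assoc1\<close>)
qed

lemma artin_algebraD:
  assumes "artin_algebra k \<phi> R"
  shows "cring k" "ring k" "artinian_ring k" "ring R" "\<phi> \<in> ring_hom k R"
    "finitely_generated k (restrict_scalars \<phi> (regular_module R))"
    "\<And>c. c \<in> carrier k \<Longrightarrow> \<phi> c \<in> carrier R"
    "\<And>c a. \<lbrakk>c \<in> carrier k; a \<in> carrier R\<rbrakk> \<Longrightarrow> \<phi> c \<otimes>\<^bsub>R\<^esub> a = a \<otimes>\<^bsub>R\<^esub> \<phi> c"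
  using assms by (auto simp: artin_algebra_def cring_def ring_hom_def)

text \<open>The chain condition travels from the ideals of \<open>k\<close> to \<open>R\<close> as a
  finitely generated \<open>k\<close>-module, from there to the left ideals of \<open>R\<close>,
  which are \<open>k\<close>-submodules, and finally to finitely generated
  \<open>R\<close>-modules.\<close>

lemma artin_algebra_artinian_module:
  assumes A: "artin_algebra k \<phi> R" and "fg_module R M"
  shows "artinian_module R M"
proof (rule artinian_module_fg[OF _ assms(2)])
  note A = artin_algebraD[OF A]
  interpret k: cring k by (rule A(1))
  interpret R: ring R by (rule A(4))
  have reg: "left_module k (regular_module k)" "left_module R (regular_module R)"
    using left_module_regular A by auto
  \<comment> \<open>Commutativity of \<open>k\<close> makes these submodules two-sided ideals, the
    objects that \<open>artinian_ring\<close> speaks of.\<close>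
  have ideal: "ideal I k" if I: "submodule I k (regular_module k)" for I
  proof (rule idealI[OF k.ring_axioms])
    have c: "I \<subseteq> carrier k" using submoduleD(1)[OF I] by (simp add: regular_module_def)
    have m: "a \<otimes>\<^bsub>k\<^esub> x \<in> I" if "a \<in> carrier k" "x \<in> I" for a x
      using submoduleD(4)[OF I that] by (simp add: regular_module_def)
    then have "\<ominus>\<^bsub>k\<^esub> x \<in> I" if "x \<in> I" for x
      using that c by (metis k.add.inv_closed k.l_minus k.l_one k.one_closed subsetD)
    then show "subgroup I (add_monoid k)"
      using c submoduleD(2,3)[OF I] by (intro k.add.subgroupI) (auto simp: regular_module_def)
    show "x \<otimes>\<^bsub>k\<^esub> a \<in> I" "a \<otimes>\<^bsub>k\<^esub> x \<in> I" if "a \<in> I" "x \<in> carrier k" for a x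
      using m[OF that(2,1)] k.m_comm[of a x] that c by auto
  qed
  have a0: "artinian_module k (regular_module k)"
    unfolding artinian_module_def
  proof (intro allI impI)
    fix N assume "(\<forall>n. submodule (N n) k (regular_module k)) \<and> (\<forall>n. N (Suc n) \<subseteq> N n)"
    then show "\<exists>n. \<forall>m\<ge>n. N m = N n"
      by (intro A(3)[unfolded artinian_ring_def, THEN conjunct2, THEN spec, THEN mp]) (simp add: ideal)
  qed
  have lm: "left_module k (restrict_scalars \<phi> (regular_module R))"
    using left_module_restrict_scalars[OF A(2,5) reg(2)] .
  have a: "artinian_module k (restrict_scalars \<phi> (regular_module R))"
    by (rule artinian_module_fg[OF a0]) (simp add: fg_module_def lm A(6))
  have sub: "submodule I k (restrict_scalars \<phi> (regular_module R))"
    if "submodule I R (regular_module R)" for I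
    using submoduleD[OF that] A(7)
    by (intro left_module.submoduleI'[OF lm]) (auto simp: restrict_scalars_def)
  show "artinian_module R (regular_module R)"
    unfolding artinian_module_def
  proof (intro allI impI)
    fix N assume "(\<forall>n. submodule (N n) R (regular_module R)) \<and> (\<forall>n. N (Suc n) \<subseteq> N n)"
    then show "\<exists>n. \<forall>m\<ge>n. N m = N n"
      by (intro a[unfolded artinian_module_def, THEN spec, THEN mp]) (simp add: sub)
  qed
qed

section \<open>Idempotents\<close>

lemma lin_hom_sub:
  assumes "left_module R N" "f \<in> lin_hom R M N" "g \<in> lin_hom R M N"
  shows "(\<lambda>x. f x \<ominus>\<^bsub>N\<^esub> g x) \<in> lin_hom R M N"
proof -
  interpret N: left_module R N by fact
  show ?thesis
    by (rule lin_homI) (simp_all add: lin_homD[OF assms(2)] lin_homD[OF assms(3)] a_minus_def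
        N.smult_r_distr N.smult_r_minus N.M.minus_add N.M.a_ac)
qed

lemma (in abelian_group) diff_cancel:
  "\<lbrakk>x \<in> carrier G; y \<in> carrier G\<rbrakk> \<Longrightarrow> (x \<ominus> y) \<oplus> y = x"
  "\<lbrakk>x \<in> carrier G; y \<in> carrier G\<rbrakk> \<Longrightarrow> y \<oplus> (x \<ominus> y) = x"
  "\<lbrakk>x \<in> carrier G; y \<in> carrier G\<rbrakk> \<Longrightarrow> (x \<oplus> y) \<ominus> x = y"
  "x \<in> carrier G \<Longrightarrow> x \<ominus> x = \<zero>"
  "x \<in> carrier G \<Longrightarrow> x \<ominus> \<zero> = x"
  "\<lbrakk>x \<in> carrier G; y \<in> carrier G\<rbrakk> \<Longrightarrow> x \<ominus> y = \<zero> \<longleftrightarrow> x = y"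
proof -
  show 1: "(x \<ominus> y) \<oplus> y = x" if "x \<in> carrier G" "y \<in> carrier G" for x y
    using that by (simp add: a_minus_def a_assoc l_neg)
  show "y \<oplus> (x \<ominus> y) = x" if "x \<in> carrier G" "y \<in> carrier G"
    using that 1 a_comm[of y "x \<ominus> y"] by simp
  show "(x \<oplus> y) \<ominus> x = y" if "x \<in> carrier G" "y \<in> carrier G"
    using that a_comm[of x y] by (simp add: a_minus_def a_assoc r_neg)
  show "x \<ominus> y = \<zero> \<longleftrightarrow> x = y" if "x \<in> carrier G" "y \<in> carrier G"
    using that 1[OF that] by (metis a_minus_def l_zero r_neg)
  show "x \<ominus> x = \<zero>" if "x \<in> carrier G"
    using that by (simp add: a_minus_def r_neg)
  show "x \<ominus> \<zero> = x" if "x \<in> carrier G"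
    using 1[OF that zero_closed] minus_closed[OF that zero_closed] r_zero by metis
qed

text \<open>
  For mutually minimal supplements \<open>K\<close> and \<open>L\<close>, a map \<open>\<alpha>\<close> into \<open>K\<close> with \<open>1 - \<alpha>\<close> mapping into \<open>L\<close>
  is automatically idempotent: its kernel is contained in \<open>L\<close> and is still a supplement of \<open>K\<close>, so
  it equals \<open>L\<close>.
\<close>

lemma projective_sum_idempotent:
  assumes P: "projective_module R P" and art: "artinian_module R P"
    and K0: "submodule K0 R P" and L0: "submodule L0 R P"
    and sum: "\<And>p. p \<in> carrier P \<Longrightarrow> \<exists>k\<in>K0. \<exists>l\<in>L0. p = k \<oplus>\<^bsub>P\<^esub> l"
  shows "\<exists>e\<in>lin_hom R P P. \<forall>p\<in>carrier P. e (e p) = e p \<and> e p \<in> K0 \<and> p \<ominus>\<^bsub>P\<^esub> e p \<in> L0"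
proof -
  interpret P: left_module R P by (rule projective_moduleD(2)[OF P])
  note lP = P.left_module_axioms
  define s where "s A B \<longleftrightarrow> (\<forall>p\<in>carrier P. \<exists>k\<in>A. \<exists>l\<in>B. p = k \<oplus>\<^bsub>P\<^esub> l)" for A B
  \<comment> \<open>The order of the choices matters: \<open>L\<close> is minimal among the
    supplements of \<open>K0\<close>, and \<open>K\<close> is then minimal for this
    \<open>L\<close>. Since \<open>K\<close> lies in \<open>K0\<close>, a supplement of
    \<open>K\<close> inside \<open>L\<close> still competes with \<open>L\<close>.\<close>
  let ?SL = "{L. submodule L R P \<and> L \<subseteq> L0 \<and> s K0 L}"
  have "s K0 L0" unfolding s_def by (intro ballI sum)
  then have "L0 \<in> ?SL" using L0 by simp
  then have "\<exists>L\<in>?SL. \<forall>L'\<in>?SL. L' \<subseteq> L \<longrightarrow> L' = L"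
    by (intro artinian_module_minimal[OF art]) auto
  then obtain L where LS: "L \<in> ?SL" and "\<forall>L'\<in>?SL. L' \<subseteq> L \<longrightarrow> L' = L" ..
  then have Lmin: "L' = L" if "submodule L' R P" "L' \<subseteq> L0" "s K0 L'" "L' \<subseteq> L" for L'
    using that by simp
  have L: "submodule L R P" "L \<subseteq> L0" "s K0 L" using LS by auto
  let ?SK = "{K. submodule K R P \<and> K \<subseteq> K0 \<and> s K L}"
  have "K0 \<in> ?SK" using K0 L(3) by simp
  then have "\<exists>K\<in>?SK. \<forall>K'\<in>?SK. K' \<subseteq> K \<longrightarrow> K' = K"
    by (intro artinian_module_minimal[OF art]) auto
  then obtain K where KS: "K \<in> ?SK" and "\<forall>K'\<in>?SK. K' \<subseteq> K \<longrightarrow> K' = K" ..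
  then have Kmin: "K' = K" if "submodule K' R P" "K' \<subseteq> K0" "s K' L" "K' \<subseteq> K" for K'
    using that by simp
  have K: "submodule K R P" "K \<subseteq> K0" "s K L" using KS by auto
  have Kc: "x \<in> carrier P" if "x \<in> K" for x using submoduleD(1)[OF K(1)] that by blast
  have Lc: "x \<in> carrier P" if "x \<in> L" for x using submoduleD(1)[OF L(1)] that by blast
  obtain \<alpha> where \<alpha>: "\<alpha> \<in> lin_hom R P P" and \<alpha>K: "\<And>p. p \<in> carrier P \<Longrightarrow> \<alpha> p \<in> K"
    and \<alpha>L: "\<And>p. p \<in> carrier P \<Longrightarrow> p \<ominus>\<^bsub>P\<^esub> \<alpha> p \<in> L"
    using projective_split_sum[OF P K(1) L(1)] K(3) unfolding s_def by metis
  note \<alpha>' = lin_homD[OF \<alpha>]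
  \<comment> \<open>Elements of \<open>K\<close> differ from their images under
    \<open>\<alpha>\<close> by elements of \<open>L\<close>, so the image of \<open>K\<close> is a
    supplement of \<open>L\<close> as well; minimality of \<open>K\<close> makes it all of
    \<open>K\<close>.\<close>
  have "s (\<alpha> ` K) L"
    unfolding s_def
  proof
    fix p assume "p \<in> carrier P"
    then obtain k l where kl: "k \<in> K" "l \<in> L" "p = k \<oplus>\<^bsub>P\<^esub> l" using K(3) unfolding s_def by blast
    have "k = \<alpha> k \<oplus>\<^bsub>P\<^esub> (k \<ominus>\<^bsub>P\<^esub> \<alpha> k)" using P.M.diff_cancel(2) Kc kl(1) \<alpha>'(1) by simp
    then have "p = \<alpha> k \<oplus>\<^bsub>P\<^esub> ((k \<ominus>\<^bsub>P\<^esub> \<alpha> k) \<oplus>\<^bsub>P\<^esub> l)"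
      using kl Kc Lc \<alpha>'(1) by (metis P.M.a_assoc P.M.minus_closed)
    moreover have "(k \<ominus>\<^bsub>P\<^esub> \<alpha> k) \<oplus>\<^bsub>P\<^esub> l \<in> L" using submoduleD(3)[OF L(1)] \<alpha>L Kc kl by blast
    ultimately show "\<exists>k\<in>\<alpha> ` K. \<exists>l\<in>L. p = k \<oplus>\<^bsub>P\<^esub> l" using kl(1) by blast
  qed
  moreover have "\<alpha> ` K \<subseteq> K" using \<alpha>K Kc by blast
  ultimately have \<alpha>im: "\<alpha> ` K = K"
    using Kmin[OF lin_hom_image_submodule[OF lP lP \<alpha> K(1)]] K(2) by simp
  let ?N = "{x \<in> carrier P. \<alpha> x = \<zero>\<^bsub>P\<^esub>}"
  have "?N \<subseteq> L"
  proof
    fix x assume "x \<in> ?N"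
    then show "x \<in> L" using \<alpha>L[of x] P.M.diff_cancel(5)[of x] by simp
  qed
  moreover have "s K0 ?N"
    unfolding s_def
  proof
    fix p assume p: "p \<in> carrier P"
    then have "\<alpha> p \<in> \<alpha> ` K" unfolding \<alpha>im by (rule \<alpha>K)
    then obtain k where k: "k \<in> K" "\<alpha> k = \<alpha> p" by auto
    have "\<alpha> (p \<ominus>\<^bsub>P\<^esub> k) = \<zero>\<^bsub>P\<^esub>"
      using lin_hom_diff[OF lP lP \<alpha> p Kc[OF k(1)]] k(2) P.M.diff_cancel(4) \<alpha>'(1)[OF p] by simp
    then have "p \<ominus>\<^bsub>P\<^esub> k \<in> ?N" using p Kc[OF k(1)] by simp
    moreover have "p = k \<oplus>\<^bsub>P\<^esub> (p \<ominus>\<^bsub>P\<^esub> k)" using P.M.diff_cancel(2) p Kc[OF k(1)] by simp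
    ultimately show "\<exists>k\<in>K0. \<exists>l\<in>?N. p = k \<oplus>\<^bsub>P\<^esub> l" using k(1) K(2) by blast
  qed
  ultimately have N: "?N = L"
    using Lmin[OF lin_hom_kernel_submodule[OF lP lP \<alpha>]] L(2) by simp
  have "\<alpha> (\<alpha> p) = \<alpha> p" if p: "p \<in> carrier P" for p
  proof -
    have "\<alpha> (p \<ominus>\<^bsub>P\<^esub> \<alpha> p) = \<zero>\<^bsub>P\<^esub>" using \<alpha>L[OF p] N by blast
    then show ?thesis
      using lin_hom_diff[OF lP lP \<alpha> p \<alpha>'(1)[OF p]] P.M.diff_cancel(6) \<alpha>'(1) p by metis
  qed
  then show ?thesis using \<alpha>K \<alpha>L K(2) L(2) by (intro bexI[OF _ \<alpha>]) auto
qed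

lemma idempotent_image_kernel:
  assumes M: "left_module R M" and e: "e \<in> lin_hom R M M"
    and idem: "\<And>x. x \<in> carrier M \<Longrightarrow> e (e x) = e x"
  defines "A \<equiv> M\<lparr>carrier := e ` carrier M\<rparr>"
    and "B \<equiv> M\<lparr>carrier := {x \<in> carrier M. e x = \<zero>\<^bsub>M\<^esub>}\<rparr>"
  shows "(\<lambda>x. (e x, x \<ominus>\<^bsub>M\<^esub> e x)) \<in> lin_iso R M (direct_sum A B)"
    and "fg_module R M \<Longrightarrow> fg_module R A" and "fg_module R M \<Longrightarrow> fg_module R B"
proof -
  interpret M: left_module R M by fact
  note e' = lin_homD[OF e]
  have A: "left_module R A" unfolding A_def
    by (intro left_module_of_submodule[OF M] lin_hom_image_submodule[OF M M e] M.carrier_is_submodule)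
  have B: "left_module R B" unfolding B_def
    by (intro left_module_of_submodule[OF M] lin_hom_kernel_submodule[OF M M e])
  have eA: "e \<in> lin_hom R M A" using e' by (auto simp: A_def intro!: lin_homI)
  let ?g = "\<lambda>x. x \<ominus>\<^bsub>M\<^esub> e x"
  have g: "?g \<in> lin_hom R M M" by (rule lin_hom_sub[OF M lin_hom_id e])
  have eg: "e (?g x) = \<zero>\<^bsub>M\<^esub>" if "x \<in> carrier M" for x
    using lin_hom_diff[OF M M e that] idem[OF that] e'(1) M.M.diff_cancel(4) that by simp
  have gB: "?g \<in> lin_hom R M B" using lin_homD[OF g] eg by (auto simp: B_def intro!: lin_homI)
  have Bg: "?g x = x" if "x \<in> carrier B" for x
    using that M.M.diff_cancel(5) by (simp add: B_def)
  have "?g ` carrier M = carrier B"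
  proof (intro equalityI subsetI)
    fix x assume "x \<in> carrier B"
    then show "x \<in> ?g ` carrier M" using Bg[of x] by (intro image_eqI[of _ _ x]) (auto simp: B_def)
  qed (use lin_homD(1)[OF gB] in auto)
  then show "fg_module R M \<Longrightarrow> fg_module R B" using fg_module_surj_image[OF _ B gB] by blast
  show "fg_module R M \<Longrightarrow> fg_module R A" using fg_module_surj_image[OF _ A eA] by (simp add: A_def)
  let ?h = "\<lambda>x. (e x, ?g x)"
  have "?h \<in> lin_hom R M (direct_sum A B)"
    using lin_homD[OF eA] lin_homD[OF gB] by (auto simp: direct_sum_def intro!: lin_homI)
  moreover have "inj_on ?h (carrier M)"
  proof (rule inj_onI)
    fix x y assume xy: "x \<in> carrier M" "y \<in> carrier M" "?h x = ?h y"
    have "x = ?g x \<oplus>\<^bsub>M\<^esub> e x" using M.M.diff_cancel(1) xy(1) e'(1) by simp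
    also have "\<dots> = ?g y \<oplus>\<^bsub>M\<^esub> e y"
      using arg_cong[OF xy(3), of fst] arg_cong[OF xy(3), of snd] by (simp only: fst_conv snd_conv)
    also have "\<dots> = y" using M.M.diff_cancel(1) xy(2) e'(1) by simp
    finally show "x = y" .
  qed
  moreover have "?h ` carrier M = carrier (direct_sum A B)"
  proof (intro equalityI subsetI)
    fix z assume "z \<in> carrier (direct_sum A B)"
    then obtain a b where z: "z = (e a, b)" "a \<in> carrier M" "b \<in> carrier M" "e b = \<zero>\<^bsub>M\<^esub>"
      by (auto simp: direct_sum_def A_def B_def)
    then have "e (e a \<oplus>\<^bsub>M\<^esub> b) = e a" using e' idem by simp
    moreover have "(e a \<oplus>\<^bsub>M\<^esub> b) \<ominus>\<^bsub>M\<^esub> e a = b" using z e'(1) M.M.diff_cancel(3) by simp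
    ultimately show "z \<in> ?h ` carrier M"
      using z e'(1) by (intro image_eqI[of _ _ "e a \<oplus>\<^bsub>M\<^esub> b"]) auto
  qed (use lin_homD(1)[OF \<open>?h \<in> lin_hom R M (direct_sum A B)\<close>] in auto)
  ultimately show "?h \<in> lin_iso R M (direct_sum A B)" by (simp add: lin_iso_def bij_betw_def)
qed

lemma idempotent_eq_id:
  assumes M: "left_module R M" and e: "e \<in> lin_hom R M M" and x: "x \<in> carrier M"
    and idem: "e (e x) = e x" and ker: "{x \<in> carrier M. e x = \<zero>\<^bsub>M\<^esub>} = {\<zero>\<^bsub>M\<^esub>}"
  shows "e x = x"
proof -
  interpret M: left_module R M by (rule M)
  note ex = lin_homD(1)[OF e x]
  have "e (x \<ominus>\<^bsub>M\<^esub> e x) = \<zero>\<^bsub>M\<^esub>"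
    using lin_hom_diff[OF M M e x ex] idem ex M.M.diff_cancel(4) by simp
  then have "x \<ominus>\<^bsub>M\<^esub> e x \<in> {x \<in> carrier M. e x = \<zero>\<^bsub>M\<^esub>}" using x ex by simp
  then have "x \<ominus>\<^bsub>M\<^esub> e x = \<zero>\<^bsub>M\<^esub>" unfolding ker by simp
  then show ?thesis using M.M.diff_cancel(6) x ex by metis
qed

text \<open>The images and the kernels of the two idempotents form subobjects whose sum is
  \<open>X\<close>, and they keep the element types of \<open>X\<close>, as the quantifiers in
  \<open>mor_indecomposable\<close> require. One of them vanishes: a zero image gives the zero
  endomorphism, a zero kernel the identity.\<close>

lemma mor_indecomposable_idempotent:
  assumes X: "mor_indecomposable R X" and e: "(e1, e2) \<in> mor_hom R X X"
    and idem1: "\<And>x. x \<in> carrier (src X) \<Longrightarrow> e1 (e1 x) = e1 x"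
    and idem2: "\<And>x. x \<in> carrier (tgt X) \<Longrightarrow> e2 (e2 x) = e2 x"
  shows "(\<forall>x\<in>carrier (src X). e1 x = \<zero>\<^bsub>src X\<^esub>) \<and> (\<forall>x\<in>carrier (tgt X). e2 x = \<zero>\<^bsub>tgt X\<^esub>) \<or>
    (\<forall>x\<in>carrier (src X). e1 x = x) \<and> (\<forall>x\<in>carrier (tgt X). e2 x = x)"
proof -
  have fg: "fg_module R (src X)" "fg_module R (tgt X)" and f: "arr X \<in> lin_hom R (src X) (tgt X)"
    using X by (auto simp: mor_indecomposable_def mor_obj_def)
  have e1: "e1 \<in> lin_hom R (src X) (src X)" and e2: "e2 \<in> lin_hom R (tgt X) (tgt X)"
    and comm: "\<And>x. x \<in> carrier (src X) \<Longrightarrow> arr X (e1 x) = e2 (arr X x)"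
    using e by (auto simp: mor_hom_def)
  interpret S: left_module R "src X" using fg by (simp add: fg_module_def)
  interpret T: left_module R "tgt X" using fg by (simp add: fg_module_def)
  note lm = S.left_module_axioms T.left_module_axioms
  let ?Y = "\<lparr>src = (src X)\<lparr>carrier := e1 ` carrier (src X)\<rparr>,
             tgt = (tgt X)\<lparr>carrier := e2 ` carrier (tgt X)\<rparr>, arr = arr X\<rparr>"
  let ?Z = "\<lparr>src = (src X)\<lparr>carrier := {x \<in> carrier (src X). e1 x = \<zero>\<^bsub>src X\<^esub>}\<rparr>,
             tgt = (tgt X)\<lparr>carrier := {x \<in> carrier (tgt X). e2 x = \<zero>\<^bsub>tgt X\<^esub>}\<rparr>, arr = arr X\<rparr>"
  note i1 = idempotent_image_kernel[OF lm(1) e1 idem1] and i2 = idempotent_image_kernel[OF lm(2) e2 idem2]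
  note f' = lin_homD[OF f] and e1' = lin_homD[OF e1] and e2' = lin_homD[OF e2]
  have f0: "arr X \<zero>\<^bsub>src X\<^esub> = \<zero>\<^bsub>tgt X\<^esub>" by (rule lin_hom_zero[OF lm f])
  have Y: "mor_obj R ?Y"
    using i1(2)[OF _ fg(1)] i2(2)[OF _ fg(2)] f' e1'(1) comm
    by (auto simp: mor_obj_def lin_hom_def)
  have Z: "mor_obj R ?Z"
    using i1(3)[OF _ fg(1)] i2(3)[OF _ fg(2)] f' comm[symmetric] f0
    by (auto simp: mor_obj_def lin_hom_def)
  have "mor_iso R X (mor_sum ?Y ?Z)"
    unfolding mor_iso_def
  proof (intro bexI[of _ "(\<lambda>x. (e1 x, x \<ominus>\<^bsub>src X\<^esub> e1 x), \<lambda>x. (e2 x, x \<ominus>\<^bsub>tgt X\<^esub> e2 x))"])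
    show "(\<lambda>x. (e1 x, x \<ominus>\<^bsub>src X\<^esub> e1 x), \<lambda>x. (e2 x, x \<ominus>\<^bsub>tgt X\<^esub> e2 x)) \<in> mor_hom R X (mor_sum ?Y ?Z)"
      using lin_isoD(1)[OF i1(1)] lin_isoD(1)[OF i2(1)] lin_hom_diff[OF lm f] e1'(1)
      by (auto simp: mor_hom_def mor_sum_def comm)
    show "case (\<lambda>x. (e1 x, x \<ominus>\<^bsub>src X\<^esub> e1 x), \<lambda>x. (e2 x, x \<ominus>\<^bsub>tgt X\<^esub> e2 x)) of (h1, h2) \<Rightarrow>
       bij_betw h1 (carrier (src X)) (carrier (src (mor_sum ?Y ?Z))) \<and>
       bij_betw h2 (carrier (tgt X)) (carrier (tgt (mor_sum ?Y ?Z)))"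
      using lin_isoD(2)[OF i1(1)] lin_isoD(2)[OF i2(1)] by (simp add: mor_sum_def)
  qed
  then have "mor_zero ?Y \<or> mor_zero ?Z"
    using X Y Z unfolding mor_indecomposable_def by blast
  then show ?thesis
  proof
    assume "mor_zero ?Y"
    then show ?thesis by (auto simp: mor_zero_def)
  next
    assume z: "mor_zero ?Z"
    show ?thesis
      using idempotent_eq_id[OF lm(1) e1 _ idem1] idempotent_eq_id[OF lm(2) e2 _ idem2] z
      by (simp add: mor_zero_def)
  qed
qed

section \<open>The minimal presentation of the cokernel\<close>

lemma quotient_projection:
  assumes M: "left_module R M" and A: "submodule A R M"
  shows "(\<lambda>x. A +>\<^bsub>M\<^esub> x) \<in> lin_hom R M (quotient_module M A)"
    and "(\<lambda>x. A +>\<^bsub>M\<^esub> x) ` carrier M = carrier (quotient_module M A)"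
    and "left_module R (quotient_module M A)"
    and "x \<in> carrier M \<Longrightarrow> A +>\<^bsub>M\<^esub> x = \<zero>\<^bsub>quotient_module M A\<^esub> \<longleftrightarrow> x \<in> A"
proof -
  interpret M: left_module R M by fact
  note sub = submodule.axioms(1)[OF A]
  interpret A: abelian_subgroup A M
    by (intro abelian_subgroupI3 additive_subgroupI sub M.M.abelian_group_axioms)
  \<comment> \<open>The scalar action of \<open>quotient_module\<close> is a union over all
    representatives of a coset; by linearity they all give the same coset, so the union
    collapses.\<close>
  have sm: "(\<Union>y\<in>A +>\<^bsub>M\<^esub> x. A +>\<^bsub>M\<^esub> (a \<odot>\<^bsub>M\<^esub> y)) = A +>\<^bsub>M\<^esub> (a \<odot>\<^bsub>M\<^esub> x)"
    if "a \<in> carrier R" "x \<in> carrier M" for a x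
  proof -
    have "A +>\<^bsub>M\<^esub> (a \<odot>\<^bsub>M\<^esub> y) = A +>\<^bsub>M\<^esub> (a \<odot>\<^bsub>M\<^esub> x)" if y: "y \<in> A +>\<^bsub>M\<^esub> x" for y
    proof -
      obtain h where h: "h \<in> A" "y = h \<oplus>\<^bsub>M\<^esub> x" using y unfolding a_r_coset_def' by blast
      have "h \<in> carrier M" using h(1) A.a_subset by blast
      then have "a \<odot>\<^bsub>M\<^esub> y = a \<odot>\<^bsub>M\<^esub> h \<oplus>\<^bsub>M\<^esub> a \<odot>\<^bsub>M\<^esub> x"
        using M.smult_r_distr[of a h x] \<open>a \<in> carrier R\<close> \<open>x \<in> carrier M\<close> h(2) by simp
      then have "a \<odot>\<^bsub>M\<^esub> y \<in> A +>\<^bsub>M\<^esub> (a \<odot>\<^bsub>M\<^esub> x)"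
        using submoduleD(4)[OF A \<open>a \<in> carrier R\<close> h(1)] unfolding a_r_coset_def' by blast
      then show ?thesis
        using M.M.a_repr_independence[OF _ _ sub] \<open>a \<in> carrier R\<close> \<open>x \<in> carrier M\<close> by simp
    qed
    moreover have "A +>\<^bsub>M\<^esub> x \<noteq> {}" using A.a_rcos_self[OF that(2)] by blast
    ultimately show ?thesis by simp
  qed
  show lin: "(\<lambda>x. A +>\<^bsub>M\<^esub> x) \<in> lin_hom R M (quotient_module M A)"
    by (rule lin_homI) (simp_all add: quotient_module_def A.a_rcos_sum sm M.M.a_rcosetsI A.a_subset)
  show im: "(\<lambda>x. A +>\<^bsub>M\<^esub> x) ` carrier M = carrier (quotient_module M A)"
    by (auto simp: quotient_module_def A_RCOSETS_def')
  show "left_module R (quotient_module M A)"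
    using left_module_surj_image[OF M lin im] A.a_subset by (simp add: quotient_module_def)
  show "x \<in> carrier M \<Longrightarrow> A +>\<^bsub>M\<^esub> x = \<zero>\<^bsub>quotient_module M A\<^esub> \<longleftrightarrow> x \<in> A"
    using M.M.a_coset_join1[OF _ _ sub] M.M.a_coset_join2[OF _ sub] by (auto simp: quotient_module_def)
qed

text \<open>Such an object is isomorphic to the identity of \<open>P\<close>, so a lift has to be
  found only at the source; the one at the target is the source lift carried along \<open>s\<close>
  and \<open>arr Y\<close>.\<close>

lemma mor_projective_iso:
  assumes P: "projective_module R P" and Q: "fg_module R Q" and f: "f \<in> lin_hom R P Q"
    and s: "s \<in> lin_hom R Q P"
    and fs: "\<And>q. q \<in> carrier Q \<Longrightarrow> f (s q) = q" and sf: "\<And>p. p \<in> carrier P \<Longrightarrow> s (f p) = p"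
  shows "mor_projective R \<lparr>src = P, tgt = Q, arr = f\<rparr>"
  unfolding mor_projective_def
proof (intro conjI allI impI)
  show "mor_obj R \<lparr>src = P, tgt = Q, arr = f\<rparr>"
    using projective_moduleD(1)[OF P] Q f by (simp add: mor_obj_def)
  fix Y Z :: "('a, 'a univ, 'a univ) mor" and g1 g2 h1 h2
  assume a: "mor_obj R Y \<and> mor_obj R Z \<and> (g1, g2) \<in> mor_hom R Y Z \<and>
        g1 ` carrier (src Y) = carrier (src Z) \<and> g2 ` carrier (tgt Y) = carrier (tgt Z) \<and>
        (h1, h2) \<in> mor_hom R \<lparr>src = P, tgt = Q, arr = f\<rparr> Z"
  then have lm: "left_module R (src Y)" "left_module R (src Z)" and
    g: "g1 \<in> lin_hom R (src Y) (src Z)" "\<And>x. x \<in> carrier (src Y) \<Longrightarrow> arr Z (g1 x) = g2 (arr Y x)" and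
    h: "h1 \<in> lin_hom R P (src Z)" "h2 \<in> lin_hom R Q (tgt Z)"
      "\<And>x. x \<in> carrier P \<Longrightarrow> arr Z (h1 x) = h2 (f x)" and
    Y: "arr Y \<in> lin_hom R (src Y) (tgt Y)"
    by (auto simp: mor_obj_def fg_module_def mor_hom_def)
  have "h1 ` carrier P \<subseteq> g1 ` carrier (src Y)" using a lin_homD(1)[OF h(1)] by auto
  then obtain l where l: "l \<in> lin_hom R P (src Y)" "\<And>p. p \<in> carrier P \<Longrightarrow> g1 (l p) = h1 p"
    using projective_lift[OF P lm g(1) h(1)] by metis
  have l2: "(\<lambda>q. arr Y (l (s q))) \<in> lin_hom R Q (tgt Y)"
    by (rule lin_hom_comp[OF lin_hom_comp[OF s l(1)] Y])
  have "g2 (arr Y (l (s q))) = h2 q" if "q \<in> carrier Q" for q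
    using that g(2)[of "l (s q)"] l(2)[of "s q"] h(3)[of "s q"] fs lin_homD(1)[OF s that]
      lin_homD(1)[OF l(1)] by metis
  then show "\<exists>(l1, l2)\<in>mor_hom R \<lparr>src = P, tgt = Q, arr = f\<rparr> Y.
      (\<forall>x\<in>carrier (src \<lparr>src = P, tgt = Q, arr = f\<rparr>). g1 (l1 x) = h1 x) \<and>
      (\<forall>x\<in>carrier (tgt \<lparr>src = P, tgt = Q, arr = f\<rparr>). g2 (l2 x) = h2 x)"
    using l l2 sf by (intro bexI[of _ "(l, \<lambda>q. arr Y (l (s q)))"]) (auto simp: mor_hom_def)
qed

section \<open>Consequences of indecomposability for a map of projective modules\<close>

context
  fixes k :: "('c, 'k) ring_scheme" and \<phi> :: "'c \<Rightarrow> 'a" and R :: "('a, 'r) ring_scheme"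
    and P :: "('a, 'p) module" and Q :: "('a, 'q) module" and f :: "'p \<Rightarrow> 'q"
  assumes alg: "artin_algebra k \<phi> R"
    and P: "projective_module R P" and Q: "projective_module R Q" and f: "f \<in> lin_hom R P Q"
    and ind: "mor_indecomposable R \<lparr>src = P, tgt = Q, arr = f\<rparr>"
begin

text \<open>An idempotent \<open>e\<close> of \<open>Q\<close> with values in the image of
  \<open>f\<close> and complement in \<open>N\<close> extends to an idempotent endomorphism of the
  whole object. If that is zero, \<open>N\<close> is everything; if it is the identity,
  \<open>f\<close> is invertible and the object is projective.\<close>

lemma indecomposable_image_small:
  assumes "\<not> mor_projective R \<lparr>src = P, tgt = Q, arr = f\<rparr>"
    and N: "submodule N R Q" and sum: "\<And>q. q \<in> carrier Q \<Longrightarrow> \<exists>p\<in>carrier P. \<exists>n\<in>N. q = f p \<oplus>\<^bsub>Q\<^esub> n"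
  shows "N = carrier Q"
proof -
  note P' = projective_moduleD[OF P] and Q' = projective_moduleD[OF Q]
  interpret P: left_module R P by (rule P'(2))
  interpret Q: left_module R Q by (rule Q'(2))
  note art = artin_algebra_artinian_module[OF alg Q'(1)] and f' = lin_homD[OF f]
  have im: "submodule (f ` carrier P) R Q"
    by (rule lin_hom_image_submodule[OF P'(2) Q'(2) f P.carrier_is_submodule])
  have "\<exists>y\<in>f ` carrier P. \<exists>n\<in>N. q = y \<oplus>\<^bsub>Q\<^esub> n" if "q \<in> carrier Q" for q
    using sum[OF that] by blast
  then have "\<exists>e\<in>lin_hom R Q Q. \<forall>q\<in>carrier Q. e (e q) = e q \<and> e q \<in> f ` carrier P \<and> q \<ominus>\<^bsub>Q\<^esub> e q \<in> N"
    by (rule projective_sum_idempotent[OF Q art im N])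
  then obtain e where "e \<in> lin_hom R Q Q"
    "\<forall>q\<in>carrier Q. e (e q) = e q \<and> e q \<in> f ` carrier P \<and> q \<ominus>\<^bsub>Q\<^esub> e q \<in> N" ..
  then have e: "e \<in> lin_hom R Q Q" "\<And>q. q \<in> carrier Q \<Longrightarrow> e (e q) = e q"
    "\<And>q. q \<in> carrier Q \<Longrightarrow> e q \<in> f ` carrier P" "\<And>q. q \<in> carrier Q \<Longrightarrow> q \<ominus>\<^bsub>Q\<^esub> e q \<in> N"
    by simp_all
  note e' = lin_homD[OF e(1)]
  have "e ` carrier Q \<subseteq> f ` carrier P" using e(3) by blast
  then obtain s where s: "s \<in> lin_hom R Q P" "\<And>q. q \<in> carrier Q \<Longrightarrow> f (s q) = e q"
    using projective_lift[OF Q P'(2) Q'(2) f e(1)] by metis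
  note s' = lin_homD[OF s(1)]
  \<comment> \<open>The factor \<open>e\<close> in the middle makes the source component idempotent:
    \<open>f\<close> after \<open>s\<close> is \<open>e\<close>, so composing the map with itself
    leaves only a power of \<open>e\<close> between \<open>f\<close> and \<open>s\<close>.\<close>
  have se: "(\<lambda>x. s (e (f x))) \<in> lin_hom R P P"
    by (rule lin_hom_comp[OF lin_hom_comp[OF f e(1)] s(1)])
  have "(\<forall>x\<in>carrier P. s (e (f x)) = \<zero>\<^bsub>P\<^esub>) \<and> (\<forall>x\<in>carrier Q. e x = \<zero>\<^bsub>Q\<^esub>) \<or>
    (\<forall>x\<in>carrier P. s (e (f x)) = x) \<and> (\<forall>x\<in>carrier Q. e x = x)"
    using mor_indecomposable_idempotent[OF ind, of "\<lambda>x. s (e (f x))" e] se e(1,2) f'(1) s'(1) s(2) e'(1)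
    by (simp add: mor_hom_def)
  then show ?thesis
  proof
    assume "(\<forall>x\<in>carrier P. s (e (f x)) = \<zero>\<^bsub>P\<^esub>) \<and> (\<forall>x\<in>carrier Q. e x = \<zero>\<^bsub>Q\<^esub>)"
    then have "q \<in> N" if "q \<in> carrier Q" for q
      using that e(4)[OF that] Q.M.diff_cancel(5) by simp
    then show ?thesis using submoduleD(1)[OF N] by blast
  next
    assume "(\<forall>x\<in>carrier P. s (e (f x)) = x) \<and> (\<forall>x\<in>carrier Q. e x = x)"
    then have "mor_projective R \<lparr>src = P, tgt = Q, arr = f\<rparr>"
      using s f'(1) by (intro mor_projective_iso[OF P Q'(1) f s(1)]) auto
    with assms(1) show ?thesis by blast
  qed
qed

text \<open>The idempotent is zero on \<open>Q\<close> and maps \<open>P\<close> into the kernel of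
  \<open>f\<close>, so both composites with \<open>f\<close> vanish and it is an endomorphism. It
  cannot be the identity, since \<open>Q\<close> is not zero; hence it vanishes and \<open>N\<close>
  is everything.\<close>

lemma indecomposable_kernel_small:
  assumes nz: "carrier Q \<noteq> {\<zero>\<^bsub>Q\<^esub>}"
    and N: "submodule N R P" and im: "f ` N = f ` carrier P"
  shows "N = carrier P"
proof -
  note P' = projective_moduleD[OF P] and Q' = projective_moduleD[OF Q]
  interpret P: left_module R P by (rule P'(2))
  interpret Q: left_module R Q by (rule Q'(2))
  note art = artin_algebra_artinian_module[OF alg P'(1)] and f' = lin_homD[OF f]
  let ?K = "{x \<in> carrier P. f x = \<zero>\<^bsub>Q\<^esub>}"
  have K: "submodule ?K R P" by (rule lin_hom_kernel_submodule[OF P'(2) Q'(2) f])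
  have "\<exists>x\<in>?K. \<exists>n\<in>N. p = x \<oplus>\<^bsub>P\<^esub> n" if p: "p \<in> carrier P" for p
  proof -
    have "f p \<in> f ` N" using im p by simp
    then obtain n where n: "n \<in> N" "f n = f p" by auto
    then have nc: "n \<in> carrier P" using submoduleD(1)[OF N] by blast
    have "f (p \<ominus>\<^bsub>P\<^esub> n) = \<zero>\<^bsub>Q\<^esub>"
      using lin_hom_diff[OF P'(2) Q'(2) f p nc] n(2) f'(1)[OF p] Q.M.diff_cancel(4) by simp
    then have "p \<ominus>\<^bsub>P\<^esub> n \<in> ?K" using p nc by simp
    moreover have "p = (p \<ominus>\<^bsub>P\<^esub> n) \<oplus>\<^bsub>P\<^esub> n" using P.M.diff_cancel(1)[OF p nc] by simp
    ultimately show ?thesis using n(1) by (intro bexI[of _ "p \<ominus>\<^bsub>P\<^esub> n"] bexI[of _ n])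
  qed
  then have "\<exists>e\<in>lin_hom R P P. \<forall>p\<in>carrier P. e (e p) = e p \<and> e p \<in> ?K \<and> p \<ominus>\<^bsub>P\<^esub> e p \<in> N"
    by (rule projective_sum_idempotent[OF P art K N])
  then obtain e where "e \<in> lin_hom R P P"
    "\<forall>p\<in>carrier P. e (e p) = e p \<and> e p \<in> ?K \<and> p \<ominus>\<^bsub>P\<^esub> e p \<in> N" ..
  then have e: "e \<in> lin_hom R P P" "\<And>p. p \<in> carrier P \<Longrightarrow> e (e p) = e p"
    "\<And>p. p \<in> carrier P \<Longrightarrow> e p \<in> ?K" "\<And>p. p \<in> carrier P \<Longrightarrow> p \<ominus>\<^bsub>P\<^esub> e p \<in> N"
    by simp_all
  have z: "(\<lambda>_. \<zero>\<^bsub>Q\<^esub>) \<in> lin_hom R Q Q" by (rule lin_homI) (simp_all add: Q.smult_r_null)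
  have "(\<forall>x\<in>carrier P. e x = \<zero>\<^bsub>P\<^esub>) \<and> (\<forall>x\<in>carrier Q. \<zero>\<^bsub>Q\<^esub> = \<zero>\<^bsub>Q\<^esub>) \<or>
    (\<forall>x\<in>carrier P. e x = x) \<and> (\<forall>x\<in>carrier Q. \<zero>\<^bsub>Q\<^esub> = x)"
    using mor_indecomposable_idempotent[OF ind, of e "\<lambda>_. \<zero>\<^bsub>Q\<^esub>"] e(1,2,3) z
    by (simp add: mor_hom_def)
  moreover have "carrier Q = {\<zero>\<^bsub>Q\<^esub>}" if "\<forall>x\<in>carrier Q. \<zero>\<^bsub>Q\<^esub> = x"
    using that Q.M.zero_closed by auto
  ultimately have "\<forall>x\<in>carrier P. e x = \<zero>\<^bsub>P\<^esub>" using nz by argo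
  then have "p \<in> N" if "p \<in> carrier P" for p
    using that e(4)[OF that] P.M.diff_cancel(5) by simp
  then show ?thesis using submoduleD(1)[OF N] by blast
qed

text \<open>The kernel of the projection onto the cokernel is the image of \<open>f\<close>, so the
  two covers use one smallness lemma each: that on the image for \<open>Q\<close>, that on the
  kernel for \<open>P\<close>.\<close>

lemma minimal_presentation_cokernel:
  assumes np: "\<not> mor_projective R \<lparr>src = P, tgt = Q, arr = f\<rparr>"
    and nz: "carrier Q \<noteq> {\<zero>\<^bsub>Q\<^esub>}"
  shows "minimal_presentation R P f Q (\<lambda>q. f ` carrier P +>\<^bsub>Q\<^esub> q) (cokernel P Q f)"
    and "left_module R (cokernel P Q f)"
proof -
  note P' = projective_moduleD[OF P] and Q' = projective_moduleD[OF Q]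
  interpret P: left_module R P by (rule P'(2))
  interpret Q: left_module R Q by (rule Q'(2))
  note f' = lin_homD[OF f]
  let ?I = "f ` carrier P"
  have im: "submodule ?I R Q"
    by (rule lin_hom_image_submodule[OF P'(2) Q'(2) f P.carrier_is_submodule])
  note q = quotient_projection[OF Q'(2) im, folded cokernel_def]
  let ?p = "\<lambda>q. ?I +>\<^bsub>Q\<^esub> q"
  show C: "left_module R (cokernel P Q f)" by (rule q(3))
  have ker: "a_kernel Q (cokernel P Q f) ?p = ?I"
    unfolding a_kernel_eq using q(4) submoduleD(1)[OF im] by blast
  have "N = carrier Q" if N: "submodule N R Q" "?p ` N = carrier (cokernel P Q f)" for N
  proof (rule indecomposable_image_small[OF np N(1)])
    fix y assume y: "y \<in> carrier Q"
    then have "?p y \<in> ?p ` N" using q(2) N(2) by blast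
    then obtain n where n: "n \<in> N" "?p n = ?p y" by auto
    then have nc: "n \<in> carrier Q" using submoduleD(1)[OF N(1)] by blast
    have "?p (y \<ominus>\<^bsub>Q\<^esub> n) = \<zero>\<^bsub>cokernel P Q f\<^esub>"
      using lin_hom_diff[OF Q'(2) C q(1) y nc] n(2) lin_homD(1)[OF q(1) y]
        abelian_group.diff_cancel(4)[of "cokernel P Q f"] C by (simp add: left_module_def)
    then have "y \<ominus>\<^bsub>Q\<^esub> n \<in> ?I" using q(4)[of "y \<ominus>\<^bsub>Q\<^esub> n"] y nc by simp
    then obtain p where p: "p \<in> carrier P" "y \<ominus>\<^bsub>Q\<^esub> n = f p" by auto
    then have "y = f p \<oplus>\<^bsub>Q\<^esub> n" using Q.M.diff_cancel(1)[OF y nc] by simp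
    then show "\<exists>p\<in>carrier P. \<exists>n\<in>N. y = f p \<oplus>\<^bsub>Q\<^esub> n"
      using n(1) p(1) by (intro bexI[of _ p] bexI[of _ n])
  qed
  then have "projective_cover R Q ?p (cokernel P Q f)"
    unfolding projective_cover_iff[OF C] using Q q(1,2) by blast
  moreover have "projective_cover R P f (Q\<lparr>carrier := ?I\<rparr>)"
    unfolding projective_cover_iff[OF left_module_of_submodule[OF Q'(2) im]]
    using P f' indecomposable_kernel_small[OF nz] by (auto simp: lin_hom_def)
  ultimately show "minimal_presentation R P f Q ?p (cokernel P Q f)"
    unfolding minimal_presentation_def ker by blast
qed

end

section \<open>The dual of the transpose as a kernel\<close>

text \<open>Right modules enter as left modules over this ring, which makes the lemmas on left
  modules available for \<open>ring_dual\<close> and \<open>transpose\<close>.\<close>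

definition opp_ring :: "('a, 'r) ring_scheme \<Rightarrow> ('a, 'r) ring_scheme" where
  "opp_ring R = R\<lparr>mult := \<lambda>x y. y \<otimes>\<^bsub>R\<^esub> x\<rparr>"

lemma ring_opp_ring:
  assumes "ring R"
  shows "ring (opp_ring R)"
proof -
  interpret ring R by fact
  show ?thesis
  proof (intro ringI abelian_groupI monoidI)
    fix x assume "x \<in> carrier (opp_ring R)"
    then show "\<exists>y\<in>carrier (opp_ring R). y \<oplus>\<^bsub>opp_ring R\<^esub> x = \<zero>\<^bsub>opp_ring R\<^esub>"
      by (intro bexI[of _ "\<ominus>\<^bsub>R\<^esub> x"]) (auto simp: opp_ring_def l_neg)
  qed (auto simp: opp_ring_def l_distr r_distr m_assoc a_ac)
qed

text \<open>Linearity never multiplies two scalars, so homomorphisms of right modules can be written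
  with \<open>R\<close> itself.\<close>

lemma lin_hom_opp_ring: "lin_hom (opp_ring R) = lin_hom R"
  by (simp add: lin_hom_def opp_ring_def fun_eq_iff)

lemma left_module_ring_dual:
  assumes "left_module R P"
  shows "left_module (opp_ring R) (ring_dual R P)"
proof -
  interpret P: left_module R P by fact
  note simps = ring_dual_def opp_ring_def lin_hom_def regular_module_def
  show ?thesis
  proof (intro left_module.intro left_module_axioms.intro abelian_groupI ring_opp_ring P.R.ring_axioms)
    fix g assume "g \<in> carrier (ring_dual R P)"
    then show "\<exists>h\<in>carrier (ring_dual R P). h \<oplus>\<^bsub>ring_dual R P\<^esub> g = \<zero>\<^bsub>ring_dual R P\<^esub>"
      by (intro bexI[of _ "\<lambda>x\<in>carrier P. \<ominus>\<^bsub>R\<^esub> g x"])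
        (auto simp: simps P.R.l_neg P.R.minus_add P.R.r_minus Pi_iff intro!: restrict_ext)
  next
    fix g assume g: "g \<in> carrier (ring_dual R P)"
    show "\<zero>\<^bsub>ring_dual R P\<^esub> \<oplus>\<^bsub>ring_dual R P\<^esub> g = g" "\<one>\<^bsub>opp_ring R\<^esub> \<odot>\<^bsub>ring_dual R P\<^esub> g = g"
      using g by (auto simp: simps Pi_iff extensional_def fun_eq_iff)
  qed (auto simp: simps Pi_iff P.R.a_ac P.R.m_assoc P.R.l_distr P.R.r_distr intro!: restrict_ext)
qed

lemma ring_dual_hom:
  assumes "left_module R P1" "d \<in> lin_hom R P1 P0"
  shows "(\<lambda>g. \<lambda>x\<in>carrier P1. g (d x)) \<in> lin_hom R (ring_dual R P0) (ring_dual R P1)"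
proof -
  interpret P1: left_module R P1 by fact
  show ?thesis
    using lin_homD[OF assms(2)]
    by (intro lin_homI) (auto simp: ring_dual_def lin_hom_def Pi_iff intro!: restrict_ext)
qed

lemma left_module_scalars_opp:
  assumes "artin_algebra k \<phi> R" "left_module (opp_ring R) N"
  shows "left_module k (restrict_scalars \<phi> N)"
proof (rule left_module_restrict_scalars[OF _ _ assms(2)])
  note A = artin_algebraD[OF assms(1)]
  show "ring k" by (rule A(2))
  show "\<phi> \<in> ring_hom k (opp_ring R)"
    using A(5,8) by (auto simp: ring_hom_def opp_ring_def)
qed

section \<open>The duality on right modules, and the kernel that it attaches to a projective
  presentation\<close>

lemma dualityD:
  assumes "\<gamma> \<in> carrier (duality k \<phi> J N)"
  shows "x \<in> carrier N \<Longrightarrow> \<gamma> x \<in> carrier J"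
    "\<lbrakk>x \<in> carrier N; y \<in> carrier N\<rbrakk> \<Longrightarrow> \<gamma> (x \<oplus>\<^bsub>N\<^esub> y) = \<gamma> x \<oplus>\<^bsub>J\<^esub> \<gamma> y"
    "\<lbrakk>c \<in> carrier k; x \<in> carrier N\<rbrakk> \<Longrightarrow> \<gamma> (\<phi> c \<odot>\<^bsub>N\<^esub> x) = c \<odot>\<^bsub>J\<^esub> \<gamma> x"
    "\<gamma> \<in> extensional (carrier N)"
    "\<gamma> \<in> lin_hom k (restrict_scalars \<phi> N) J"
  using assms by (auto simp: duality_def lin_hom_def restrict_scalars_def)

lemma dualityI:
  assumes "\<And>x. x \<in> carrier N \<Longrightarrow> \<gamma> x \<in> carrier J"
    "\<And>x y. \<lbrakk>x \<in> carrier N; y \<in> carrier N\<rbrakk> \<Longrightarrow> \<gamma> (x \<oplus>\<^bsub>N\<^esub> y) = \<gamma> x \<oplus>\<^bsub>J\<^esub> \<gamma> y"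
    "\<And>c x. \<lbrakk>c \<in> carrier k; x \<in> carrier N\<rbrakk> \<Longrightarrow> \<gamma> (\<phi> c \<odot>\<^bsub>N\<^esub> x) = c \<odot>\<^bsub>J\<^esub> \<gamma> x"
    "\<gamma> \<in> extensional (carrier N)"
  shows "\<gamma> \<in> carrier (duality k \<phi> J N)"
  using assms by (auto simp: duality_def lin_hom_def restrict_scalars_def)

lemma duality_ops:
  "\<gamma> \<oplus>\<^bsub>duality k \<phi> J N\<^esub> \<delta> = (\<lambda>x\<in>carrier N. \<gamma> x \<oplus>\<^bsub>J\<^esub> \<delta> x)"
  "a \<odot>\<^bsub>duality k \<phi> J N\<^esub> \<gamma> = (\<lambda>x\<in>carrier N. \<gamma> (a \<odot>\<^bsub>N\<^esub> x))"
  "\<zero>\<^bsub>duality k \<phi> J N\<^esub> = (\<lambda>x\<in>carrier N. \<zero>\<^bsub>J\<^esub>)"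
  by (simp_all add: duality_def)

text \<open>Centrality of the image of \<open>\<phi>\<close> keeps \<open>\<gamma>\<close> linear
  over \<open>k\<close> after multiplication by \<open>a\<close> has been inserted. Closure is what
  \<open>lin_iso_inv_into'\<close> asks for.\<close>

lemma duality_closed:
  assumes A: "artin_algebra k \<phi> R" and N: "left_module (opp_ring R) N" and J: "left_module k J"
  shows "\<lbrakk>\<gamma> \<in> carrier (duality k \<phi> J N); \<delta> \<in> carrier (duality k \<phi> J N)\<rbrakk> \<Longrightarrow>
      \<gamma> \<oplus>\<^bsub>duality k \<phi> J N\<^esub> \<delta> \<in> carrier (duality k \<phi> J N)"
    and "\<lbrakk>a \<in> carrier R; \<gamma> \<in> carrier (duality k \<phi> J N)\<rbrakk> \<Longrightarrow>
      a \<odot>\<^bsub>duality k \<phi> J N\<^esub> \<gamma> \<in> carrier (duality k \<phi> J N)"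
proof -
  note A = artin_algebraD[OF A]
  interpret N: left_module "opp_ring R" N by fact
  interpret J: left_module k J by fact
  have opp: "carrier (opp_ring R) = carrier R" "x \<otimes>\<^bsub>opp_ring R\<^esub> y = y \<otimes>\<^bsub>R\<^esub> x" for x y
    by (auto simp: opp_ring_def)
  note N = N.smult_closed[unfolded opp] N.smult_r_distr[unfolded opp] N.smult_assoc1[unfolded opp, symmetric]
  show "\<gamma> \<oplus>\<^bsub>duality k \<phi> J N\<^esub> \<delta> \<in> carrier (duality k \<phi> J N)"
    if "\<gamma> \<in> carrier (duality k \<phi> J N)" "\<delta> \<in> carrier (duality k \<phi> J N)"
    using dualityD[OF that(1)] dualityD[OF that(2)] A(7)
    by (intro dualityI) (simp_all add: duality_ops N J.smult_r_distr J.M.a_ac)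
  show "a \<odot>\<^bsub>duality k \<phi> J N\<^esub> \<gamma> \<in> carrier (duality k \<phi> J N)"
    if a: "a \<in> carrier R" and \<gamma>: "\<gamma> \<in> carrier (duality k \<phi> J N)"
  proof (rule dualityI)
    fix c x assume c: "c \<in> carrier k" and x: "x \<in> carrier N"
    have "a \<odot>\<^bsub>N\<^esub> (\<phi> c \<odot>\<^bsub>N\<^esub> x) = \<phi> c \<odot>\<^bsub>N\<^esub> (a \<odot>\<^bsub>N\<^esub> x)"
      using a c x A(7,8) by (simp add: N(3))
    then show "(a \<odot>\<^bsub>duality k \<phi> J N\<^esub> \<gamma>) (\<phi> c \<odot>\<^bsub>N\<^esub> x) = c \<odot>\<^bsub>J\<^esub> (a \<odot>\<^bsub>duality k \<phi> J N\<^esub> \<gamma>) x"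
      using dualityD[OF \<gamma>] a c x A(7) by (simp add: duality_ops N(1))
  qed (use dualityD[OF \<gamma>] a in \<open>simp_all add: duality_ops N\<close>)
qed

lemma duality_hom:
  assumes N: "left_module (opp_ring R) N" and t: "t \<in> lin_hom R N N'"
    and "\<And>c. c \<in> carrier k \<Longrightarrow> \<phi> c \<in> carrier R"
  shows "(\<lambda>\<gamma>. \<lambda>x\<in>carrier N. \<gamma> (t x)) \<in> lin_hom R (duality k \<phi> J N') (duality k \<phi> J N)"
proof -
  interpret N: left_module "opp_ring R" N by fact
  note t' = lin_homD[OF t]
  have N: "a \<odot>\<^bsub>N\<^esub> x \<in> carrier N" if "a \<in> carrier R" "x \<in> carrier N" for a x
    using N.smult_closed[of a x] that by (simp add: opp_ring_def)
  show ?thesis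
  proof (rule lin_homI)
    fix \<gamma> assume "\<gamma> \<in> carrier (duality k \<phi> J N')"
    note \<gamma> = dualityD[OF this]
    show "(\<lambda>x\<in>carrier N. \<gamma> (t x)) \<in> carrier (duality k \<phi> J N)"
      using \<gamma> t' assms(3) N by (intro dualityI) auto
    show "(\<lambda>x\<in>carrier N. (a \<odot>\<^bsub>duality k \<phi> J N'\<^esub> \<gamma>) (t x)) = a \<odot>\<^bsub>duality k \<phi> J N\<^esub> (\<lambda>x\<in>carrier N. \<gamma> (t x))"
      if "a \<in> carrier R" for a
      using that t' N by (auto simp: duality_ops intro!: restrict_ext)
  qed (auto simp: duality_ops t' intro!: restrict_ext)
qed

text \<open>With \<open>D = Hom_k(-, J)\<close>, this is the kernel of the map that the Nakayama
  functor \<open>D Hom_R(-, R)\<close> assigns to \<open>d\<close>. It is determined by the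
  presentation and involves no quotient, in contrast to the dual of a cokernel.\<close>

definition nakayama_kernel ::
    "('c, 'k) ring_scheme \<Rightarrow> ('c \<Rightarrow> 'a) \<Rightarrow> ('c, 'e) module \<Rightarrow> ('a, 'r) ring_scheme \<Rightarrow>
     ('a, 'm) module \<Rightarrow> ('m \<Rightarrow> 'n) \<Rightarrow> ('a, 'n) module \<Rightarrow> ('a, ('m \<Rightarrow> 'a) \<Rightarrow> 'e) module" where
  "nakayama_kernel k \<phi> J R P1 d P0 =
     (duality k \<phi> J (ring_dual R P1))
       \<lparr>carrier := {\<gamma> \<in> carrier (duality k \<phi> J (ring_dual R P1)).
          \<forall>g\<in>carrier (ring_dual R P0). \<gamma> (\<lambda>x\<in>carrier P1. g (d x)) = \<zero>\<^bsub>J\<^esub>}\<rparr>"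

text \<open>Turns the dual of the cokernel in \<open>transpose\<close> into a kernel. The inverse
  evaluates \<open>\<gamma>\<close> at chosen representatives of cosets, and the choice does not
  matter because \<open>\<gamma>\<close> vanishes on \<open>I\<close>.\<close>

lemma duality_quotient:
  fixes R :: "('a, 'r) ring_scheme"
  assumes A: "artin_algebra k \<phi> R" and J: "left_module k J"
    and N: "left_module (opp_ring R) N" and I: "submodule I (opp_ring R) N"
  shows "(\<lambda>G. \<lambda>x\<in>carrier N. G (I +>\<^bsub>N\<^esub> x)) \<in> lin_iso R (duality k \<phi> J (quotient_module N I))
     ((duality k \<phi> J N)\<lparr>carrier := {\<gamma> \<in> carrier (duality k \<phi> J N). \<forall>x\<in>I. \<gamma> x = \<zero>\<^bsub>J\<^esub>}\<rparr>)"
    (is "?F \<in> lin_iso R ?D ?K")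
proof -
  note A' = artin_algebraD[OF A]
  note q = quotient_projection[OF N I]
  let ?Q = "quotient_module N I" and ?\<pi> = "\<lambda>x. I +>\<^bsub>N\<^esub> x"
  interpret N: left_module "opp_ring R" N by fact
  have N_smult: "a \<odot>\<^bsub>N\<^esub> x \<in> carrier N" if "a \<in> carrier R" "x \<in> carrier N" for a x
    using N.smult_closed[of a x] that by (simp add: opp_ring_def)
  interpret J: left_module k J by fact
  have pi: "?\<pi> \<in> lin_hom R N ?Q" using q(1) by (simp add: lin_hom_opp_ring)
  note pi' = lin_homD[OF pi]
  have zero: "\<gamma> \<zero>\<^bsub>M\<^esub> = \<zero>\<^bsub>J\<^esub>"
    if "left_module (opp_ring R) M" "\<gamma> \<in> carrier (duality k \<phi> J M)" for \<gamma> and M :: "('a, 'z) module"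
    using lin_hom_zero[OF left_module_scalars_opp[OF A that(1)] J dualityD(5)[OF that(2)]]
    by (simp add: restrict_scalars_def)
  have F0: "?F \<in> lin_hom R ?D (duality k \<phi> J N)" by (rule duality_hom[OF N pi A'(7)])
  have "?F G x = \<zero>\<^bsub>J\<^esub>" if "G \<in> carrier ?D" "x \<in> I" for G x
    using zero[OF q(3) that(1)] q(4)[of x] submoduleD(1)[OF I] that(2) by auto
  then have F: "?F \<in> lin_hom R ?D ?K"
    using lin_homD[OF F0] by (auto intro!: lin_homI)
  have inj: "inj_on ?F (carrier ?D)"
  proof (rule inj_onI)
    fix G H assume GH: "G \<in> carrier ?D" "H \<in> carrier ?D" "?F G = ?F H"
    show "G = H"
    proof (rule extensionalityI[OF dualityD(4)[OF GH(1)] dualityD(4)[OF GH(2)]])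
      fix C assume "C \<in> carrier ?Q"
      then obtain x where "x \<in> carrier N" "C = ?\<pi> x" using q(2) by blast
      then show "G C = H C" using fun_cong[OF GH(3), of x] by simp
    qed
  qed
  have surj: "\<exists>G\<in>carrier ?D. \<gamma> = ?F G" if "\<gamma> \<in> carrier ?K" for \<gamma>
  proof -
    have \<gamma>: "\<gamma> \<in> carrier (duality k \<phi> J N)" "\<And>x. x \<in> I \<Longrightarrow> \<gamma> x = \<zero>\<^bsub>J\<^esub>" using that by auto
    note \<gamma>' = dualityD[OF \<gamma>(1)]
    define r where "r C = (SOME x. x \<in> carrier N \<and> C = ?\<pi> x)" for C
    have r: "r (?\<pi> x) \<in> carrier N" "?\<pi> x = ?\<pi> (r (?\<pi> x))" if "x \<in> carrier N" for x
      using someI[of "\<lambda>y. y \<in> carrier N \<and> ?\<pi> x = ?\<pi> y" x] that unfolding r_def by auto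
    define G where "G = (\<lambda>C\<in>carrier ?Q. \<gamma> (r C))"
    have G: "G (?\<pi> x) = \<gamma> x" if x: "x \<in> carrier N" for x
    proof -
      let ?y = "r (?\<pi> x)"
      interpret Q: left_module "opp_ring R" ?Q by (rule q(3))
      have "?\<pi> (?y \<ominus>\<^bsub>N\<^esub> x) = \<zero>\<^bsub>?Q\<^esub>"
        using lin_hom_diff[OF N q(3) q(1) r(1)[OF x] x] r(2)[OF x] Q.M.diff_cancel(4)[OF pi'(1)[OF x]]
        by simp
      then have i: "?y \<ominus>\<^bsub>N\<^esub> x \<in> I" using q(4)[of "?y \<ominus>\<^bsub>N\<^esub> x"] r(1)[OF x] x by simp
      have "\<gamma> ?y = \<gamma> ((?y \<ominus>\<^bsub>N\<^esub> x) \<oplus>\<^bsub>N\<^esub> x)"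
        using N.M.diff_cancel(1)[OF r(1)[OF x] x] by simp
      also have "\<dots> = \<gamma> x"
        using \<gamma>'(2)[of "?y \<ominus>\<^bsub>N\<^esub> x" x] \<gamma>(2)[OF i] r(1)[OF x] x \<gamma>'(1)[OF x] by simp
      finally show ?thesis using pi'(1)[OF x] by (simp add: G_def)
    qed
    have ex: "\<exists>x. x \<in> carrier N \<and> C = ?\<pi> x" if "C \<in> carrier ?Q" for C using q(2) that by blast
    have "G \<in> carrier ?D"
    proof (rule dualityI)
      fix C assume "C \<in> carrier ?Q"
      then obtain x where x: "x \<in> carrier N" "C = ?\<pi> x" using ex by blast
      show "G C \<in> carrier J" using x G \<gamma>'(1) by simp
      show "G (\<phi> c \<odot>\<^bsub>?Q\<^esub> C) = c \<odot>\<^bsub>J\<^esub> G C" if c: "c \<in> carrier k" for c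
        using x G \<gamma>'(3)[OF c x(1)] A'(7)[OF c] N_smult by (simp flip: pi'(3))
      fix D assume "D \<in> carrier ?Q"
      then obtain y where y: "y \<in> carrier N" "D = ?\<pi> y" using ex by blast
      show "G (C \<oplus>\<^bsub>?Q\<^esub> D) = G C \<oplus>\<^bsub>J\<^esub> G D"
        using x y G \<gamma>'(2)[OF x(1) y(1)] by (simp flip: pi'(2))
    qed (simp add: G_def)
    moreover have "\<gamma> = ?F G"
      using \<gamma>'(4) G by (auto simp: fun_eq_iff extensional_def)
    ultimately show ?thesis by blast
  qed
  have "?F ` carrier ?D = carrier ?K"
  proof
    show "?F ` carrier ?D \<subseteq> carrier ?K" using lin_homD(1)[OF F] by blast
    show "carrier ?K \<subseteq> ?F ` carrier ?D" using surj by blast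
  qed
  with F inj show ?thesis by (simp add: lin_iso_def bij_betw_def)
qed

text \<open>Two contravariant functors in a row make the construction covariant in the pair
  \<open>e1\<close>, \<open>e0\<close>. The commuting square turns the pullback along
  \<open>e1\<close> of a map factoring through \<open>d'\<close> into one factoring through
  \<open>d\<close>, which \<open>\<gamma>\<close> kills.\<close>

lemma nakayama_kernel_hom:
  assumes phi: "\<And>c. c \<in> carrier k \<Longrightarrow> \<phi> c \<in> carrier R"
    and P1: "left_module R P1" and P0: "left_module R P0" and P1': "left_module R P1'"
    and d: "d \<in> lin_hom R P1 P0" and d': "d' \<in> lin_hom R P1' P0'"
    and e1: "e1 \<in> lin_hom R P1 P1'" and e0: "e0 \<in> lin_hom R P0 P0'"
    and comm: "\<And>x. x \<in> carrier P1 \<Longrightarrow> d' (e1 x) = e0 (d x)"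
  shows "(\<lambda>\<gamma>. \<lambda>\<xi>\<in>carrier (ring_dual R P1'). \<gamma> (\<lambda>x\<in>carrier P1. \<xi> (e1 x))) \<in>
      lin_hom R (nakayama_kernel k \<phi> J R P1 d P0) (nakayama_kernel k \<phi> J R P1' d' P0')"
proof -
  note F = lin_homD[OF duality_hom[OF left_module_ring_dual[OF P1'] ring_dual_hom[OF P1 e1],
      where k = k and \<phi> = \<phi> and J = J, OF phi]]
  have "(\<lambda>\<xi>\<in>carrier (ring_dual R P1'). \<gamma> (\<lambda>x\<in>carrier P1. \<xi> (e1 x))) (\<lambda>x\<in>carrier P1'. g (d' x)) = \<zero>\<^bsub>J\<^esub>"
    if \<gamma>: "\<gamma> \<in> carrier (nakayama_kernel k \<phi> J R P1 d P0)" and g: "g \<in> carrier (ring_dual R P0')" for \<gamma> g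
  proof -
    define g1 where "g1 = (\<lambda>x\<in>carrier P1'. g (d' x))"
    define g0 where "g0 = (\<lambda>x\<in>carrier P0. g (e0 x))"
    have "g1 \<in> carrier (ring_dual R P1')" "g0 \<in> carrier (ring_dual R P0)"
      using lin_homD(1)[OF ring_dual_hom[OF P1' d'] g] lin_homD(1)[OF ring_dual_hom[OF P0 e0] g]
      by (simp_all add: g1_def g0_def)
    moreover have "(\<lambda>x\<in>carrier P1. g1 (e1 x)) = (\<lambda>x\<in>carrier P1. g0 (d x))"
      using comm lin_homD(1)[OF e1] lin_homD(1)[OF d]
      by (intro restrict_ext) (simp add: g1_def g0_def)
    ultimately show ?thesis
      unfolding g1_def[symmetric] using \<gamma> by (simp add: nakayama_kernel_def)
  qed
  then show ?thesis
    using F by (intro lin_homI) (simp_all add: nakayama_kernel_def)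
qed

lemma nakayama_kernel_lin_iso:
  fixes R :: "('a, 'r) ring_scheme"
  assumes phi: "\<And>c. c \<in> carrier k \<Longrightarrow> \<phi> c \<in> carrier R"
    and P1: "left_module R P1" and P0: "left_module R P0"
    and P1': "left_module R P1'" and P0': "left_module R P0'"
    and d: "d \<in> lin_hom R P1 P0" and d': "d' \<in> lin_hom R P1' P0'"
    and e1: "e1 \<in> lin_iso R P1 P1'" and e0: "e0 \<in> lin_iso R P0 P0'"
    and comm: "\<And>x. x \<in> carrier P1 \<Longrightarrow> d' (e1 x) = e0 (d x)"
  shows "(\<lambda>\<gamma>. \<lambda>\<xi>\<in>carrier (ring_dual R P1'). \<gamma> (\<lambda>x\<in>carrier P1. \<xi> (e1 x))) \<in>
      lin_iso R (nakayama_kernel k \<phi> J R P1 d P0) (nakayama_kernel k \<phi> J R P1' d' P0')"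
    (is "?F \<in> lin_iso R ?K ?K'")
proof -
  let ?i1 = "inv_into (carrier P1) e1" and ?i0 = "inv_into (carrier P0) e0"
  let ?G = "\<lambda>\<gamma>. \<lambda>\<xi>\<in>carrier (ring_dual R P1). \<gamma> (\<lambda>x\<in>carrier P1'. \<xi> (?i1 x))"
  note e1' = lin_isoD[OF e1] and e0' = lin_isoD[OF e0]
  have i1: "?i1 \<in> lin_hom R P1' P1" and i0: "?i0 \<in> lin_hom R P0' P0"
    using lin_isoD(1)[OF lin_iso_inv_into] P1 e1 P0 e0 by metis+
  have comm': "d (?i1 y) = ?i0 (d' y)" if "y \<in> carrier P1'" for y
    using comm[of "?i1 y"] e1'(6,7)[OF that] e0'(5) lin_homD(1)[OF d] by metis
  have F: "?F \<in> lin_hom R ?K ?K'"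
    by (rule nakayama_kernel_hom[where ?e0.0 = e0]) (fact phi P1 P0 P1' d d' e1'(1) e0'(1) comm)+
  have G: "?G \<in> lin_hom R ?K' ?K"
    by (rule nakayama_kernel_hom[where ?e0.0 = ?i0]) (fact phi P1 P0' P1' d d' i1 i0 comm')+
  have c1: "(\<lambda>x\<in>carrier P1'. \<xi> (?i1 x)) \<in> carrier (ring_dual R P1')" if "\<xi> \<in> carrier (ring_dual R P1)" for \<xi>
    using lin_homD(1)[OF ring_dual_hom[OF P1' i1] that] .
  have c2: "(\<lambda>x\<in>carrier P1. \<xi> (e1 x)) \<in> carrier (ring_dual R P1)" if "\<xi> \<in> carrier (ring_dual R P1')" for \<xi>
    using lin_homD(1)[OF ring_dual_hom[OF P1 e1'(1)] that] .
  have ext: "(\<lambda>x\<in>carrier M. \<xi> x) = \<xi>" if "\<xi> \<in> carrier (ring_dual R M)" for \<xi> and M :: "('a, 'z) module"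
    using that by (simp add: ring_dual_def extensional_restrict)
  have GF: "?G (?F \<gamma>) = \<gamma>" if "\<gamma> \<in> carrier ?K" for \<gamma>
  proof (rule extensionalityI[where A = "carrier (ring_dual R P1)"])
    show "\<gamma> \<in> extensional (carrier (ring_dual R P1))"
      using that dualityD(4) by (auto simp: nakayama_kernel_def)
    fix \<xi> assume \<xi>: "\<xi> \<in> carrier (ring_dual R P1)"
    have "(\<lambda>x\<in>carrier P1. (\<lambda>x\<in>carrier P1'. \<xi> (?i1 x)) (e1 x)) = (\<lambda>x\<in>carrier P1. \<xi> x)"
      using lin_homD(1)[OF e1'(1)] e1'(5) by (intro restrict_ext) simp
    then show "?G (?F \<gamma>) \<xi> = \<gamma> \<xi>" using \<xi> c1[OF \<xi>] ext[OF \<xi>] by simp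
  qed simp
  have FG: "?F (?G \<gamma>) = \<gamma>" if "\<gamma> \<in> carrier ?K'" for \<gamma>
  proof (rule extensionalityI[where A = "carrier (ring_dual R P1')"])
    show "\<gamma> \<in> extensional (carrier (ring_dual R P1'))"
      using that dualityD(4) by (auto simp: nakayama_kernel_def)
    fix \<xi> assume \<xi>: "\<xi> \<in> carrier (ring_dual R P1')"
    have "(\<lambda>x\<in>carrier P1'. (\<lambda>x\<in>carrier P1. \<xi> (e1 x)) (?i1 x)) = (\<lambda>x\<in>carrier P1'. \<xi> x)"
      using lin_homD(1)[OF i1] e1'(6) by (intro restrict_ext) simp
    then show "?F (?G \<gamma>) \<xi> = \<gamma> \<xi>" using \<xi> c2[OF \<xi>] ext[OF \<xi>] by simp
  qed simp
  have "bij_betw ?F (carrier ?K) (carrier ?K')"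
    by (rule bij_betw_byWitness[where f' = ?G]) (use GF FG lin_homD(1)[OF F] lin_homD(1)[OF G] in auto)
  with F show ?thesis by (simp add: lin_iso_def)
qed

text \<open>Opens the choice made in \<open>transpose\<close>. The given presentation
  \<open>m\<close> serves to show that there is something to choose; the one obtained is related to
  it only by uniqueness up to isomorphism.\<close>

lemma transpose_presentation:
  fixes R :: "('a, 'r) ring_scheme"
  assumes M: "left_module R M" and m: "minimal_presentation R P1 d P0 p M"
  obtains P1' P0' :: "('a, 'a univ) module" and d' p' where "minimal_presentation R P1' d' P0' p' M"
    "transpose R M = quotient_module (ring_dual R P1')
       ((\<lambda>g. \<lambda>x\<in>carrier P1'. g (d' x)) ` carrier (ring_dual R P0'))"
    "left_module (opp_ring R) (ring_dual R P1')"
    "submodule ((\<lambda>g. \<lambda>x\<in>carrier P1'. g (d' x)) ` carrier (ring_dual R P0'))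
       (opp_ring R) (ring_dual R P1')"
proof -
  let ?P = "\<lambda>(P1 :: ('a, 'a univ) module, d, P0 :: ('a, 'a univ) module).
    \<exists>p. minimal_presentation R P1 d P0 p M"
  define S where "S = (SOME s. ?P s)"
  obtain P1' d' P0' where S': "S = (P1', d', P0')" by (metis prod_cases3)
  have "\<exists>s. ?P s"
    using minimal_presentation_univ_copy[OF m M] by (metis (mono_tags, lifting) case_prod_conv)
  then have "?P S" unfolding S_def by (rule someI_ex)
  then obtain p' where m': "minimal_presentation R P1' d' P0' p' M" unfolding S' by auto
  let ?I = "(\<lambda>g. \<lambda>x\<in>carrier P1'. g (d' x)) ` carrier (ring_dual R P0')"
  have tr: "transpose R M = quotient_module (ring_dual R P1') ?I"
    unfolding transpose_def S_def[symmetric] S' by (simp add: cokernel_def)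
  note h' = minimal_presentation_homs[OF m' M]
  note P' = projective_moduleD(2)[OF h'(1)] projective_moduleD(2)[OF h'(2)]
  have dual: "left_module (opp_ring R) (ring_dual R P1')" "left_module (opp_ring R) (ring_dual R P0')"
    using left_module_ring_dual P' by auto
  have "submodule ?I (opp_ring R) (ring_dual R P1')"
    using lin_hom_image_submodule[OF dual(2,1) _ left_module.carrier_is_submodule[OF dual(2)]]
      ring_dual_hom[OF P'(2) h'(4)] by (simp add: lin_hom_opp_ring)
  then show ?thesis by (rule that[OF m' tr dual(1)])
qed

text \<open>This is the exact sequence \<open>0 -> tau M -> nu P1 -> nu P0\<close> for the Nakayama
  functor \<open>nu\<close>, from any minimal presentation. Uniqueness of minimal presentations
  mediates between the one chosen in \<open>transpose\<close> and the given one.\<close>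

lemma AR_translation_lin_iso:
  fixes R :: "('a, 'r) ring_scheme"
  assumes A: "artin_algebra k \<phi> R" and J: "left_module k J" and M: "left_module R M"
    and m: "minimal_presentation R P1 d P0 p M"
  shows "\<exists>F. F \<in> lin_iso R (AR_translation k \<phi> J R M) (nakayama_kernel k \<phi> J R P1 d P0)"
proof -
  obtain P1' P0' :: "('a, 'a univ) module" and d' p' where t: "minimal_presentation R P1' d' P0' p' M"
    "transpose R M = quotient_module (ring_dual R P1')
       ((\<lambda>g. \<lambda>x\<in>carrier P1'. g (d' x)) ` carrier (ring_dual R P0'))"
    "left_module (opp_ring R) (ring_dual R P1')"
    "submodule ((\<lambda>g. \<lambda>x\<in>carrier P1'. g (d' x)) ` carrier (ring_dual R P0'))
      (opp_ring R) (ring_dual R P1')"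
    using transpose_presentation[OF M m] by metis
  let ?I = "(\<lambda>g. \<lambda>x\<in>carrier P1'. g (d' x)) ` carrier (ring_dual R P0')"
  note F1 = duality_quotient[OF A J t(3,4)]
  have K: "(duality k \<phi> J (ring_dual R P1'))\<lparr>carrier := {\<gamma> \<in> carrier (duality k \<phi> J (ring_dual R P1')).
      \<forall>x\<in>?I. \<gamma> x = \<zero>\<^bsub>J\<^esub>}\<rparr> = nakayama_kernel k \<phi> J R P1' d' P0'"
    by (simp add: nakayama_kernel_def)
  note h' = minimal_presentation_homs[OF t(1) M] and h = minimal_presentation_homs[OF m M]
  note P' = projective_moduleD(2)[OF h'(1)] projective_moduleD(2)[OF h'(2)]
  note P = projective_moduleD(2)[OF h(1)] projective_moduleD(2)[OF h(2)]
  obtain e1 e0 where e: "e1 \<in> lin_iso R P1' P1" "e0 \<in> lin_iso R P0' P0"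
    "\<And>x. x \<in> carrier P1' \<Longrightarrow> d (e1 x) = e0 (d' x)"
    using minimal_presentation_unique[OF t(1) m M] by metis
  note F2 = nakayama_kernel_lin_iso[OF artin_algebraD(7)[OF A] P'(2,1) P(2,1) h'(4) h(4) e]
  show ?thesis
    unfolding AR_translation_def t(2) by (rule exI, rule lin_iso_comp[OF F1[unfolded K] F2])
qed

lemma AR_translation_closed:
  assumes A: "artin_algebra k \<phi> R" and J: "left_module k J" and M: "left_module R M"
    and m: "minimal_presentation R P1 d P0 p M"
  shows "\<lbrakk>x \<in> carrier (AR_translation k \<phi> J R M); y \<in> carrier (AR_translation k \<phi> J R M)\<rbrakk> \<Longrightarrow>
      x \<oplus>\<^bsub>AR_translation k \<phi> J R M\<^esub> y \<in> carrier (AR_translation k \<phi> J R M)"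
    and "\<lbrakk>a \<in> carrier R; x \<in> carrier (AR_translation k \<phi> J R M)\<rbrakk> \<Longrightarrow>
      a \<odot>\<^bsub>AR_translation k \<phi> J R M\<^esub> x \<in> carrier (AR_translation k \<phi> J R M)"
proof -
  have tr: "left_module (opp_ring R) (transpose R M)"
    using transpose_presentation[OF M m] quotient_projection(3) by metis
  show "\<lbrakk>x \<in> carrier (AR_translation k \<phi> J R M); y \<in> carrier (AR_translation k \<phi> J R M)\<rbrakk> \<Longrightarrow>
      x \<oplus>\<^bsub>AR_translation k \<phi> J R M\<^esub> y \<in> carrier (AR_translation k \<phi> J R M)"
    and "\<lbrakk>a \<in> carrier R; x \<in> carrier (AR_translation k \<phi> J R M)\<rbrakk> \<Longrightarrow>
      a \<odot>\<^bsub>AR_translation k \<phi> J R M\<^esub> x \<in> carrier (AR_translation k \<phi> J R M)"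
    unfolding AR_translation_def by (fact duality_closed[OF A tr J])+
qed

section \<open>Triangular matrices\<close>

lemma T2_simps [simp]:
  "(a, b, c) \<in> carrier (T2 R) \<longleftrightarrow> a \<in> carrier R \<and> b \<in> carrier R \<and> c \<in> carrier R"
  "(a, b, c) \<otimes>\<^bsub>T2 R\<^esub> (a', b', c') = (a \<otimes>\<^bsub>R\<^esub> a', a \<otimes>\<^bsub>R\<^esub> b' \<oplus>\<^bsub>R\<^esub> b \<otimes>\<^bsub>R\<^esub> c', c \<otimes>\<^bsub>R\<^esub> c')"
  "(a, b, c) \<oplus>\<^bsub>T2 R\<^esub> (a', b', c') = (a \<oplus>\<^bsub>R\<^esub> a', b \<oplus>\<^bsub>R\<^esub> b', c \<oplus>\<^bsub>R\<^esub> c')"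
  "\<one>\<^bsub>T2 R\<^esub> = (\<one>\<^bsub>R\<^esub>, \<zero>\<^bsub>R\<^esub>, \<one>\<^bsub>R\<^esub>)" "\<zero>\<^bsub>T2 R\<^esub> = (\<zero>\<^bsub>R\<^esub>, \<zero>\<^bsub>R\<^esub>, \<zero>\<^bsub>R\<^esub>)"
  by (auto simp: T2_def)

lemma T2_fst:
  "fst (s \<oplus>\<^bsub>T2 R\<^esub> t) = fst s \<oplus>\<^bsub>R\<^esub> fst t" "fst (s \<otimes>\<^bsub>T2 R\<^esub> t) = fst s \<otimes>\<^bsub>R\<^esub> fst t"
  by (simp_all add: T2_def split: prod.splits)

lemma T2_cases:
  assumes "t \<in> carrier (T2 R)"
  obtains a b c where "t = (a, b, c)" "a \<in> carrier R" "b \<in> carrier R" "c \<in> carrier R"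
  using assms by (cases t) auto

lemma ring_T2:
  assumes "ring R"
  shows "ring (T2 R)"
proof -
  interpret ring R by fact
  show ?thesis
  proof (intro ringI abelian_groupI monoidI)
    fix x assume "x \<in> carrier (T2 R)"
    then show "\<exists>y\<in>carrier (T2 R). y \<oplus>\<^bsub>T2 R\<^esub> x = \<zero>\<^bsub>T2 R\<^esub>"
      by (elim T2_cases, intro bexI[of _ "case x of (a, b, c) \<Rightarrow> (\<ominus>\<^bsub>R\<^esub> a, \<ominus>\<^bsub>R\<^esub> b, \<ominus>\<^bsub>R\<^esub> c)"])
        (auto simp: l_neg)
  qed (auto elim!: T2_cases simp: l_distr r_distr m_assoc a_ac)
qed

text \<open>Generators over \<open>k\<close> are those of \<open>R\<close>, placed in each of the
  three matrix positions.\<close>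

lemma artin_algebra_T2:
  assumes "artin_algebra k \<phi> R"
  shows "artin_algebra k (T2_scalar R \<phi>) (T2 R)"
proof -
  note A = artin_algebraD[OF assms]
  interpret R: ring R by (rule A(4))
  let ?M = "restrict_scalars \<phi> (regular_module R)"
    and ?N = "restrict_scalars (T2_scalar R \<phi>) (regular_module (T2 R))"
  have hom: "T2_scalar R \<phi> \<in> ring_hom k (T2 R)"
    using A(5,7) by (auto simp: ring_hom_def T2_scalar_def)
  have M: "left_module k ?M"
    by (rule left_module_restrict_scalars[OF A(2,5) left_module_regular[OF A(4)]])
  have N: "left_module k ?N"
    by (rule left_module_restrict_scalars[OF A(2) hom left_module_regular[OF ring_T2[OF A(4)]]])
  note defs = restrict_scalars_def regular_module_def T2_scalar_def
  have i: "(\<lambda>a. (a, \<zero>\<^bsub>R\<^esub>, \<zero>\<^bsub>R\<^esub>)) \<in> lin_hom k ?M ?N"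
    "(\<lambda>a. (\<zero>\<^bsub>R\<^esub>, a, \<zero>\<^bsub>R\<^esub>)) \<in> lin_hom k ?M ?N" "(\<lambda>a. (\<zero>\<^bsub>R\<^esub>, \<zero>\<^bsub>R\<^esub>, a)) \<in> lin_hom k ?M ?N"
    using A(7) by (auto simp: lin_hom_def defs)
  obtain S where S: "finite S" "S \<subseteq> carrier ?M" "\<And>B. submodule B k ?M \<Longrightarrow> S \<subseteq> B \<Longrightarrow> B = carrier ?M"
    using finitely_generatedE[OF A(6)] by metis
  let ?S = "(\<lambda>a. (a, \<zero>\<^bsub>R\<^esub>, \<zero>\<^bsub>R\<^esub>)) ` S \<union> (\<lambda>a. (\<zero>\<^bsub>R\<^esub>, a, \<zero>\<^bsub>R\<^esub>)) ` S \<union> (\<lambda>a. (\<zero>\<^bsub>R\<^esub>, \<zero>\<^bsub>R\<^esub>, a)) ` S"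
  have "B = carrier ?N" if B: "submodule B k ?N" "?S \<subseteq> B" for B
  proof -
    have mem: "j a \<in> B" if j: "j \<in> lin_hom k ?M ?N" "j ` S \<subseteq> B" and a: "a \<in> carrier R" for j a
    proof -
      have "{x \<in> carrier ?M. j x \<in> B} = carrier ?M"
        using j(2) S(2) by (intro S(3) lin_hom_vimage_submodule[OF M N j(1) B(1)]) auto
      then show ?thesis using a by (auto simp: defs)
    qed
    have "(a, b, c) \<in> B" if "a \<in> carrier R" "b \<in> carrier R" "c \<in> carrier R" for a b c
    proof -
      have "(a, \<zero>\<^bsub>R\<^esub>, \<zero>\<^bsub>R\<^esub>) \<in> B" "(\<zero>\<^bsub>R\<^esub>, b, \<zero>\<^bsub>R\<^esub>) \<in> B" "(\<zero>\<^bsub>R\<^esub>, \<zero>\<^bsub>R\<^esub>, c) \<in> B"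
        using mem[OF i(1)] mem[OF i(2)] mem[OF i(3)] B(2) that by auto
      then have "((a, \<zero>\<^bsub>R\<^esub>, \<zero>\<^bsub>R\<^esub>) \<oplus>\<^bsub>?N\<^esub> (\<zero>\<^bsub>R\<^esub>, b, \<zero>\<^bsub>R\<^esub>)) \<oplus>\<^bsub>?N\<^esub> (\<zero>\<^bsub>R\<^esub>, \<zero>\<^bsub>R\<^esub>, c) \<in> B"
        using submoduleD(3)[OF B(1)] by blast
      then show ?thesis using that by (simp add: defs)
    qed
    then have "carrier ?N \<subseteq> B" by (auto simp: defs T2_def)
    then show ?thesis using submoduleD(1)[OF B(1)] by blast
  qed
  moreover have "?S \<subseteq> carrier ?N" using S(2) by (auto simp: defs)
  ultimately have "finitely_generated k ?N"
    unfolding finitely_generated_def using S(1) by (intro exI[of _ ?S]) auto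
  moreover have "T2_scalar R \<phi> c \<otimes>\<^bsub>T2 R\<^esub> t = t \<otimes>\<^bsub>T2 R\<^esub> T2_scalar R \<phi> c"
    if "c \<in> carrier k" "t \<in> carrier (T2 R)" for c t
    using that A(7,8) by (auto simp: T2_scalar_def elim!: T2_cases)
  ultimately show ?thesis
    using A(1,3) ring_T2[OF A(4)] hom by (auto simp: artin_algebra_def)
qed

text \<open>Restriction along this embedding makes a \<open>T2 R\<close>-module an
  \<open>R\<close>-module: source and target of the corresponding object taken together.\<close>

definition diag :: "('a, 'r) ring_scheme \<Rightarrow> 'a \<Rightarrow> 'a \<times> 'a \<times> 'a" where
  "diag R a = (a, \<zero>\<^bsub>R\<^esub>, a)"

lemma diag_hom:
  assumes "ring R"
  shows "diag R \<in> ring_hom R (T2 R)"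
proof -
  interpret ring R by fact
  show ?thesis by (auto simp: ring_hom_def diag_def)
qed

lemma lin_hom_restrict_scalars:
  assumes "\<phi> \<in> ring_hom k R" "g \<in> lin_hom R Y Z"
  shows "g \<in> lin_hom k (restrict_scalars \<phi> Y) (restrict_scalars \<phi> Z)"
  using assms by (auto simp: lin_hom_def restrict_scalars_def ring_hom_def)

text \<open>The lift is linear over \<open>R\<close> only. Linearity over \<open>T2 R\<close> is
  restored afterwards by multiplying with matrix units.\<close>

lemma projective_lift_diag:
  assumes P: "projective_module R P" and Y: "left_module (T2 R) Y" and Z: "left_module (T2 R) Z"
    and g: "g \<in> lin_hom (T2 R) Y Z" "g ` carrier Y = carrier Z"
    and h: "h \<in> lin_hom R P (restrict_scalars (diag R) Z)"
  shows "\<exists>l\<in>lin_hom R P (restrict_scalars (diag R) Y). \<forall>p\<in>carrier P. g (l p) = h p"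
proof -
  note R = projective_moduleD(3)[OF P] and d = diag_hom[OF projective_moduleD(3)[OF P]]
  have "h ` carrier P \<subseteq> g ` carrier (restrict_scalars (diag R) Y)"
    using lin_homD(1)[OF h] g(2) by (auto simp: restrict_scalars_def)
  then show ?thesis
    using projective_lift[OF P left_module_restrict_scalars[OF R d Y]
        left_module_restrict_scalars[OF R d Z] lin_hom_restrict_scalars[OF d g(1)] h] by metis
qed

section \<open>The minimal presentation of a map of projective modules\<close>

text \<open>
  Under the equivalence of the morphism category with \<open>T2 R\<close>-modules, the following two modules are
  the objects \<open>0 \<rightarrow> P\<close> and \<open>P \<rightarrow> P \<oplus> Q\<close>, \<open>p \<mapsto> (p, 0)\<close>; the last entry of \<open>(u, q, p)\<close> is the source.
\<close>

definition zero_to :: "('a, 'p) module \<Rightarrow> ('a \<times> 'a \<times> 'a, 'p) module" where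
  "zero_to P =
     \<lparr>carrier = carrier P, mult = undefined, one = undefined, zero = \<zero>\<^bsub>P\<^esub>, add = add P,
      smult = (\<lambda>(a, b, c) p. a \<odot>\<^bsub>P\<^esub> p)\<rparr>"

definition summand_inclusion ::
    "('a, 'p) module \<Rightarrow> ('a, 'q) module \<Rightarrow> ('a \<times> 'a \<times> 'a, 'p \<times> 'q \<times> 'p) module" where
  "summand_inclusion P Q =
     \<lparr>carrier = carrier P \<times> carrier Q \<times> carrier P, mult = undefined, one = undefined,
      zero = (\<zero>\<^bsub>P\<^esub>, \<zero>\<^bsub>Q\<^esub>, \<zero>\<^bsub>P\<^esub>),
      add = (\<lambda>(u, q, p) (u', q', p'). (u \<oplus>\<^bsub>P\<^esub> u', q \<oplus>\<^bsub>Q\<^esub> q', p \<oplus>\<^bsub>P\<^esub> p')),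
      smult = (\<lambda>(a, b, c) (u, q, p). (a \<odot>\<^bsub>P\<^esub> u \<oplus>\<^bsub>P\<^esub> b \<odot>\<^bsub>P\<^esub> p, a \<odot>\<^bsub>Q\<^esub> q, c \<odot>\<^bsub>P\<^esub> p))\<rparr>"

lemma zero_to_simps [simp]:
  "carrier (zero_to P) = carrier P" "\<zero>\<^bsub>zero_to P\<^esub> = \<zero>\<^bsub>P\<^esub>" "p \<oplus>\<^bsub>zero_to P\<^esub> p' = p \<oplus>\<^bsub>P\<^esub> p'"
  "(a, b, c) \<odot>\<^bsub>zero_to P\<^esub> p = a \<odot>\<^bsub>P\<^esub> p"
  by (auto simp: zero_to_def)

lemma summand_inclusion_simps [simp]:
  "(u, q, p) \<in> carrier (summand_inclusion P Q) \<longleftrightarrow> u \<in> carrier P \<and> q \<in> carrier Q \<and> p \<in> carrier P"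
  "\<zero>\<^bsub>summand_inclusion P Q\<^esub> = (\<zero>\<^bsub>P\<^esub>, \<zero>\<^bsub>Q\<^esub>, \<zero>\<^bsub>P\<^esub>)"
  "(u, q, p) \<oplus>\<^bsub>summand_inclusion P Q\<^esub> (u', q', p') = (u \<oplus>\<^bsub>P\<^esub> u', q \<oplus>\<^bsub>Q\<^esub> q', p \<oplus>\<^bsub>P\<^esub> p')"
  "(a, b, c) \<odot>\<^bsub>summand_inclusion P Q\<^esub> (u, q, p) =
     (a \<odot>\<^bsub>P\<^esub> u \<oplus>\<^bsub>P\<^esub> b \<odot>\<^bsub>P\<^esub> p, a \<odot>\<^bsub>Q\<^esub> q, c \<odot>\<^bsub>P\<^esub> p)"
  by (auto simp: summand_inclusion_def)

lemma summand_inclusion_cases: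
  assumes "x \<in> carrier (summand_inclusion P Q)"
  obtains u q p where "x = (u, q, p)" "u \<in> carrier P" "q \<in> carrier Q" "p \<in> carrier P"
  using assms by (cases x) auto

lemma left_module_zero_to:
  assumes "left_module R P"
  shows "left_module (T2 R) (zero_to P)"
proof -
  interpret P: left_module R P by fact
  show ?thesis
  proof (intro left_module.intro left_module_axioms.intro abelian_groupI ring_T2 P.R.ring_axioms)
    fix p assume "p \<in> carrier (zero_to P)"
    then show "\<exists>y\<in>carrier (zero_to P). y \<oplus>\<^bsub>zero_to P\<^esub> p = \<zero>\<^bsub>zero_to P\<^esub>"
      by (intro bexI[of _ "\<ominus>\<^bsub>P\<^esub> p"]) (auto simp: P.M.l_neg)
  qed (auto elim!: T2_cases simp: P.M.a_ac P.smult_l_distr P.smult_r_distr P.smult_assoc1 P.smult_one)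
qed

lemma left_module_summand_inclusion:
  assumes "left_module R P" "left_module R Q"
  shows "left_module (T2 R) (summand_inclusion P Q)"
proof -
  interpret P: left_module R P by fact
  interpret Q: left_module R Q by fact
  show ?thesis
  proof (intro left_module.intro left_module_axioms.intro abelian_groupI ring_T2 P.R.ring_axioms)
    fix x assume "x \<in> carrier (summand_inclusion P Q)"
    then show "\<exists>y\<in>carrier (summand_inclusion P Q). y \<oplus>\<^bsub>summand_inclusion P Q\<^esub> x = \<zero>\<^bsub>summand_inclusion P Q\<^esub>"
      by (elim summand_inclusion_cases,
          intro bexI[of _ "case x of (u, q, p) \<Rightarrow> (\<ominus>\<^bsub>P\<^esub> u, \<ominus>\<^bsub>Q\<^esub> q, \<ominus>\<^bsub>P\<^esub> p)"])
        (auto simp: P.M.l_neg Q.M.l_neg)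
  qed (auto elim!: T2_cases summand_inclusion_cases simp: P.M.a_ac P.smult_l_distr P.smult_r_distr
      P.smult_assoc1 P.smult_one P.smult_l_null Q.M.a_ac Q.smult_l_distr Q.smult_r_distr
      Q.smult_assoc1 Q.smult_one)
qed

lemma fg_module_zero_to:
  assumes "fg_module R P"
  shows "fg_module (T2 R) (zero_to P)"
proof -
  interpret P: left_module R P using assms by (simp add: fg_module_def)
  obtain S where S: "finite S" "S \<subseteq> carrier P" "\<And>B. submodule B R P \<Longrightarrow> S \<subseteq> B \<Longrightarrow> B = carrier P"
    using finitely_generatedE[of R P] assms unfolding fg_module_def by metis
  have "submodule B R P" if B: "submodule B (T2 R) (zero_to P)" for B
    using submoduleD(1-3)[OF B] submoduleD(4)[OF B, of "(a, \<zero>\<^bsub>R\<^esub>, \<zero>\<^bsub>R\<^esub>)" for a]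
    by (intro P.submoduleI') auto
  then show ?thesis
    unfolding fg_module_def finitely_generated_def
    using left_module_zero_to[OF P.left_module_axioms] S by (intro conjI exI[of _ S]) auto
qed

lemma submodule_restrict_scalars:
  assumes "ring k" "\<phi> \<in> ring_hom k R" "left_module R M" "submodule N R M"
  shows "submodule N k (restrict_scalars \<phi> M)"
proof -
  have "\<phi> a \<in> carrier R" if "a \<in> carrier k" for a using assms(2) that by (auto simp: ring_hom_def)
  then show ?thesis
    using submoduleD[OF assms(4)]
    by (intro left_module.submoduleI'[OF left_module_restrict_scalars[OF assms(1-3)]])
      (auto simp: restrict_scalars_def)
qed

text \<open>The first entry is reached from the third by the matrix unit \<open>e12\<close>, which
  acts as the arrow of the object, so these two injections already generate everything.\<close>

lemma summand_inclusion_injections: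
  assumes "left_module R P" "left_module R Q"
  shows "(\<lambda>p. (\<zero>\<^bsub>P\<^esub>, \<zero>\<^bsub>Q\<^esub>, p)) \<in> lin_hom R P (restrict_scalars (diag R) (summand_inclusion P Q))"
    and "(\<lambda>q. (\<zero>\<^bsub>P\<^esub>, q, \<zero>\<^bsub>P\<^esub>)) \<in> lin_hom R Q (restrict_scalars (diag R) (summand_inclusion P Q))"
proof -
  interpret P: left_module R P by fact
  interpret Q: left_module R Q by fact
  show "(\<lambda>p. (\<zero>\<^bsub>P\<^esub>, \<zero>\<^bsub>Q\<^esub>, p)) \<in> lin_hom R P (restrict_scalars (diag R) (summand_inclusion P Q))"
    "(\<lambda>q. (\<zero>\<^bsub>P\<^esub>, q, \<zero>\<^bsub>P\<^esub>)) \<in> lin_hom R Q (restrict_scalars (diag R) (summand_inclusion P Q))"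
    by (rule lin_homI; simp add: restrict_scalars_def diag_def P.smult_l_null P.smult_r_null Q.smult_r_null)+
qed

lemma summand_inclusion_vimage:
  assumes P: "left_module R P" and Q: "left_module R Q" and B: "submodule B (T2 R) (summand_inclusion P Q)"
  shows "submodule {p \<in> carrier P. (\<zero>\<^bsub>P\<^esub>, \<zero>\<^bsub>Q\<^esub>, p) \<in> B} R P"
    and "submodule {q \<in> carrier Q. (\<zero>\<^bsub>P\<^esub>, q, \<zero>\<^bsub>P\<^esub>) \<in> B} R Q"
proof -
  have R: "ring R" using P by (simp add: left_module_def)
  note M = left_module_summand_inclusion[OF P Q]
  note vimage = lin_hom_vimage_submodule[OF _ left_module_restrict_scalars[OF R diag_hom[OF R] M] _
      submodule_restrict_scalars[OF R diag_hom[OF R] M B]]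
  show "submodule {p \<in> carrier P. (\<zero>\<^bsub>P\<^esub>, \<zero>\<^bsub>Q\<^esub>, p) \<in> B} R P"
    by (rule vimage[OF P summand_inclusion_injections(1)[OF P Q]])
  show "submodule {q \<in> carrier Q. (\<zero>\<^bsub>P\<^esub>, q, \<zero>\<^bsub>P\<^esub>) \<in> B} R Q"
    by (rule vimage[OF Q summand_inclusion_injections(2)[OF P Q]])
qed

lemma fg_module_summand_inclusion:
  assumes "fg_module R P" "fg_module R Q"
  shows "fg_module (T2 R) (summand_inclusion P Q)"
proof -
  let ?o = "\<zero>\<^bsub>R\<^esub>" and ?i = "\<one>\<^bsub>R\<^esub>" and ?oP = "\<zero>\<^bsub>P\<^esub>" and ?oQ = "\<zero>\<^bsub>Q\<^esub>"
  interpret P: left_module R P using assms by (simp add: fg_module_def)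
  interpret Q: left_module R Q using assms by (simp add: fg_module_def)
  obtain S where S: "finite S" "S \<subseteq> carrier P" "\<And>B. submodule B R P \<Longrightarrow> S \<subseteq> B \<Longrightarrow> B = carrier P"
    using finitely_generatedE[of R P] assms unfolding fg_module_def by metis
  obtain S' where S': "finite S'" "S' \<subseteq> carrier Q" "\<And>B. submodule B R Q \<Longrightarrow> S' \<subseteq> B \<Longrightarrow> B = carrier Q"
    using finitely_generatedE[of R Q] assms unfolding fg_module_def by metis
  let ?M = "summand_inclusion P Q"
  let ?S = "(\<lambda>p. (?oP, ?oQ, p)) ` S \<union> (\<lambda>q. (?oP, q, ?oP)) ` S'"
  have "B = carrier ?M" if B: "submodule B (T2 R) ?M" "?S \<subseteq> B" for B
  proof -
    note B' = submoduleD[OF B(1)]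
    note sub = summand_inclusion_vimage[OF P.left_module_axioms Q.left_module_axioms B(1)]
    have "{p \<in> carrier P. (?oP, ?oQ, p) \<in> B} = carrier P" using B(2) S(2) by (intro S(3) sub) auto
    then have BP: "(?oP, ?oQ, p) \<in> B" if "p \<in> carrier P" for p using that by blast
    have "{q \<in> carrier Q. (?oP, q, ?oP) \<in> B} = carrier Q" using B(2) S'(2) by (intro S'(3) sub) auto
    then have BQ: "(?oP, q, ?oP) \<in> B" if "q \<in> carrier Q" for q using that by blast
    have "(u, q, p) \<in> B" if c: "u \<in> carrier P" "q \<in> carrier Q" "p \<in> carrier P" for u q p
    proof -
      have "(?o, ?i, ?o) \<odot>\<^bsub>?M\<^esub> (?oP, ?oQ, u) \<oplus>\<^bsub>?M\<^esub> (?oP, q, ?oP) \<oplus>\<^bsub>?M\<^esub> (?oP, ?oQ, p) \<in> B"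
        using c by (intro B'(3,4) BP BQ) simp_all
      then show ?thesis using c by (simp add: P.smult_l_null P.smult_one Q.smult_l_null)
    qed
    then have "carrier ?M \<subseteq> B" by (auto elim!: summand_inclusion_cases)
    then show ?thesis using B'(1) by blast
  qed
  moreover have "?S \<subseteq> carrier ?M" using S(2) S'(2) by auto
  ultimately show ?thesis
    unfolding fg_module_def finitely_generated_def
    using left_module_summand_inclusion[OF P.left_module_axioms Q.left_module_axioms] S(1) S'(1)
    by (intro conjI exI[of _ ?S]) auto
qed

text \<open>Multiplying an \<open>R\<close>-linear lift by the upper left matrix unit moves it into
  the target part of \<open>Y\<close>, where the other two entries of a matrix act by zero; this
  makes it linear over \<open>T2 R\<close>. The composite with \<open>g\<close> does not change,
  because that matrix unit fixes \<open>zero_to P\<close>.\<close>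

lemma projective_module_zero_to:
  assumes P: "projective_module R P"
  shows "projective_module (T2 R) (zero_to P)"
  unfolding projective_module_def
proof (intro conjI allI impI)
  note P' = projective_moduleD[OF P]
  show "fg_module (T2 R) (zero_to P)" by (rule fg_module_zero_to[OF P'(1)])
  interpret P: left_module R P by (rule P'(2))
  fix Y Z :: "('a \<times> 'a \<times> 'a, ('a \<times> 'a \<times> 'a) univ) module" and g h
  assume a: "fg_module (T2 R) Y \<and> fg_module (T2 R) Z \<and> g \<in> lin_hom (T2 R) Y Z \<and>
    g ` carrier Y = carrier Z \<and> h \<in> lin_hom (T2 R) (zero_to P) Z"
  then have g: "g \<in> lin_hom (T2 R) Y Z" "g ` carrier Y = carrier Z"
    and h: "h \<in> lin_hom (T2 R) (zero_to P) Z"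
    and Y: "left_module (T2 R) Y" and Z: "left_module (T2 R) Z" by (auto simp: fg_module_def)
  interpret Y: left_module "T2 R" Y by (rule Y)
  note g' = lin_homD[OF g(1)] and h' = lin_homD[OF h, simplified]
  have hP: "h \<in> lin_hom R P (restrict_scalars (diag R) Z)"
    using h'(1,2) h'(3)[of "(a, \<zero>\<^bsub>R\<^esub>, a)" for a]
    by (auto simp: lin_hom_def restrict_scalars_def diag_def)
  obtain l where l0: "l \<in> lin_hom R P (restrict_scalars (diag R) Y)"
    and l4: "\<forall>p\<in>carrier P. g (l p) = h p"
    using projective_lift_diag[OF P Y Z g hP] by (rule bexE)
  note l = lin_homD[OF l0, unfolded restrict_scalars_def diag_def, simplified] l4[rule_format]
  let ?e = "(\<one>\<^bsub>R\<^esub>, \<zero>\<^bsub>R\<^esub>, \<zero>\<^bsub>R\<^esub>)"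
  show "\<exists>l\<in>lin_hom (T2 R) (zero_to P) Y. \<forall>x\<in>carrier (zero_to P). g (l x) = h x"
  proof (intro bexI ballI)
    show "g (?e \<odot>\<^bsub>Y\<^esub> l p) = h p" if "p \<in> carrier (zero_to P)" for p
      using that l(1,4) g'(3) h'(3)[of ?e p] by (simp add: P.smult_one)
    show "(\<lambda>p. ?e \<odot>\<^bsub>Y\<^esub> l p) \<in> lin_hom (T2 R) (zero_to P) Y"
      by (rule lin_homI)
        (auto elim!: T2_cases simp: l(1-3) Y.smult_r_distr simp flip: Y.smult_assoc1)
  qed
qed

text \<open>A map from \<open>P -> P \<oplus> Q\<close> to an object amounts to a map from
  \<open>P\<close> to its source and a map from \<open>Q\<close> to its target, chosen
  independently; each of them is lifted on its own.\<close>

lemma projective_module_summand_inclusion: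
  assumes P: "projective_module R P" and Q: "projective_module R Q"
  shows "projective_module (T2 R) (summand_inclusion P Q)"
  unfolding projective_module_def
proof (intro conjI allI impI)
  let ?o = "\<zero>\<^bsub>R\<^esub>" and ?i = "\<one>\<^bsub>R\<^esub>" and ?oP = "\<zero>\<^bsub>P\<^esub>" and ?oQ = "\<zero>\<^bsub>Q\<^esub>"
  note P' = projective_moduleD[OF P] and Q' = projective_moduleD[OF Q]
  show "fg_module (T2 R) (summand_inclusion P Q)" by (rule fg_module_summand_inclusion[OF P'(1) Q'(1)])
  interpret P: left_module R P by (rule P'(2))
  interpret Q: left_module R Q by (rule Q'(2))
  let ?M = "summand_inclusion P Q"
  fix Y Z :: "('a \<times> 'a \<times> 'a, ('a \<times> 'a \<times> 'a) univ) module" and g h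
  assume a: "fg_module (T2 R) Y \<and> fg_module (T2 R) Z \<and> g \<in> lin_hom (T2 R) Y Z \<and>
    g ` carrier Y = carrier Z \<and> h \<in> lin_hom (T2 R) ?M Z"
  then have g: "g \<in> lin_hom (T2 R) Y Z" "g ` carrier Y = carrier Z" and h: "h \<in> lin_hom (T2 R) ?M Z"
    and Y: "left_module (T2 R) Y" and Z: "left_module (T2 R) Z" by (auto simp: fg_module_def)
  interpret Y: left_module "T2 R" Y by (rule Y)
  note g' = lin_homD[OF g(1)] and h' = lin_homD[OF h]
  note null = P.smult_l_null P.smult_r_null P.smult_one Q.smult_l_null Q.smult_r_null Q.smult_one
  note hd = lin_hom_restrict_scalars[OF diag_hom[OF P'(3)] h]
  have hP: "(\<lambda>p. h (?oP, ?oQ, p)) \<in> lin_hom R P (restrict_scalars (diag R) Z)"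
    and hQ: "(\<lambda>q. h (?oP, q, ?oP)) \<in> lin_hom R Q (restrict_scalars (diag R) Z)"
    using summand_inclusion_injections[OF P'(2) Q'(2), THEN lin_hom_comp, OF hd] .
  obtain l where l0: "l \<in> lin_hom R P (restrict_scalars (diag R) Y)"
    and l4: "\<forall>p\<in>carrier P. g (l p) = h (?oP, ?oQ, p)"
    using projective_lift_diag[OF P Y Z g hP] by (rule bexE)
  note l = lin_homD[OF l0, unfolded restrict_scalars_def diag_def, simplified] l4[rule_format]
  obtain m where m0: "m \<in> lin_hom R Q (restrict_scalars (diag R) Y)"
    and m4: "\<forall>p\<in>carrier Q. g (m p) = h (?oP, p, ?oP)"
    using projective_lift_diag[OF Q Y Z g hQ] by (rule bexE)
  note m = lin_homD[OF m0, unfolded restrict_scalars_def diag_def, simplified] m4[rule_format]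
  let ?e11 = "(?i, ?o, ?o)" and ?e12 = "(?o, ?i, ?o)" and ?e22 = "(?o, ?o, ?i)"
  \<comment> \<open>The value at \<open>u\<close> is forced by linearity: \<open>(u, 0, 0)\<close>
    is \<open>e12\<close> times \<open>(0, 0, u)\<close>, so it reuses \<open>l\<close>. The units
    \<open>e11\<close> and \<open>e22\<close> project \<open>m q\<close> to the target part and
    \<open>l p\<close> to the source part.\<close>
  let ?l = "\<lambda>(u, q, p). ?e12 \<odot>\<^bsub>Y\<^esub> l u \<oplus>\<^bsub>Y\<^esub> ?e11 \<odot>\<^bsub>Y\<^esub> m q \<oplus>\<^bsub>Y\<^esub> ?e22 \<odot>\<^bsub>Y\<^esub> l p"
  show "\<exists>l\<in>lin_hom (T2 R) ?M Y. \<forall>x\<in>carrier ?M. g (l x) = h x"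
  proof (intro bexI ballI)
    fix x assume "x \<in> carrier ?M"
    then obtain u q p where x: "x = (u, q, p)" "u \<in> carrier P" "q \<in> carrier Q" "p \<in> carrier P"
      by (rule summand_inclusion_cases)
    have "g (?l x) = ?e12 \<odot>\<^bsub>Z\<^esub> h (?oP, ?oQ, u) \<oplus>\<^bsub>Z\<^esub> ?e11 \<odot>\<^bsub>Z\<^esub> h (?oP, q, ?oP)
        \<oplus>\<^bsub>Z\<^esub> ?e22 \<odot>\<^bsub>Z\<^esub> h (?oP, ?oQ, p)"
      using x l(1,4) m(1,4) by (simp add: g')
    also have "\<dots> = h (u, ?oQ, ?oP) \<oplus>\<^bsub>Z\<^esub> h (?oP, q, ?oP) \<oplus>\<^bsub>Z\<^esub> h (?oP, ?oQ, p)"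
      using h'(3)[of ?e12 "(?oP, ?oQ, u)"] h'(3)[of ?e11 "(?oP, q, ?oP)"]
        h'(3)[of ?e22 "(?oP, ?oQ, p)"] x by (simp add: null)
    also have "\<dots> = h x"
      using h'(2)[of "(u, ?oQ, ?oP)" "(?oP, q, ?oP)"] h'(2)[of "(u, q, ?oP)" "(?oP, ?oQ, p)"] x
      by simp
    finally show "g (?l x) = h x" .
  next
    show "?l \<in> lin_hom (T2 R) ?M Y"
    proof (rule lin_homI)
      fix x assume "x \<in> carrier ?M"
      then obtain u q p where x: "x = (u, q, p)" "u \<in> carrier P" "q \<in> carrier Q" "p \<in> carrier P"
        by (rule summand_inclusion_cases)
      then show "?l x \<in> carrier Y" using l(1) m(1) by simp
      show "?l (t \<odot>\<^bsub>?M\<^esub> x) = t \<odot>\<^bsub>Y\<^esub> ?l x" if t: "t \<in> carrier (T2 R)" for t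
      proof -
        obtain a b c where t: "t = (a, b, c)" "a \<in> carrier R" "b \<in> carrier R" "c \<in> carrier R"
          using t by (rule T2_cases)
        have "?l (t \<odot>\<^bsub>?M\<^esub> x) = (?o, a, ?o) \<odot>\<^bsub>Y\<^esub> l u \<oplus>\<^bsub>Y\<^esub> (?o, b, ?o) \<odot>\<^bsub>Y\<^esub> l p
            \<oplus>\<^bsub>Y\<^esub> (a, ?o, ?o) \<odot>\<^bsub>Y\<^esub> m q \<oplus>\<^bsub>Y\<^esub> (?o, ?o, c) \<odot>\<^bsub>Y\<^esub> l p"
          using x t by (simp add: l(1-3) m(1-3) Y.smult_r_distr flip: Y.smult_assoc1)
        moreover have "t \<odot>\<^bsub>Y\<^esub> ?l x = (?o, a, ?o) \<odot>\<^bsub>Y\<^esub> l u \<oplus>\<^bsub>Y\<^esub> (a, ?o, ?o) \<odot>\<^bsub>Y\<^esub> m q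
            \<oplus>\<^bsub>Y\<^esub> (?o, b, c) \<odot>\<^bsub>Y\<^esub> l p"
          using x t by (simp add: l(1-3) m(1-3) Y.smult_r_distr flip: Y.smult_assoc1)
        moreover have "(?o, b, c) \<odot>\<^bsub>Y\<^esub> l p = (?o, b, ?o) \<odot>\<^bsub>Y\<^esub> l p \<oplus>\<^bsub>Y\<^esub> (?o, ?o, c) \<odot>\<^bsub>Y\<^esub> l p"
          using Y.smult_l_distr[of "(?o, b, ?o)" "(?o, ?o, c)" "l p"] x t l(1) by simp
        ultimately show ?thesis using x t l(1) m(1) by (simp add: Y.M.a_ac del: T2_simps(2,3))
      qed
    next
      fix x y assume "x \<in> carrier ?M" "y \<in> carrier ?M"
      then show "?l (x \<oplus>\<^bsub>?M\<^esub> y) = ?l x \<oplus>\<^bsub>Y\<^esub> ?l y"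
        by (auto elim!: summand_inclusion_cases simp: l(1,2) m(1,2) Y.smult_r_distr Y.M.a_ac)
    qed
  qed
qed

lemma mor_to_T2_simps [simp]:
  "(y, x) \<in> carrier (mor_to_T2 \<lparr>src = P, tgt = Q, arr = f\<rparr>) \<longleftrightarrow> y \<in> carrier Q \<and> x \<in> carrier P"
  "\<zero>\<^bsub>mor_to_T2 \<lparr>src = P, tgt = Q, arr = f\<rparr>\<^esub> = (\<zero>\<^bsub>Q\<^esub>, \<zero>\<^bsub>P\<^esub>)"
  "(y, x) \<oplus>\<^bsub>mor_to_T2 \<lparr>src = P, tgt = Q, arr = f\<rparr>\<^esub> (y', x') = (y \<oplus>\<^bsub>Q\<^esub> y', x \<oplus>\<^bsub>P\<^esub> x')"
  "(a, b, c) \<odot>\<^bsub>mor_to_T2 \<lparr>src = P, tgt = Q, arr = f\<rparr>\<^esub> (y, x) =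
     (a \<odot>\<^bsub>Q\<^esub> y \<oplus>\<^bsub>Q\<^esub> b \<odot>\<^bsub>Q\<^esub> f x, c \<odot>\<^bsub>P\<^esub> x)"
  by (auto simp: mor_to_T2_def)

text \<open>The minus sign makes the image of this map the kernel of \<open>(u, q, p)\<close> going
  to \<open>(f u + q, p)\<close>; the zero in the last entry says that it takes values in the target
  part.\<close>

lemma graph_lin_hom:
  assumes "left_module R P" "left_module R Q" "f \<in> lin_hom R P Q"
  shows "(\<lambda>u. (u, \<ominus>\<^bsub>Q\<^esub> f u, \<zero>\<^bsub>P\<^esub>)) \<in> lin_hom (T2 R) (zero_to P) (summand_inclusion P Q)"
proof -
  interpret P: left_module R P by fact
  interpret Q: left_module R Q by fact
  show ?thesis
    using lin_homD[OF assms(3)]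
    by (intro lin_homI) (auto elim!: T2_cases simp: Q.M.minus_add P.smult_r_null Q.smult_r_minus Q.M.a_comm)
qed

lemma minimal_presentation_T2:
  assumes P: "projective_module R P" and Q: "projective_module R Q" and f: "f \<in> lin_hom R P Q"
    and small: "\<And>N. \<lbrakk>submodule N R Q; \<And>q. q \<in> carrier Q \<Longrightarrow> \<exists>p\<in>carrier P. \<exists>n\<in>N. q = f p \<oplus>\<^bsub>Q\<^esub> n\<rbrakk>
      \<Longrightarrow> N = carrier Q"
  shows "minimal_presentation (T2 R) (zero_to P) (\<lambda>u. (u, \<ominus>\<^bsub>Q\<^esub> f u, \<zero>\<^bsub>P\<^esub>)) (summand_inclusion P Q)
      (\<lambda>(u, q, p). (f u \<oplus>\<^bsub>Q\<^esub> q, p)) (mor_to_T2 \<lparr>src = P, tgt = Q, arr = f\<rparr>)"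
      (is "minimal_presentation _ _ ?d ?M ?\<pi> ?X")
    and "left_module (T2 R) (mor_to_T2 \<lparr>src = P, tgt = Q, arr = f\<rparr>)"
proof -
  let ?o = "\<zero>\<^bsub>R\<^esub>" and ?i = "\<one>\<^bsub>R\<^esub>" and ?oP = "\<zero>\<^bsub>P\<^esub>" and ?oQ = "\<zero>\<^bsub>Q\<^esub>"
  note P' = projective_moduleD[OF P] and Q' = projective_moduleD[OF Q] and f' = lin_homD[OF f]
  interpret P: left_module R P by (rule P'(2))
  interpret Q: left_module R Q by (rule Q'(2))
  have f0: "f ?oP = ?oQ" by (rule lin_hom_zero[OF P'(2) Q'(2) f])
  have M: "left_module (T2 R) ?M" by (rule left_module_summand_inclusion[OF P'(2) Q'(2)])
  have pi: "?\<pi> \<in> lin_hom (T2 R) ?M ?X"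
  proof (rule lin_homI)
    fix x assume x: "x \<in> carrier ?M"
    then show "?\<pi> x \<in> carrier ?X" by (auto elim!: summand_inclusion_cases simp: f')
    show "?\<pi> (t \<odot>\<^bsub>?M\<^esub> x) = t \<odot>\<^bsub>?X\<^esub> ?\<pi> x" if "t \<in> carrier (T2 R)" for t
      using x that by (auto elim!: T2_cases summand_inclusion_cases simp: f' Q.smult_r_distr Q.M.a_ac)
    show "?\<pi> (x \<oplus>\<^bsub>?M\<^esub> y) = ?\<pi> x \<oplus>\<^bsub>?X\<^esub> ?\<pi> y" if "y \<in> carrier ?M" for y
      using x that by (auto elim!: summand_inclusion_cases simp: f' Q.M.a_ac)
  qed
  have surj: "?\<pi> ` carrier ?M = carrier ?X"
  proof (intro equalityI subsetI)
    fix z assume "z \<in> carrier ?X"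
    then show "z \<in> ?\<pi> ` carrier ?M"
      by (cases z) (auto simp: f0 intro!: image_eqI[of _ _ "(?oP, fst z, snd z)"])
  qed (use lin_homD(1)[OF pi] in auto)
  show X: "left_module (T2 R) ?X"
    by (rule left_module_surj_image[OF M pi surj]) (simp add: f0)
  have "N = carrier ?M" if N: "submodule N (T2 R) ?M" "?\<pi> ` N = carrier ?X" for N
  proof -
    note N' = submoduleD[OF N(1)]
    have im: "\<exists>u q p'. (u, q, p') \<in> N \<and> u \<in> carrier P \<and> q \<in> carrier Q \<and> y = f u \<oplus>\<^bsub>Q\<^esub> q \<and> p = p'"
      if "y \<in> carrier Q" "p \<in> carrier P" for y p
    proof -
      have "(y, p) \<in> ?\<pi> ` N" unfolding N(2) using that by simp
      then obtain x where x: "x \<in> N" "(y, p) = ?\<pi> x" by auto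
      then have "x \<in> carrier ?M" using N'(1) by blast
      then show ?thesis using x by (auto elim!: summand_inclusion_cases)
    qed
    have N3: "(?oP, ?oQ, p) \<in> N" if p: "p \<in> carrier P" for p
    proof -
      obtain u q where x: "(u, q, p) \<in> N" "u \<in> carrier P" "q \<in> carrier Q"
        using im[OF Q.M.zero_closed p] by auto
      have "(?o, ?o, ?i) \<odot>\<^bsub>?M\<^esub> (u, q, p) \<in> N" by (rule N'(4)[OF _ x(1)]) simp
      then show ?thesis using x p by (simp add: P.smult_l_null Q.smult_l_null P.smult_one)
    qed
    have N1: "(u, ?oQ, ?oP) \<in> N" if u: "u \<in> carrier P" for u
    proof -
      have "(?o, ?i, ?o) \<odot>\<^bsub>?M\<^esub> (?oP, ?oQ, u) \<in> N" by (rule N'(4)[OF _ N3[OF u]]) simp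
      then show ?thesis using u by (simp add: P.smult_l_null Q.smult_l_null P.smult_one)
    qed
    let ?NQ = "{q \<in> carrier Q. (?oP, q, ?oP) \<in> N}"
    have "?NQ = carrier Q"
    proof (rule small)
      show "submodule ?NQ R Q" by (rule summand_inclusion_vimage(2)[OF P'(2) Q'(2) N(1)])
      fix y assume "y \<in> carrier Q"
      then obtain u q where x: "(u, q, ?oP) \<in> N" "u \<in> carrier P" "q \<in> carrier Q" "y = f u \<oplus>\<^bsub>Q\<^esub> q"
        using im[OF _ P.M.zero_closed] by blast
      have "(u, q, ?oP) \<oplus>\<^bsub>?M\<^esub> (\<ominus>\<^bsub>P\<^esub> u, ?oQ, ?oP) \<in> N" using N'(3)[OF x(1) N1] x(2) by simp
      then have "q \<in> ?NQ" using x by (simp add: P.M.r_neg)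
      with x show "\<exists>p\<in>carrier P. \<exists>n\<in>?NQ. y = f p \<oplus>\<^bsub>Q\<^esub> n" by (intro bexI[of _ u] bexI[of _ q])
    qed
    then have N2: "(?oP, q, ?oP) \<in> N" if "q \<in> carrier Q" for q using that by blast
    have "(u, q, p) \<in> N" if c: "u \<in> carrier P" "q \<in> carrier Q" "p \<in> carrier P" for u q p
    proof -
      have "(u, ?oQ, ?oP) \<oplus>\<^bsub>?M\<^esub> (?oP, q, ?oP) \<oplus>\<^bsub>?M\<^esub> (?oP, ?oQ, p) \<in> N"
        using c by (intro N'(3) N1 N2 N3)
      then show ?thesis using c by simp
    qed
    then have "carrier ?M \<subseteq> N" by (auto elim!: summand_inclusion_cases)
    then show ?thesis using N'(1) by blast
  qed
  then have c0: "projective_cover (T2 R) ?M ?\<pi> ?X"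
    unfolding projective_cover_iff[OF X]
    using projective_module_summand_inclusion[OF P Q] pi surj by blast
  have d: "?d \<in> lin_hom (T2 R) (zero_to P) ?M" by (rule graph_lin_hom[OF P'(2) Q'(2) f])
  have ker: "a_kernel ?M ?X ?\<pi> = ?d ` carrier P"
  proof (intro equalityI subsetI)
    fix x assume "x \<in> a_kernel ?M ?X ?\<pi>"
    then have x: "x \<in> carrier ?M" "?\<pi> x = \<zero>\<^bsub>?X\<^esub>" by (simp_all add: a_kernel_eq)
    then obtain u q p where u: "x = (u, q, p)" "u \<in> carrier P" "q \<in> carrier Q" "p \<in> carrier P"
      by (elim summand_inclusion_cases)
    then have "f u \<oplus>\<^bsub>Q\<^esub> q = ?oQ" "p = ?oP" using x(2) by simp_all
    then have "q = \<ominus>\<^bsub>Q\<^esub> f u" using Q.M.minus_equality[of q "f u"] u f'(1) Q.M.a_comm by simp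
    then show "x \<in> ?d ` carrier P" using u \<open>p = ?oP\<close> by blast
  next
    fix x assume "x \<in> ?d ` carrier P"
    then show "x \<in> a_kernel ?M ?X ?\<pi>" using f'(1) by (auto simp: a_kernel_eq Q.M.r_neg)
  qed
  have inj: "inj_on ?d (carrier P)" by (auto simp: inj_on_def)
  have "projective_cover (T2 R) (zero_to P) ?d (?M\<lparr>carrier := a_kernel ?M ?X ?\<pi>\<rparr>)"
    unfolding projective_cover_iff[OF left_module_kernel[OF M X pi]]
  proof (intro conjI allI impI)
    show "projective_module (T2 R) (zero_to P)" by (rule projective_module_zero_to[OF P])
    show "?d \<in> lin_hom (T2 R) (zero_to P) (?M\<lparr>carrier := a_kernel ?M ?X ?\<pi>\<rparr>)"
      using lin_homD[OF d] ker by (intro lin_homI) simp_all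
    show "?d ` carrier (zero_to P) = carrier (?M\<lparr>carrier := a_kernel ?M ?X ?\<pi>\<rparr>)" by (simp add: ker)
    fix N assume "submodule N (T2 R) (zero_to P) \<and> ?d ` N = carrier (?M\<lparr>carrier := a_kernel ?M ?X ?\<pi>\<rparr>)"
    then have N: "N \<subseteq> carrier P" "?d ` N = ?d ` carrier P"
      using submoduleD(1)[of N "T2 R" "zero_to P"] ker by simp_all
    show "N = carrier (zero_to P)" using inj_on_image_eq_iff[OF inj N(1) subset_refl] N(2) by simp
  qed
  then show "minimal_presentation (T2 R) (zero_to P) ?d ?M ?\<pi> ?X"
    using c0 by (simp add: minimal_presentation_def)
qed

section \<open>Comparing the two duals\<close>

lemma ring_dualI:
  assumes "\<And>x. x \<in> carrier P \<Longrightarrow> \<alpha> x \<in> carrier R"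
    "\<And>x y. \<lbrakk>x \<in> carrier P; y \<in> carrier P\<rbrakk> \<Longrightarrow> \<alpha> (x \<oplus>\<^bsub>P\<^esub> y) = \<alpha> x \<oplus>\<^bsub>R\<^esub> \<alpha> y"
    "\<And>a x. \<lbrakk>a \<in> carrier R; x \<in> carrier P\<rbrakk> \<Longrightarrow> \<alpha> (a \<odot>\<^bsub>P\<^esub> x) = a \<otimes>\<^bsub>R\<^esub> \<alpha> x"
    "\<alpha> \<in> extensional (carrier P)"
  shows "\<alpha> \<in> carrier (ring_dual R P)"
  using assms by (auto simp: ring_dual_def lin_hom_def regular_module_def)

lemma ring_dualD:
  assumes "\<alpha> \<in> carrier (ring_dual R P)"
  shows "x \<in> carrier P \<Longrightarrow> \<alpha> x \<in> carrier R"
    "\<lbrakk>x \<in> carrier P; y \<in> carrier P\<rbrakk> \<Longrightarrow> \<alpha> (x \<oplus>\<^bsub>P\<^esub> y) = \<alpha> x \<oplus>\<^bsub>R\<^esub> \<alpha> y"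
    "\<lbrakk>a \<in> carrier R; x \<in> carrier P\<rbrakk> \<Longrightarrow> \<alpha> (a \<odot>\<^bsub>P\<^esub> x) = a \<otimes>\<^bsub>R\<^esub> \<alpha> x"
    "\<alpha> \<in> extensional (carrier P)"
    "\<alpha> \<in> lin_hom R P (regular_module R)"
  using assms by (auto simp: ring_dual_def lin_hom_def regular_module_def)

lemma ring_dual_ops:
  "\<alpha> \<oplus>\<^bsub>ring_dual R P\<^esub> \<beta> = (\<lambda>x\<in>carrier P. \<alpha> x \<oplus>\<^bsub>R\<^esub> \<beta> x)"
  "a \<odot>\<^bsub>ring_dual R P\<^esub> \<alpha> = (\<lambda>x\<in>carrier P. \<alpha> x \<otimes>\<^bsub>R\<^esub> a)"
  by (simp_all add: ring_dual_def)

text \<open>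
  A \<open>T2 R\<close>-linear map \<open>\<xi> : zero_to P \<rightarrow> T2 R\<close> has values in matrices with vanishing second row, so it is
  a pair of elements of \<open>Hom\<^sub>R(P, R)\<close>. The maps with vanishing first entry all factor through
  \<open>summand_inclusion P Q\<close>, hence die in the transpose; therefore \<open>\<xi> \<mapsto> fst \<circ> \<xi>\<close> identifies the two
  transposes.
\<close>

definition entry11 :: "('a, 'r) ring_scheme \<Rightarrow> ('a, 'p) module \<Rightarrow> ('p \<Rightarrow> 'a) \<Rightarrow> 'p \<Rightarrow> 'a \<times> 'a \<times> 'a" where
  "entry11 R P \<alpha> = (\<lambda>p\<in>carrier P. (\<alpha> p, \<zero>\<^bsub>R\<^esub>, \<zero>\<^bsub>R\<^esub>))"

definition entry12 :: "('a, 'r) ring_scheme \<Rightarrow> ('a, 'p) module \<Rightarrow> ('p \<Rightarrow> 'a) \<Rightarrow> 'p \<Rightarrow> 'a \<times> 'a \<times> 'a" where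
  "entry12 R P \<beta> = (\<lambda>p\<in>carrier P. (\<zero>\<^bsub>R\<^esub>, \<beta> p, \<zero>\<^bsub>R\<^esub>))"

lemma entry_mem:
  assumes "left_module R P" "\<alpha> \<in> carrier (ring_dual R P)"
  shows "entry11 R P \<alpha> \<in> carrier (ring_dual (T2 R) (zero_to P))"
    and "entry12 R P \<alpha> \<in> carrier (ring_dual (T2 R) (zero_to P))"
proof -
  interpret P: left_module R P by fact
  note \<alpha> = ring_dualD[OF assms(2)]
  show "entry11 R P \<alpha> \<in> carrier (ring_dual (T2 R) (zero_to P))"
    by (rule ring_dualI) (auto elim!: T2_cases simp: entry11_def \<alpha>)
  show "entry12 R P \<alpha> \<in> carrier (ring_dual (T2 R) (zero_to P))"
    by (rule ring_dualI) (auto elim!: T2_cases simp: entry12_def \<alpha>)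
qed

lemma zero_to_dual_entries:
  assumes P: "left_module R P" and \<xi>: "\<xi> \<in> carrier (ring_dual (T2 R) (zero_to P))"
  obtains \<alpha> \<beta> where "\<alpha> \<in> carrier (ring_dual R P)" "\<beta> \<in> carrier (ring_dual R P)"
    "\<And>p. p \<in> carrier P \<Longrightarrow> \<xi> p = (\<alpha> p, \<beta> p, \<zero>\<^bsub>R\<^esub>)" "\<alpha> = (\<lambda>p\<in>carrier P. fst (\<xi> p))"
proof -
  interpret P: left_module R P by fact
  note \<xi>' = ring_dualD[OF \<xi>, simplified]
  define \<alpha> where "\<alpha> = (\<lambda>p\<in>carrier P. fst (\<xi> p))"
  define \<beta> where "\<beta> = (\<lambda>p\<in>carrier P. fst (snd (\<xi> p)))"
  have val: "\<xi> p = (\<alpha> p, \<beta> p, \<zero>\<^bsub>R\<^esub>) \<and> \<alpha> p \<in> carrier R \<and> \<beta> p \<in> carrier R" if p: "p \<in> carrier P" for p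
  proof -
    obtain a b c where abc: "\<xi> p = (a, b, c)" "a \<in> carrier R" "b \<in> carrier R" "c \<in> carrier R"
      using \<xi>'(1)[OF p] by (elim T2_cases)
    \<comment> \<open>The matrix unit \<open>e11\<close> acts as the identity on
      \<open>zero_to P\<close>, whereas on matrices it erases the second row.\<close>
    have "\<xi> p = (\<one>\<^bsub>R\<^esub>, \<zero>\<^bsub>R\<^esub>, \<zero>\<^bsub>R\<^esub>) \<otimes>\<^bsub>T2 R\<^esub> \<xi> p"
      using \<xi>'(3)[of "(\<one>\<^bsub>R\<^esub>, \<zero>\<^bsub>R\<^esub>, \<zero>\<^bsub>R\<^esub>)" p] p by (simp add: P.smult_one)
    then have "c = \<zero>\<^bsub>R\<^esub>" using abc by simp
    then show ?thesis using abc p by (simp add: \<alpha>_def \<beta>_def)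
  qed
  have add: "\<alpha> (p \<oplus>\<^bsub>P\<^esub> q) = \<alpha> p \<oplus>\<^bsub>R\<^esub> \<alpha> q" "\<beta> (p \<oplus>\<^bsub>P\<^esub> q) = \<beta> p \<oplus>\<^bsub>R\<^esub> \<beta> q"
    if "p \<in> carrier P" "q \<in> carrier P" for p q
    using \<xi>'(2)[OF that] val[of p] val[of q] val[of "p \<oplus>\<^bsub>P\<^esub> q"] that by auto
  have mul: "\<alpha> (a \<odot>\<^bsub>P\<^esub> p) = a \<otimes>\<^bsub>R\<^esub> \<alpha> p" "\<beta> (a \<odot>\<^bsub>P\<^esub> p) = a \<otimes>\<^bsub>R\<^esub> \<beta> p"
    if "a \<in> carrier R" "p \<in> carrier P" for a p
    using \<xi>'(3)[of "(a, \<zero>\<^bsub>R\<^esub>, \<zero>\<^bsub>R\<^esub>)" p] val[of p] val[of "a \<odot>\<^bsub>P\<^esub> p"] that by auto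
  have "\<alpha> \<in> carrier (ring_dual R P)" "\<beta> \<in> carrier (ring_dual R P)"
    using val add mul by (auto intro!: ring_dualI) (auto simp: \<alpha>_def \<beta>_def)
  then show ?thesis using val \<alpha>_def by (intro that[of \<alpha> \<beta>]) auto
qed

context
  fixes k :: "('c, 'k) ring_scheme" and \<phi> :: "'c \<Rightarrow> 'a" and J :: "('c, 'e) module"
    and R :: "('a, 'r) ring_scheme"
    and P :: "('a, 'p) module" and Q :: "('a, 'q) module" and f :: "'p \<Rightarrow> 'q"
  assumes alg: "artin_algebra k \<phi> R" and J: "left_module k J"
    and P: "left_module R P" and Q: "left_module R Q" and f: "f \<in> lin_hom R P Q"
begin

interpretation P: left_module R P by (rule P)
interpretation Q: left_module R Q by (rule Q)
interpretation J: left_module k J by (rule J)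

abbreviation (input) "dT \<equiv> \<lambda>u. (u, \<ominus>\<^bsub>Q\<^esub> f u, \<zero>\<^bsub>P\<^esub>)"
abbreviation (input) "KT \<equiv> nakayama_kernel k (T2_scalar R \<phi>) J (T2 R) (zero_to P) dT (summand_inclusion P Q)"
abbreviation (input) "dualP \<equiv> ring_dual R P"
abbreviation (input) "dualQ \<equiv> ring_dual R Q"
abbreviation (input) "dualT \<equiv> ring_dual (T2 R) (zero_to P)"
abbreviation (input) "dualM \<equiv> ring_dual (T2 R) (summand_inclusion P Q)"
abbreviation (input) "KR \<equiv> nakayama_kernel k \<phi> J R P f Q"

lemma nakayama_kernel_T2D:
  assumes "\<gamma> \<in> carrier KT"
  shows "\<gamma> \<in> carrier (duality k (T2_scalar R \<phi>) J dualT)"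
    and "\<eta> \<in> carrier dualM \<Longrightarrow> \<gamma> (\<lambda>x\<in>carrier P. \<eta> (dT x)) = \<zero>\<^bsub>J\<^esub>"
  using assms by (auto simp: nakayama_kernel_def)

lemma entry12_factors:
  assumes "\<beta> \<in> carrier dualP"
  shows "\<exists>\<eta>\<in>carrier dualM. entry12 R P \<beta> = (\<lambda>x\<in>carrier P. \<eta> (dT x))"
proof (intro bexI)
  \<comment> \<open>\<open>T2 R\<close>-linearity dictates the second column: \<open>e12\<close>
    sends the third entry \<open>p\<close> to the first, so \<open>\<beta> p\<close> has to sit
    below \<open>\<beta> u\<close>. On the image of the presentation map the third entry is zero,
    and only \<open>\<beta> u\<close> remains.\<close>
  let ?\<eta> = "\<lambda>x\<in>carrier (summand_inclusion P Q). case x of (u, q, p) \<Rightarrow> (\<zero>\<^bsub>R\<^esub>, \<beta> u, \<beta> p)"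
  note \<beta> = ring_dualD[OF assms]
  have "\<beta> \<zero>\<^bsub>P\<^esub> = \<zero>\<^bsub>R\<^esub>"
    using lin_hom_zero[OF P left_module_regular[OF P.R.ring_axioms] \<beta>(5)] by (simp add: regular_module_def)
  then show "entry12 R P \<beta> = (\<lambda>x\<in>carrier P. ?\<eta> (dT x))"
    using lin_homD(1)[OF f] by (auto simp: entry12_def intro!: restrict_ext)
  show "?\<eta> \<in> carrier dualM"
    by (rule ring_dualI) (auto elim!: T2_cases summand_inclusion_cases simp: \<beta>)
qed

lemma entry11_factors:
  assumes "g \<in> carrier dualQ"
  shows "\<exists>\<eta>\<in>carrier dualM.
    entry11 R P (\<lambda>x\<in>carrier P. g (f x)) = (\<lambda>x\<in>carrier P. \<eta> (dT x))"
proof (intro bexI)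
  \<comment> \<open>The sign undoes the one in the presentation map, whose middle entry is the
    negative of \<open>f u\<close>.\<close>
  let ?\<eta> = "\<lambda>x\<in>carrier (summand_inclusion P Q). case x of (u, q, p) \<Rightarrow> (g (\<ominus>\<^bsub>Q\<^esub> q), \<zero>\<^bsub>R\<^esub>, \<zero>\<^bsub>R\<^esub>)"
  note g = ring_dualD[OF assms]
  show "entry11 R P (\<lambda>x\<in>carrier P. g (f x)) = (\<lambda>x\<in>carrier P. ?\<eta> (dT x))"
    using lin_homD(1)[OF f] by (auto simp: entry11_def intro!: restrict_ext)
  show "?\<eta> \<in> carrier dualM"
    by (rule ring_dualI)
      (auto elim!: T2_cases summand_inclusion_cases simp: g Q.M.minus_add simp flip: Q.smult_r_minus)
qed

text \<open>The part of the presentation map coming from \<open>u\<close> contributes nothing to the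
  first matrix entry: \<open>(u, 0, 0)\<close> is \<open>e12\<close> times \<open>(0, 0, u)\<close>,
  and left multiplication by \<open>e12\<close> leaves a zero first column. What is left depends on
  \<open>f u\<close> alone.\<close>

lemma fst_factors:
  assumes "\<eta> \<in> carrier dualM"
  shows "\<exists>g\<in>carrier dualQ. (\<lambda>x\<in>carrier P. fst (\<eta> (dT x))) = (\<lambda>x\<in>carrier P. g (f x))"
proof (intro bexI)
  let ?o = "\<zero>\<^bsub>R\<^esub>" and ?i = "\<one>\<^bsub>R\<^esub>" and ?oP = "\<zero>\<^bsub>P\<^esub>" and ?oQ = "\<zero>\<^bsub>Q\<^esub>"
  note \<eta> = ring_dualD[OF assms]
  let ?g = "\<lambda>q\<in>carrier Q. fst (\<eta> (?oP, \<ominus>\<^bsub>Q\<^esub> q, ?oP))"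
  have fst_car: "fst t \<in> carrier R" if "t \<in> carrier (T2 R)" for t using that by (cases t) simp
  show "(\<lambda>x\<in>carrier P. fst (\<eta> (dT x))) = (\<lambda>x\<in>carrier P. ?g (f x))"
  proof (rule restrict_ext)
    fix x assume x: "x \<in> carrier P"
    let ?e12 = "(?o, ?i, ?o)"
    have fx: "f x \<in> carrier Q" using lin_homD(1)[OF f x] .
    have "\<eta> (dT x) = \<eta> (x, ?oQ, ?oP) \<oplus>\<^bsub>T2 R\<^esub> \<eta> (?oP, \<ominus>\<^bsub>Q\<^esub> f x, ?oP)"
      using \<eta>(2)[of "(x, ?oQ, ?oP)" "(?oP, \<ominus>\<^bsub>Q\<^esub> f x, ?oP)"] x fx by simp
    moreover have "\<eta> (x, ?oQ, ?oP) = ?e12 \<otimes>\<^bsub>T2 R\<^esub> \<eta> (?oP, ?oQ, x)"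
      using \<eta>(3)[of ?e12 "(?oP, ?oQ, x)"] x
      by (simp add: P.smult_l_null P.smult_one Q.smult_l_null)
    ultimately show "fst (\<eta> (dT x)) = ?g (f x)"
      using fst_car[OF \<eta>(1)[of "(?oP, ?oQ, x)"]] fst_car[OF \<eta>(1)[of "(?oP, \<ominus>\<^bsub>Q\<^esub> f x, ?oP)"]] x fx
      by (simp add: T2_fst)
  qed
  show "?g \<in> carrier dualQ"
  proof (rule ring_dualI)
    fix x assume x: "x \<in> carrier Q"
    show "?g x \<in> carrier R" using fst_car[OF \<eta>(1)[of "(?oP, \<ominus>\<^bsub>Q\<^esub> x, ?oP)"]] x by simp
    show "?g (x \<oplus>\<^bsub>Q\<^esub> y) = ?g x \<oplus>\<^bsub>R\<^esub> ?g y" if "y \<in> carrier Q" for y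
      using \<eta>(2)[of "(?oP, \<ominus>\<^bsub>Q\<^esub> x, ?oP)" "(?oP, \<ominus>\<^bsub>Q\<^esub> y, ?oP)"] x that
      by (simp add: Q.M.minus_add Q.M.a_comm T2_fst)
    show "?g (a \<odot>\<^bsub>Q\<^esub> x) = a \<otimes>\<^bsub>R\<^esub> ?g x" if "a \<in> carrier R" for a
      using \<eta>(3)[of "(a, ?o, a)" "(?oP, \<ominus>\<^bsub>Q\<^esub> x, ?oP)"] x that
      by (simp add: P.smult_r_null P.smult_l_null Q.smult_r_minus T2_fst)
  qed simp
qed

text \<open>\<open>\<xi>\<close> is the sum of its first-entry and second-entry parts, and the
  latter extends along the presentation map by \<open>entry12_factors\<close>, so
  \<open>\<gamma>\<close> kills it.\<close>

lemma nakayama_kernel_T2_entry11: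
  assumes \<gamma>: "\<gamma> \<in> carrier KT" and \<xi>: "\<xi> \<in> carrier dualT"
  shows "\<gamma> \<xi> = \<gamma> (entry11 R P (\<lambda>p\<in>carrier P. fst (\<xi> p)))"
proof -
  obtain \<alpha> \<beta> where \<alpha>: "\<alpha> \<in> carrier dualP" "\<alpha> = (\<lambda>p\<in>carrier P. fst (\<xi> p))"
    and \<beta>: "\<beta> \<in> carrier dualP" and eq: "\<And>p. p \<in> carrier P \<Longrightarrow> \<xi> p = (\<alpha> p, \<beta> p, \<zero>\<^bsub>R\<^esub>)"
    using zero_to_dual_entries[OF P \<xi>] by metis
  have "\<xi> = entry11 R P \<alpha> \<oplus>\<^bsub>dualT\<^esub> entry12 R P \<beta>"
    using ring_dualD(4)[OF \<xi>] eq ring_dualD(1)[OF \<alpha>(1)] ring_dualD(1)[OF \<beta>]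
    by (auto simp: fun_eq_iff ring_dual_ops entry11_def entry12_def extensional_def)
  then have "\<gamma> \<xi> = \<gamma> (entry11 R P \<alpha>) \<oplus>\<^bsub>J\<^esub> \<gamma> (entry12 R P \<beta>)"
    using dualityD(2)[OF nakayama_kernel_T2D(1)[OF \<gamma>]] entry_mem[OF P \<alpha>(1)] entry_mem[OF P \<beta>] by simp
  moreover obtain \<eta> where "\<eta> \<in> carrier dualM"
    "entry12 R P \<beta> = (\<lambda>x\<in>carrier P. \<eta> (dT x))"
    using entry12_factors[OF \<beta>] by (rule bexE)
  then have "\<gamma> (entry12 R P \<beta>) = \<zero>\<^bsub>J\<^esub>" using nakayama_kernel_T2D(2)[OF \<gamma>] by simp
  ultimately show ?thesis
    using dualityD(1)[OF nakayama_kernel_T2D(1)[OF \<gamma>] entry_mem(1)[OF P \<alpha>(1)]] \<alpha>(2) by simp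
qed

text \<open>Evaluation through \<open>entry11\<close> and evaluation through \<open>fst\<close> are
  inverse to each other up to second entries, which elements of \<open>KT\<close> ignore. The
  vanishing conditions correspond by \<open>entry11_factors\<close> in one direction and by
  \<open>fst_factors\<close> in the other.\<close>

lemma nakayama_kernel_T2_bij:
  shows "bij_betw (\<lambda>\<gamma>. \<lambda>\<alpha>\<in>carrier dualP. \<gamma> (entry11 R P \<alpha>)) (carrier KT) (carrier KR)"
    (is "bij_betw ?F _ _")
proof (rule bij_betw_byWitness[where f' =
      "\<lambda>\<gamma>. \<lambda>\<xi>\<in>carrier dualT. \<gamma> (\<lambda>p\<in>carrier P. fst (\<xi> p))"])
  let ?G = "\<lambda>\<gamma>. \<lambda>\<xi>\<in>carrier dualT. \<gamma> (\<lambda>p\<in>carrier P. fst (\<xi> p))"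
  note A = artin_algebraD[OF alg]
  have ent: "\<alpha> = (\<lambda>p\<in>carrier P. fst (entry11 R P \<alpha> p))" if "\<alpha> \<in> carrier dualP" for \<alpha>
    using ring_dualD(4)[OF that] by (auto simp: entry11_def fun_eq_iff extensional_def)
  have fstmem: "(\<lambda>p\<in>carrier P. fst (\<xi> p)) \<in> carrier dualP"
    if "\<xi> \<in> carrier dualT" for \<xi>
    using zero_to_dual_entries[OF P that] by metis
  show "\<forall>\<gamma>\<in>carrier KT. ?G (?F \<gamma>) = \<gamma>"
  proof
    fix \<gamma> assume \<gamma>: "\<gamma> \<in> carrier KT"
    show "?G (?F \<gamma>) = \<gamma>"
      by (rule extensionalityI[where A = "carrier dualT"])
        (use dualityD(4)[OF nakayama_kernel_T2D(1)[OF \<gamma>]] nakayama_kernel_T2_entry11[OF \<gamma>] fstmem in auto)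
  qed
  show "\<forall>\<gamma>\<in>carrier KR. ?F (?G \<gamma>) = \<gamma>"
  proof
    fix \<gamma> assume \<gamma>: "\<gamma> \<in> carrier KR"
    then have "\<gamma> \<in> extensional (carrier dualP)"
      using dualityD(4) by (auto simp: nakayama_kernel_def)
    then show "?F (?G \<gamma>) = \<gamma>"
      by (intro extensionalityI[where A = "carrier dualP"])
        (use entry_mem(1)[OF P] ent in auto)
  qed
  show "?F ` carrier KT \<subseteq> carrier KR"
  proof (rule image_subsetI)
    fix \<gamma> assume \<gamma>: "\<gamma> \<in> carrier KT"
    note \<gamma>' = dualityD[OF nakayama_kernel_T2D(1)[OF \<gamma>]]
    have "?F \<gamma> \<in> carrier (duality k \<phi> J dualP)"
    proof (rule dualityI)
      fix \<alpha> assume \<alpha>: "\<alpha> \<in> carrier dualP"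
      note e = entry_mem(1)[OF P \<alpha>]
      interpret D: left_module "opp_ring R" "dualP" by (rule left_module_ring_dual[OF P])
      show "?F \<gamma> \<alpha> \<in> carrier J" using \<gamma>'(1)[OF e] \<alpha> by simp
      show "?F \<gamma> (\<phi> c \<odot>\<^bsub>dualP\<^esub> \<alpha>) = c \<odot>\<^bsub>J\<^esub> ?F \<gamma> \<alpha>" if c: "c \<in> carrier k" for c
      proof -
        have "T2_scalar R \<phi> c \<odot>\<^bsub>dualT\<^esub> entry11 R P \<alpha>
            = entry11 R P (\<phi> c \<odot>\<^bsub>dualP\<^esub> \<alpha>)"
          using ring_dualD(1)[OF \<alpha>] A(7)[OF c]
          by (auto simp: ring_dual_ops entry11_def T2_scalar_def intro!: restrict_ext)
        then show ?thesis
          using \<gamma>'(3)[OF c e] \<alpha> D.smult_closed[of "\<phi> c" \<alpha>] A(7)[OF c] by (simp add: opp_ring_def)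
      qed
      fix \<beta> assume \<beta>: "\<beta> \<in> carrier dualP"
      have "entry11 R P \<alpha> \<oplus>\<^bsub>dualT\<^esub> entry11 R P \<beta>
          = entry11 R P (\<alpha> \<oplus>\<^bsub>dualP\<^esub> \<beta>)"
        by (auto simp: ring_dual_ops entry11_def intro!: restrict_ext)
      then show "?F \<gamma> (\<alpha> \<oplus>\<^bsub>dualP\<^esub> \<beta>) = ?F \<gamma> \<alpha> \<oplus>\<^bsub>J\<^esub> ?F \<gamma> \<beta>"
        using \<gamma>'(2)[OF e entry_mem(1)[OF P \<beta>]] \<alpha> \<beta> D.M.a_closed[OF \<alpha> \<beta>] by simp
    qed simp
    moreover have "?F \<gamma> (\<lambda>x\<in>carrier P. g (f x)) = \<zero>\<^bsub>J\<^esub>" if g: "g \<in> carrier dualQ" for g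
    proof -
      have "(\<lambda>x\<in>carrier P. g (f x)) \<in> carrier dualP"
        using lin_homD(1)[OF ring_dual_hom[OF P f] g] .
      moreover obtain \<eta> where "\<eta> \<in> carrier dualM"
        "entry11 R P (\<lambda>x\<in>carrier P. g (f x)) = (\<lambda>x\<in>carrier P. \<eta> (dT x))"
        using entry11_factors[OF g] by (rule bexE)
      ultimately show ?thesis using nakayama_kernel_T2D(2)[OF \<gamma>] by simp
    qed
    ultimately show "?F \<gamma> \<in> carrier KR" by (simp add: nakayama_kernel_def)
  qed
  show "?G ` carrier KR \<subseteq> carrier KT"
  proof (rule image_subsetI)
    fix \<gamma> assume \<gamma>: "\<gamma> \<in> carrier KR"
    then have D: "\<gamma> \<in> carrier (duality k \<phi> J dualP)" by (simp add: nakayama_kernel_def)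
    note \<gamma>' = dualityD[OF D]
    have "?G \<gamma> \<in> carrier (duality k (T2_scalar R \<phi>) J dualT)"
    proof (rule dualityI)
      fix \<xi> assume \<xi>: "\<xi> \<in> carrier dualT"
      note \<xi>' = ring_dualD[OF \<xi>, simplified]
      interpret D: left_module "opp_ring (T2 R)" dualT
        by (rule left_module_ring_dual[OF left_module_zero_to[OF P]])
      show "?G \<gamma> \<xi> \<in> carrier J" using \<gamma>'(1)[OF fstmem[OF \<xi>]] \<xi> by simp
      show "?G \<gamma> (T2_scalar R \<phi> c \<odot>\<^bsub>dualT\<^esub> \<xi>) = c \<odot>\<^bsub>J\<^esub> ?G \<gamma> \<xi>" if c: "c \<in> carrier k" for c
      proof -
        have "(\<lambda>p\<in>carrier P. fst ((T2_scalar R \<phi> c \<odot>\<^bsub>dualT\<^esub> \<xi>) p))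
            = \<phi> c \<odot>\<^bsub>dualP\<^esub> (\<lambda>p\<in>carrier P. fst (\<xi> p))"
          unfolding ring_dual_ops by (intro restrict_ext) (simp add: T2_fst T2_scalar_def)
        moreover have "T2_scalar R \<phi> c \<odot>\<^bsub>dualT\<^esub> \<xi> \<in> carrier dualT"
          using D.smult_closed[of "T2_scalar R \<phi> c" \<xi>] \<xi> A(7)[OF c] by (simp add: opp_ring_def T2_scalar_def)
        ultimately show ?thesis using \<gamma>'(3)[OF c fstmem[OF \<xi>]] \<xi> by simp
      qed
      fix \<zeta> assume \<zeta>: "\<zeta> \<in> carrier dualT"
      have "(\<lambda>p\<in>carrier P. fst ((\<xi> \<oplus>\<^bsub>dualT\<^esub> \<zeta>) p))
          = (\<lambda>p\<in>carrier P. fst (\<xi> p)) \<oplus>\<^bsub>dualP\<^esub> (\<lambda>p\<in>carrier P. fst (\<zeta> p))"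
        unfolding ring_dual_ops by (intro restrict_ext) (simp add: T2_fst)
      then show "?G \<gamma> (\<xi> \<oplus>\<^bsub>dualT\<^esub> \<zeta>) = ?G \<gamma> \<xi> \<oplus>\<^bsub>J\<^esub> ?G \<gamma> \<zeta>"
        using \<gamma>'(2)[OF fstmem[OF \<xi>] fstmem[OF \<zeta>]] \<xi> \<zeta> D.M.a_closed[OF \<xi> \<zeta>] by simp
    qed simp
    moreover have "?G \<gamma> (\<lambda>x\<in>carrier P. \<eta> (dT x)) = \<zero>\<^bsub>J\<^esub>"
      if \<eta>: "\<eta> \<in> carrier dualM" for \<eta>
    proof -
      have m: "(\<lambda>x\<in>carrier P. \<eta> (dT x)) \<in> carrier dualT"
        using lin_homD(1)[OF ring_dual_hom[OF left_module_zero_to[OF P] graph_lin_hom[OF P Q f]] \<eta>] by simp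
      obtain g where g: "g \<in> carrier dualQ"
        "(\<lambda>x\<in>carrier P. fst (\<eta> (dT x))) = (\<lambda>x\<in>carrier P. g (f x))"
        using fst_factors[OF \<eta>] by (rule bexE)
      have "(\<lambda>p\<in>carrier P. fst ((\<lambda>x\<in>carrier P. \<eta> (dT x)) p)) = (\<lambda>x\<in>carrier P. g (f x))"
        unfolding g(2)[symmetric] by (intro restrict_ext) simp
      then show ?thesis using m \<gamma> g(1) by (simp add: nakayama_kernel_def)
    qed
    ultimately show "?G \<gamma> \<in> carrier KT" by (simp add: nakayama_kernel_def)
  qed
qed

end

text \<open>In the abelian group \<open>J\<close> only zero equals its own double, and the argument
  is pointwise. It recognises zero without the module axioms of the dual.\<close>

lemma duality_zero_iff:
  assumes J: "left_module k J" and \<gamma>: "\<gamma> \<in> carrier (duality k \<phi> J N)"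
    and eq: "\<gamma> \<oplus>\<^bsub>duality k \<phi> J N\<^esub> \<gamma> = \<gamma>"
  shows "\<gamma> = \<zero>\<^bsub>duality k \<phi> J N\<^esub>"
proof (rule extensionalityI[OF dualityD(4)[OF \<gamma>]])
  interpret J: left_module k J by (rule J)
  show "\<zero>\<^bsub>duality k \<phi> J N\<^esub> \<in> extensional (carrier N)" by (simp add: duality_ops)
  fix x assume x: "x \<in> carrier N"
  have "\<gamma> x \<oplus>\<^bsub>J\<^esub> \<gamma> x = \<gamma> x" using fun_cong[OF eq, of x] x by (simp add: duality_ops)
  then show "\<gamma> x = \<zero>\<^bsub>duality k \<phi> J N\<^esub> x"
    using dualityD(1)[OF \<gamma> x] x by (simp add: duality_ops J.M.add.r_cancel_one)
qed

text \<open>Both translates are isomorphic to kernels, \<open>KT\<close> over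
  \<open>T2 \<Lambda>\<close> and \<open>KR\<close> over \<open>\<Lambda>\<close>, which are
  identified by evaluating functionals at \<open>entry11\<close>. On \<open>KT\<close> the
  idempotent \<open>e11\<close> acts as the identity and \<open>e22\<close> as zero, so the object
  that \<open>T2_to_mor\<close> reads off sits entirely in its target. These facts are pulled back
  to the translate \<open>N\<close> along \<open>F\<close>.\<close>

theorem proposition2p4:
  fixes k :: "('c, 'k) ring_scheme"
    and \<Lambda> :: "('a, 'r) ring_scheme"
    and \<phi> :: "'c \<Rightarrow> 'a"
    and J :: "('c, 'e) module"
    and P :: "('a, 'p) module"
    and Q :: "('a, 'q) module"
    and f :: "'p \<Rightarrow> 'q"
  assumes "artin_algebra k \<phi> \<Lambda>"
    and "dualizing_module k J"
    and "projective_module \<Lambda> P"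
    and "projective_module \<Lambda> Q"
    and "f \<in> lin_hom \<Lambda> P Q"
    and "mor_indecomposable \<Lambda> \<lparr>src = P, tgt = Q, arr = f\<rparr>"
    and "\<not> mor_projective \<Lambda> \<lparr>src = P, tgt = Q, arr = f\<rparr>"
    and "carrier Q \<noteq> {\<zero>\<^bsub>Q\<^esub>}"
  shows "mor_iso \<Lambda>
           (mor_AR_translation k \<phi> J \<Lambda> \<lparr>src = P, tgt = Q, arr = f\<rparr>)
           \<lparr>src = zero_module,
            tgt = AR_translation k \<phi> J \<Lambda> (cokernel P Q f),
            arr = (\<lambda>_. \<zero>\<^bsub>AR_translation k \<phi> J \<Lambda> (cokernel P Q f)\<^esub>)\<rparr>"
proof -
  note alg = assms(1) and f = assms(5)
  have J: "left_module k J"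
    using assms(2) by (simp add: dualizing_module_def injective_envelope_def injective_module_def)
  note P = projective_moduleD[OF assms(3)] and Q = projective_moduleD[OF assms(4)]
  interpret P: left_module \<Lambda> P by (rule P(2))
  interpret J: left_module k J by (rule J)
  note small = indecomposable_image_small[OF alg assms(3-7)]
  have presT:
    "minimal_presentation (T2 \<Lambda>) (zero_to P) (\<lambda>u. (u, \<ominus>\<^bsub>Q\<^esub> f u, \<zero>\<^bsub>P\<^esub>)) (summand_inclusion P Q)
      (\<lambda>(u, q, p). (f u \<oplus>\<^bsub>Q\<^esub> q, p)) (mor_to_T2 \<lparr>src = P, tgt = Q, arr = f\<rparr>)"
    "left_module (T2 \<Lambda>) (mor_to_T2 \<lparr>src = P, tgt = Q, arr = f\<rparr>)"
    by (rule minimal_presentation_T2[OF assms(3-5)], erule small, simp)+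
  note presR = minimal_presentation_cokernel[OF alg assms(3-8)]
  let ?T = "T2 \<Lambda>" and ?X = "mor_to_T2 \<lparr>src = P, tgt = Q, arr = f\<rparr>" and ?C = "cokernel P Q f"
  let ?s = "T2_scalar \<Lambda> \<phi>" and ?D = "ring_dual (T2 \<Lambda>) (zero_to P)"
  define N where "N = AR_translation k ?s J ?T ?X"
  define M where "M = AR_translation k \<phi> J \<Lambda> ?C"
  define KT where "KT = nakayama_kernel k ?s J ?T (zero_to P) (\<lambda>u. (u, \<ominus>\<^bsub>Q\<^esub> f u, \<zero>\<^bsub>P\<^esub>)) (summand_inclusion P Q)"
  define KR where "KR = nakayama_kernel k \<phi> J \<Lambda> P f Q"
  let ?o = "\<zero>\<^bsub>\<Lambda>\<^esub>" and ?i = "\<one>\<^bsub>\<Lambda>\<^esub>" and ?zT = "\<lambda>\<xi>\<in>carrier ?D. \<zero>\<^bsub>J\<^esub>"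
  let ?e11 = "(?i, ?o, ?o)" and ?e12 = "(?o, ?i, ?o)" and ?e22 = "(?o, ?o, ?i)"
  note algT = artin_algebra_T2[OF alg]
  obtain F where "F \<in> lin_iso ?T N KT"
    using AR_translation_lin_iso[OF algT J presT(2,1)] unfolding N_def KT_def by (rule exE)
  note F = lin_isoD[OF this] and F' = lin_homD[OF lin_isoD(1)[OF this]]
  note Ncl = AR_translation_closed[OF algT J presT(2,1), folded N_def]
  note Mcl = AR_translation_closed[OF alg J presR(2,1), folded M_def]
  obtain G where G: "G \<in> lin_iso \<Lambda> M KR"
    using AR_translation_lin_iso[OF alg J presR(2,1)] unfolding M_def KR_def by (rule exE)
  define H where "H = inv_into (carrier M) G"
  have "H \<in> lin_iso \<Lambda> KR M" unfolding H_def by (rule lin_iso_inv_into'[OF G Mcl])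
  note H = lin_isoD[OF this] and H' = lin_homD[OF lin_isoD(1)[OF this]]
  let ?\<Theta> = "\<lambda>\<gamma>. \<lambda>\<alpha>\<in>carrier (ring_dual \<Lambda> P). \<gamma> (entry11 \<Lambda> P \<alpha>)"
  have \<Theta>: "bij_betw ?\<Theta> (carrier KT) (carrier KR)"
    unfolding KT_def KR_def by (rule nakayama_kernel_T2_bij[OF alg J P(2) Q(2) f])
  note entry = nakayama_kernel_T2_entry11[OF alg J P(2) Q(2) f, folded KT_def]
  have KTD: "\<gamma> \<in> carrier (duality k ?s J ?D)" if "\<gamma> \<in> carrier KT" for \<gamma>
    using that by (simp add: KT_def nakayama_kernel_def)
  have KTsmult: "t \<odot>\<^bsub>KT\<^esub> \<gamma> = (\<lambda>\<xi>\<in>carrier ?D. \<gamma> (\<lambda>p\<in>carrier P. \<xi> p \<otimes>\<^bsub>?T\<^esub> t))" for t \<gamma>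
    by (auto simp: KT_def nakayama_kernel_def duality_ops ring_dual_ops intro!: restrict_ext)
  have KTadd: "\<gamma> \<oplus>\<^bsub>KT\<^esub> \<delta> = (\<lambda>\<xi>\<in>carrier ?D. \<gamma> \<xi> \<oplus>\<^bsub>J\<^esub> \<delta> \<xi>)" for \<gamma> \<delta>
    by (simp add: KT_def nakayama_kernel_def duality_ops)
  have KRsmult: "a \<odot>\<^bsub>KR\<^esub> \<gamma> = (\<lambda>\<alpha>\<in>carrier (ring_dual \<Lambda> P). \<gamma> (\<lambda>p\<in>carrier P. \<alpha> p \<otimes>\<^bsub>\<Lambda>\<^esub> a))" for a \<gamma>
    by (auto simp: KR_def nakayama_kernel_def duality_ops ring_dual_ops intro!: restrict_ext)
  have KRadd: "\<gamma> \<oplus>\<^bsub>KR\<^esub> \<delta> = (\<lambda>\<alpha>\<in>carrier (ring_dual \<Lambda> P). \<gamma> \<alpha> \<oplus>\<^bsub>J\<^esub> \<delta> \<alpha>)" for \<gamma> \<delta>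
    by (simp add: KR_def nakayama_kernel_def duality_ops)
  interpret D: left_module "opp_ring ?T" ?D
    by (rule left_module_ring_dual[OF left_module_zero_to[OF P(2)]])
  have Dmem: "(\<lambda>p\<in>carrier P. \<xi> p \<otimes>\<^bsub>?T\<^esub> t) \<in> carrier ?D" if "\<xi> \<in> carrier ?D" "t \<in> carrier ?T" for \<xi> t
    using D.smult_closed[of t \<xi>] that by (simp add: opp_ring_def ring_dual_ops)
  \<comment> \<open>The argument equals its own double, so its value in \<open>J\<close> does too
    and is zero.\<close>
  have zero_entry: "\<gamma> (entry11 \<Lambda> P (\<lambda>p\<in>carrier P. ?o)) = \<zero>\<^bsub>J\<^esub>" if \<gamma>: "\<gamma> \<in> carrier KT" for \<gamma>
  proof -
    let ?z = "entry11 \<Lambda> P (\<lambda>p\<in>carrier P. ?o)"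
    have "(\<lambda>p\<in>carrier P. ?o) \<in> carrier (ring_dual \<Lambda> P)" by (rule ring_dualI) auto
    then have z: "?z \<in> carrier ?D" by (rule entry_mem(1)[OF P(2)])
    have "?z \<oplus>\<^bsub>?D\<^esub> ?z = ?z" by (auto simp: ring_dual_ops entry11_def intro!: restrict_ext)
    then have "\<gamma> ?z \<oplus>\<^bsub>J\<^esub> \<gamma> ?z = \<gamma> ?z" using dualityD(2)[OF KTD[OF \<gamma>] z z] by simp
    then show ?thesis using dualityD(1)[OF KTD[OF \<gamma>] z] by (simp add: J.M.add.r_cancel_one)
  qed
  \<comment> \<open>Right multiplication by \<open>e22\<close> clears the first entry of every value
    of \<open>\<xi>\<close>, and by \<open>entry\<close> a functional in \<open>KT\<close> sees
    nothing else.\<close>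
  have e22: "?e22 \<odot>\<^bsub>KT\<^esub> \<gamma> = ?zT" if \<gamma>: "\<gamma> \<in> carrier KT" for \<gamma>
    unfolding KTsmult
  proof (rule restrict_ext)
    fix \<xi> assume \<xi>: "\<xi> \<in> carrier ?D"
    have "(\<lambda>p\<in>carrier P. fst ((\<lambda>p\<in>carrier P. \<xi> p \<otimes>\<^bsub>?T\<^esub> ?e22) p)) = (\<lambda>p\<in>carrier P. ?o)"
    proof (rule restrict_ext)
      fix p assume p: "p \<in> carrier P"
      then have "\<xi> p \<in> carrier ?T" using ring_dualD(1)[OF \<xi>] by simp
      then show "fst ((\<lambda>p\<in>carrier P. \<xi> p \<otimes>\<^bsub>?T\<^esub> ?e22) p) = ?o" using p by (elim T2_cases) simp
    qed
    then show "\<gamma> (\<lambda>p\<in>carrier P. \<xi> p \<otimes>\<^bsub>?T\<^esub> ?e22) = \<zero>\<^bsub>J\<^esub>"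
      using entry[OF \<gamma> Dmem[OF \<xi>, of ?e22]] zero_entry[OF \<gamma>] by simp
  qed
  \<comment> \<open>Right multiplication by \<open>e11\<close> keeps the first entry and clears the
    others, which makes no difference to \<open>\<gamma>\<close>.\<close>
  have e11: "?e11 \<odot>\<^bsub>KT\<^esub> \<gamma> = \<gamma>" if \<gamma>: "\<gamma> \<in> carrier KT" for \<gamma>
  proof (rule extensionalityI[where A = "carrier ?D"])
    show "?e11 \<odot>\<^bsub>KT\<^esub> \<gamma> \<in> extensional (carrier ?D)" by (simp add: KTsmult)
    show "\<gamma> \<in> extensional (carrier ?D)" by (rule dualityD(4)[OF KTD[OF \<gamma>]])
    fix \<xi> assume \<xi>: "\<xi> \<in> carrier ?D"
    have "(\<lambda>p\<in>carrier P. fst ((\<lambda>p\<in>carrier P. \<xi> p \<otimes>\<^bsub>?T\<^esub> ?e11) p)) = (\<lambda>p\<in>carrier P. fst (\<xi> p))"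
    proof (rule restrict_ext)
      fix p assume p: "p \<in> carrier P"
      then have "\<xi> p \<in> carrier ?T" using ring_dualD(1)[OF \<xi>] by simp
      then show "fst ((\<lambda>p\<in>carrier P. \<xi> p \<otimes>\<^bsub>?T\<^esub> ?e11) p) = fst (\<xi> p)" using p by (elim T2_cases) simp
    qed
    then show "(?e11 \<odot>\<^bsub>KT\<^esub> \<gamma>) \<xi> = \<gamma> \<xi>"
      using entry[OF \<gamma> Dmem[OF \<xi>, of ?e11]] entry[OF \<gamma> \<xi>] \<xi> by (simp add: KTsmult)
  qed
  have Ne11: "?e11 \<odot>\<^bsub>N\<^esub> x = x" if "x \<in> carrier N" for x
  proof (rule inj_onD[OF F(3) _ _ that])
    show "?e11 \<odot>\<^bsub>N\<^esub> x \<in> carrier N" by (rule Ncl(2)[OF _ that]) simp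
    show "F (?e11 \<odot>\<^bsub>N\<^esub> x) = F x" using F'(3)[of ?e11 x] e11[OF F'(1)[OF that]] that by simp
  qed
  have Fe22: "F (?e22 \<odot>\<^bsub>N\<^esub> x) = ?zT" and Ne22: "?e22 \<odot>\<^bsub>N\<^esub> x \<in> carrier N"
    if "x \<in> carrier N" for x
    using F'(3)[of ?e22 x] e22[OF F'(1)[OF that]] Ncl(2)[of ?e22 x] that by simp_all
  \<comment> \<open>The zero functional lies in \<open>KT\<close>. A point of \<open>N\<close> is
    wanted because the source carrier, an image of \<open>carrier N\<close>, has to be a singleton
    and not empty.\<close>
  have NM: "carrier N \<noteq> {}"
  proof -
    have dT: "(\<lambda>x\<in>carrier P. \<eta> (x, \<ominus>\<^bsub>Q\<^esub> f x, \<zero>\<^bsub>P\<^esub>)) \<in> carrier ?D"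
      if "\<eta> \<in> carrier (ring_dual ?T (summand_inclusion P Q))" for \<eta>
      using lin_homD(1)[OF ring_dual_hom[OF left_module_zero_to[OF P(2)] graph_lin_hom[OF P(2) Q(2) f]] that]
      by simp
    have "?zT \<in> carrier (duality k ?s J ?D)"
    proof (rule dualityI)
      fix c \<xi> assume c: "c \<in> carrier k" and \<xi>: "\<xi> \<in> carrier ?D"
      have "?s c \<odot>\<^bsub>?D\<^esub> \<xi> \<in> carrier ?D"
        using D.smult_closed[of "?s c" \<xi>] \<xi> artin_algebraD(7)[OF algT c] by (simp add: opp_ring_def)
      then show "?zT (?s c \<odot>\<^bsub>?D\<^esub> \<xi>) = c \<odot>\<^bsub>J\<^esub> ?zT \<xi>"
        using c \<xi> by (simp add: J.smult_r_null)
    qed simp_all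
    then have "?zT \<in> carrier KT"
      using dT by (simp add: KT_def nakayama_kernel_def)
    then show ?thesis using F(4) by auto
  qed
  \<comment> \<open>The comparison map runs from the translate over \<open>T2 \<Lambda>\<close> to
    its kernel description, across to the kernel over \<open>\<Lambda>\<close>, and back into the
    translate of the cokernel.\<close>
  let ?h = "\<lambda>x. H (?\<Theta> (F x))"
  have h: "bij_betw ?h (carrier N) (carrier M)"
    using bij_betw_trans[OF bij_betw_trans[OF F(2) \<Theta>] H(2)] by (simp add: comp_def)
  have \<Theta>mem: "?\<Theta> \<gamma> \<in> carrier KR" if "\<gamma> \<in> carrier KT" for \<gamma>
    using bij_betwE[OF \<Theta>] that by blast
  have hadd: "?h (x \<oplus>\<^bsub>N\<^esub> y) = ?h x \<oplus>\<^bsub>M\<^esub> ?h y" if "x \<in> carrier N" "y \<in> carrier N" for x y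
  proof -
    have "?\<Theta> (F x \<oplus>\<^bsub>KT\<^esub> F y) = ?\<Theta> (F x) \<oplus>\<^bsub>KR\<^esub> ?\<Theta> (F y)"
      unfolding KTadd KRadd using entry_mem(1)[OF P(2)] by (intro restrict_ext) simp
    then show ?thesis using F'(2)[OF that] H'(2)[OF \<Theta>mem[OF F'(1)] \<Theta>mem[OF F'(1)], OF that] by simp
  qed
  have hsmult: "?h ((a, ?o, a) \<odot>\<^bsub>N\<^esub> x) = a \<odot>\<^bsub>M\<^esub> ?h x" if a: "a \<in> carrier \<Lambda>" and x: "x \<in> carrier N" for a x
  proof -
    have "?\<Theta> ((a, ?o, a) \<odot>\<^bsub>KT\<^esub> F x) = a \<odot>\<^bsub>KR\<^esub> ?\<Theta> (F x)"
      unfolding KTsmult KRsmult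
    proof (rule restrict_ext)
      fix \<alpha> assume \<alpha>: "\<alpha> \<in> carrier (ring_dual \<Lambda> P)"
      interpret DR: left_module "opp_ring \<Lambda>" "ring_dual \<Lambda> P" by (rule left_module_ring_dual[OF P(2)])
      have "(\<lambda>p\<in>carrier P. \<alpha> p \<otimes>\<^bsub>\<Lambda>\<^esub> a) \<in> carrier (ring_dual \<Lambda> P)"
        using DR.smult_closed[of a \<alpha>] \<alpha> a by (simp add: opp_ring_def ring_dual_ops)
      moreover have "(\<lambda>p\<in>carrier P. entry11 \<Lambda> P \<alpha> p \<otimes>\<^bsub>?T\<^esub> (a, ?o, a))
          = entry11 \<Lambda> P (\<lambda>p\<in>carrier P. \<alpha> p \<otimes>\<^bsub>\<Lambda>\<^esub> a)"
        using ring_dualD(1)[OF \<alpha>] a by (auto simp: entry11_def intro!: restrict_ext)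
      ultimately show "(\<lambda>\<xi>\<in>carrier ?D. F x (\<lambda>p\<in>carrier P. \<xi> p \<otimes>\<^bsub>?T\<^esub> (a, ?o, a))) (entry11 \<Lambda> P \<alpha>)
          = ?\<Theta> (F x) (\<lambda>p\<in>carrier P. \<alpha> p \<otimes>\<^bsub>\<Lambda>\<^esub> a)"
        using entry_mem(1)[OF P(2) \<alpha>] by simp
    qed
    then show ?thesis
      using F'(3)[of "(a, ?o, a)" x] H'(3)[OF a \<Theta>mem[OF F'(1)[OF x]]] a x by simp
  qed
  have h0: "?h (?e12 \<odot>\<^bsub>N\<^esub> (?e22 \<odot>\<^bsub>N\<^esub> x)) = \<zero>\<^bsub>M\<^esub>" if x: "x \<in> carrier N" for x
  proof -
    let ?y = "?e12 \<odot>\<^bsub>N\<^esub> (?e22 \<odot>\<^bsub>N\<^esub> x)"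
    have y: "?y \<in> carrier N" by (rule Ncl(2)[OF _ Ne22[OF x]]) simp
    have "F ?y = ?e12 \<odot>\<^bsub>KT\<^esub> ?zT"
      using F'(3)[OF _ Ne22[OF x], of ?e12] Fe22[OF x] by simp
    also have "\<dots> = ?zT"
      unfolding KTsmult using Dmem[of _ ?e12] by (intro restrict_ext) simp
    finally have Fy: "F ?y = ?zT" .
    \<comment> \<open>The zero functional equals its own double; injectivity of \<open>F\<close>
      carries this to \<open>?y\<close>, additivity of \<open>?h\<close> to its image in
      \<open>M\<close>, where \<open>duality_zero_iff\<close> concludes.\<close>
    have "F (?y \<oplus>\<^bsub>N\<^esub> ?y) = F ?y"
      unfolding F'(2)[OF y y] unfolding Fy KTadd by (intro restrict_ext) simp
    then have "?y \<oplus>\<^bsub>N\<^esub> ?y = ?y" using inj_onD[OF F(3)] Ncl(1)[OF y y] y by metis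
    then have "?h ?y \<oplus>\<^bsub>M\<^esub> ?h ?y = ?h ?y" using hadd[OF y y] by simp
    moreover have "?h ?y \<in> carrier M" using bij_betwE[OF h] y by blast
    ultimately show ?thesis unfolding M_def AR_translation_def by (intro duality_zero_iff[OF J])
  qed
  let ?Y = "T2_to_mor \<Lambda> N"
  have Ysrc: "carrier (src ?Y) = (\<lambda>x. ?e22 \<odot>\<^bsub>N\<^esub> x) ` carrier N"
    and Ytgt: "carrier (tgt ?Y) = carrier N"
    and Yadd: "add (tgt ?Y) = add N"
    and Ysmult: "\<And>a x. a \<odot>\<^bsub>tgt ?Y\<^esub> x = (a, ?o, a) \<odot>\<^bsub>N\<^esub> x"
    and Yarr: "arr ?Y = (\<lambda>x. ?e12 \<odot>\<^bsub>N\<^esub> x)"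
    using Ne11 by (auto simp: T2_to_mor_def Let_def)
  obtain z where z: "z \<in> carrier N" using NM by blast
  \<comment> \<open>\<open>F\<close> is injective and sends every multiple by \<open>e22\<close> to
    the same zero functional.\<close>
  have single: "carrier (src ?Y) = {?e22 \<odot>\<^bsub>N\<^esub> z}"
  proof -
    have "?e22 \<odot>\<^bsub>N\<^esub> x = ?e22 \<odot>\<^bsub>N\<^esub> z" if x: "x \<in> carrier N" for x
      using inj_onD[OF F(3) _ Ne22[OF x] Ne22[OF z]] Fe22[OF x] Fe22[OF z] by simp
    then show ?thesis unfolding Ysrc using z by blast
  qed
  have "(\<lambda>_. (), ?h) \<in> mor_hom \<Lambda> ?Y \<lparr>src = zero_module, tgt = M, arr = \<lambda>_. \<zero>\<^bsub>M\<^esub>\<rparr>"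
  proof -
    have "?h \<in> lin_hom \<Lambda> (tgt ?Y) M"
      using bij_betwE[OF h] hadd hsmult by (intro lin_homI) (simp_all add: Ytgt Yadd Ysmult)
    moreover have "(\<lambda>_. ()) \<in> lin_hom \<Lambda> (src ?Y) zero_module"
      by (auto simp: lin_hom_def zero_module_def)
    ultimately show ?thesis using h0 by (simp add: mor_hom_def Ysrc Yarr)
  qed
  moreover have "bij_betw (\<lambda>_. ()) (carrier (src ?Y)) (carrier zero_module)"
    unfolding single by (simp add: bij_betw_def zero_module_def)
  ultimately have "mor_iso \<Lambda> ?Y \<lparr>src = zero_module, tgt = M, arr = \<lambda>_. \<zero>\<^bsub>M\<^esub>\<rparr>"
    using h unfolding mor_iso_def by (intro bexI[of _ "(\<lambda>_. (), ?h)"]) (simp_all add: Ytgt)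
  then show ?thesis by (simp add: mor_AR_translation_def N_def M_def)
qed

end
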